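(* Any data structure for dynamic connectivity on $n$ vertices in the external-memory model with page size $B$ must satisfy $t_q\left(\lg B+\lg\frac{t_u}{t_q}\right)=\Omega(\lg n)$, where $t_u$ is the (amortized expected) number of page transfers of \texttt{insert}/\texttt{delete} and $t_q$ that of \texttt{connected}. This bound allows amortization, Las Vegas randomization and nondeterminism, and holds even if the graph is always a disjoint union of paths.
   Context: Throughout, $\lg x$ denotes $\log_2(2+x)$. Dynamic connectivity: maintain an undirected graph on a fixed set of $n$ vertices under $\texttt{insert}(u,v)$, $\texttt{delete}(u,v)$ and $\texttt{connected}(u,v)$ (test whether $u,v$ lie in the same connected component). External-memory model (general form): memory is divided into pages, each holding $B$ cells of $\lg n$ bits (so $B\lg n$ bits per page); data may be manipulated arbitrarily and the cost of an operation is only the number of pages read or written (this is the cell-probe model with $(B\lg n)$-bit cells). Nondeterministic queries: a query spawns threads, answers ``yes'' iff some thread accepts, costs the maximum over threads; rejecting threads write nothing and all accepting threads write identical values. Las Vegas randomization: some memory initialized uniformly at random at creation, thereafter deterministic and always correct, costs measured in expectation. *)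

theory Defs
  imports "HOL-Probability.Probability"
begin

definition lg :: "real \<Rightarrow> real" where
  "lg x = log 2 (2 + x)"


section \<open>The cell-probe machine with pages of \<open>B\<close> cells\<close>

definition cell_bits :: "nat \<Rightarrow> nat" where
  "cell_bits n = nat \<lceil>lg (real n)\<rceil>"

definition page_bits :: "nat \<Rightarrow> nat \<Rightarrow> nat" where
  "page_bits n B = B * cell_bits n"

text \<open>A memory maps page addresses to page contents; a content is the number below
  \<open>2 ^ page_bits n B\<close> that its bits encode.\<close>

type_synonym memory = "nat \<Rightarrow> nat"

text \<open>An algorithm is an arbitrary (non-uniform) decision tree of probes: computation between
  probes is free and unrestricted, and nothing but the memory survives from one operation to
  the next.\<close>

datatype 'r prog =
    Return 'r
  | Read nat "nat \<Rightarrow> 'r prog"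
  | Write nat nat "'r prog"

primrec result :: "'r prog \<Rightarrow> memory \<Rightarrow> 'r" where
  "result (Return r) m = r"
| "result (Read a k) m = result (k (m a)) m"
| "result (Write a x p) m = result p (m(a := x))"

text \<open>The written pages, each with the last value written to it.\<close>

primrec writes :: "'r prog \<Rightarrow> memory \<Rightarrow> (nat \<rightharpoonup> nat)" where
  "writes (Return r) m = Map.empty"
| "writes (Read a k) m = writes (k (m a)) m"
| "writes (Write a x p) m = [a \<mapsto> x] ++ writes p (m(a := x))"

primrec probes :: "'r prog \<Rightarrow> memory \<Rightarrow> nat" where
  "probes (Return r) m = 0"
| "probes (Read a k) m = Suc (probes (k (m a)) m)"
| "probes (Write a x p) m = Suc (probes p (m(a := x)))"

definition final_memory :: "'r prog \<Rightarrow> memory \<Rightarrow> memory" where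
  "final_memory p m = (\<lambda>a. case writes p m a of None \<Rightarrow> m a | Some x \<Rightarrow> x)"

primrec wf_prog :: "nat \<Rightarrow> nat \<Rightarrow> 'r prog \<Rightarrow> bool" where
  "wf_prog S w (Return r) \<longleftrightarrow> True"
| "wf_prog S w (Read a k) \<longleftrightarrow> a < S \<and> (\<forall>x < 2 ^ w. wf_prog S w (k x))"
| "wf_prog S w (Write a x p) \<longleftrightarrow> a < S \<and> x < 2 ^ w \<and> wf_prog S w p"


section \<open>Queries\<close>

text \<open>A nondeterministic query is the set of its threads. Ordinary queries are kept apart, since
  they may write to memory also when their answer is negative, which rejecting threads may not.\<close>

datatype query =
    Deterministic "bool prog"
  | Nondeterministic "bool prog set"

fun answer :: "query \<Rightarrow> memory \<Rightarrow> bool" where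
  "answer (Deterministic p) m \<longleftrightarrow> result p m"
| "answer (Nondeterministic T) m \<longleftrightarrow> (\<exists>p\<in>T. result p m)"

fun query_cost :: "query \<Rightarrow> memory \<Rightarrow> nat" where
  "query_cost (Deterministic p) m = probes p m"
| "query_cost (Nondeterministic T) m = Max ((\<lambda>p. probes p m) ` T)"

text \<open>The choice of the accepting thread below is immaterial under \<open>write_discipline\<close>.\<close>

fun query_memory :: "query \<Rightarrow> memory \<Rightarrow> memory" where
  "query_memory (Deterministic p) m = final_memory p m"
| "query_memory (Nondeterministic T) m =
     (if \<exists>p\<in>T. result p m then final_memory (SOME p. p \<in> T \<and> result p m) m else m)"

fun write_discipline :: "query \<Rightarrow> memory \<Rightarrow> bool" where
  "write_discipline (Deterministic p) m \<longleftrightarrow> True"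
| "write_discipline (Nondeterministic T) m \<longleftrightarrow>
     (\<forall>p\<in>T. \<not> result p m \<longrightarrow> writes p m = Map.empty) \<and>
     (\<forall>p\<in>T. \<forall>q\<in>T. result p m \<longrightarrow> result q m \<longrightarrow> writes p m = writes q m)"

fun wf_query :: "nat \<Rightarrow> nat \<Rightarrow> query \<Rightarrow> bool" where
  "wf_query S w (Deterministic p) \<longleftrightarrow> wf_prog S w p"
| "wf_query S w (Nondeterministic T) \<longleftrightarrow> finite T \<and> T \<noteq> {} \<and> (\<forall>p\<in>T. wf_prog S w p)"


section \<open>Dynamic graphs\<close>

text \<open>A graph on the vertices \<open>0, \<dots>, n - 1\<close> is given by its set of edges \<open>{u, v}\<close>,
  \<open>u \<noteq> v\<close>.\<close>

type_synonym graph = "nat set set"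

definition joined :: "graph \<Rightarrow> nat \<Rightarrow> nat \<Rightarrow> bool" where
  "joined E u v \<longleftrightarrow> (u, v) \<in> {(x, y). {x, y} \<in> E}\<^sup>*"

definition path_edges :: "nat list \<Rightarrow> graph" where
  "path_edges p = {{p ! i, p ! Suc i} | i. Suc i < length p}"

text \<open>Isolated vertices are paths without edges.\<close>

definition unions_of_paths :: "graph set" where
  "unions_of_paths = {E. \<exists>P. (\<forall>p\<in>P. distinct p) \<and>
     (\<forall>p\<in>P. \<forall>q\<in>P. p \<noteq> q \<longrightarrow> set p \<inter> set q = {}) \<and> E = (\<Union>p\<in>P. path_edges p)}"

datatype operation = Insert nat nat | Delete nat nat | Connected nat nat

fun is_query :: "operation \<Rightarrow> bool" where
  "is_query (Connected u v) = True"
| "is_query _ = False"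

fun apply_op :: "operation \<Rightarrow> graph \<Rightarrow> graph" where
  "apply_op (Insert u v) E = insert {u, v} E"
| "apply_op (Delete u v) E = E - {{u, v}}"
| "apply_op (Connected u v) E = E"

fun legal_op :: "nat \<Rightarrow> operation \<Rightarrow> graph \<Rightarrow> bool" where
  "legal_op n (Insert u v) E \<longleftrightarrow> u < n \<and> v < n \<and> u \<noteq> v \<and> {u, v} \<notin> E"
| "legal_op n (Delete u v) E \<longleftrightarrow> u < n \<and> v < n \<and> {u, v} \<in> E"
| "legal_op n (Connected u v) E \<longleftrightarrow> u < n \<and> v < n"

text \<open>Operation sequences that keep the graph inside the class \<open>\<G>\<close> all the time.\<close>

primrec legal_ops :: "nat \<Rightarrow> graph set \<Rightarrow> operation list \<Rightarrow> graph \<Rightarrow> bool" where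
  "legal_ops n \<G> [] E \<longleftrightarrow> True"
| "legal_ops n \<G> (x # xs) E \<longleftrightarrow>
     legal_op n x E \<and> apply_op x E \<in> \<G> \<and> legal_ops n \<G> xs (apply_op x E)"

definition graph_after :: "operation list \<Rightarrow> graph" where
  "graph_after xs = fold apply_op xs {}"


section \<open>Data structures for dynamic connectivity\<close>

record data_structure =
  num_pages :: nat
  init_page :: "nat \<Rightarrow> nat"
  random_pages :: "nat set"
  insert_prog :: "nat \<Rightarrow> nat \<Rightarrow> unit prog"
  delete_prog :: "nat \<Rightarrow> nat \<Rightarrow> unit prog"
  connected_query :: "nat \<Rightarrow> nat \<Rightarrow> query"

text \<open>As usual in the cell-probe model the address of a page has \<open>O(w)\<close> bits, where \<open>w\<close> is the
  number of bits of a page; \<open>C\<close> is the constant hidden in this \<open>O\<close>.\<close>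

definition wf_data_structure :: "nat \<Rightarrow> nat \<Rightarrow> nat \<Rightarrow> data_structure \<Rightarrow> bool" where
  "wf_data_structure C n B D \<longleftrightarrow>
     (let w = page_bits n B; S = num_pages D in
       S \<le> 2 ^ (C * w) \<and>
       (\<forall>a<S. init_page D a < 2 ^ w) \<and>
       random_pages D \<subseteq> {..<S} \<and>
       (\<forall>u<n. \<forall>v<n. wf_prog S w (insert_prog D u v) \<and> wf_prog S w (delete_prog D u v) \<and>
          wf_query S w (connected_query D u v)))"

definition initial_memories :: "nat \<Rightarrow> nat \<Rightarrow> data_structure \<Rightarrow> memory set" where
  "initial_memories n B D =
     {m. (\<forall>a\<in>random_pages D. m a < 2 ^ page_bits n B) \<and>
         (\<forall>a. a \<notin> random_pages D \<longrightarrow> m a = init_page D a)}"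

fun op_memory :: "data_structure \<Rightarrow> operation \<Rightarrow> memory \<Rightarrow> memory" where
  "op_memory D (Insert u v) m = final_memory (insert_prog D u v) m"
| "op_memory D (Delete u v) m = final_memory (delete_prog D u v) m"
| "op_memory D (Connected u v) m = query_memory (connected_query D u v) m"

fun op_cost :: "data_structure \<Rightarrow> operation \<Rightarrow> memory \<Rightarrow> nat" where
  "op_cost D (Insert u v) m = probes (insert_prog D u v) m"
| "op_cost D (Delete u v) m = probes (delete_prog D u v) m"
| "op_cost D (Connected u v) m = query_cost (connected_query D u v) m"

definition memory_after :: "data_structure \<Rightarrow> operation list \<Rightarrow> memory \<Rightarrow> memory" where
  "memory_after D xs m = fold (op_memory D) xs m"

primrec total_cost :: "data_structure \<Rightarrow> operation list \<Rightarrow> memory \<Rightarrow> nat" where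
  "total_cost D [] m = 0"
| "total_cost D (x # xs) m = op_cost D x m + total_cost D xs (op_memory D x m)"

definition solves_connectivity ::
    "nat \<Rightarrow> nat \<Rightarrow> nat \<Rightarrow> graph set \<Rightarrow> data_structure \<Rightarrow> bool" where
  "solves_connectivity C n B \<G> D \<longleftrightarrow>
     wf_data_structure C n B D \<and>
     (\<forall>m\<in>initial_memories n B D. \<forall>xs. legal_ops n \<G> xs {} \<longrightarrow>
       (\<forall>u<n. \<forall>v<n.
          write_discipline (connected_query D u v) (memory_after D xs m) \<and>
          (answer (connected_query D u v) (memory_after D xs m) \<longleftrightarrow> joined (graph_after xs) u v)))"

text \<open>The amortized expected costs of an update and of a query are (at most) \<open>t\<^sub>u\<close> and \<open>t\<^sub>q\<close>.\<close>

definition amortized_expected_costs ::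
    "nat \<Rightarrow> nat \<Rightarrow> graph set \<Rightarrow> data_structure \<Rightarrow> real \<Rightarrow> real \<Rightarrow> bool" where
  "amortized_expected_costs n B \<G> D t\<^sub>u t\<^sub>q \<longleftrightarrow>
     (\<forall>xs. legal_ops n \<G> xs {} \<longrightarrow>
       measure_pmf.expectation (pmf_of_set (initial_memories n B D)) (\<lambda>m. real (total_cost D xs m))
         \<le> t\<^sub>u * real (length (filter (\<lambda>x. \<not> is_query x) xs))
           + t\<^sub>q * real (length (filter is_query xs)))"

end

theory Submission
  imports Defs
begin

text \<open>The proof follows Patrascu and Demaine. The graph consists of rows of vertices in \<open>N + 1\<close>
  layers; consecutive layers are linked by permutations, so a query between layer 0 and layer \<open>j\<close>
  evaluates a product of \<open>j\<close> permutations. Blocks of updates, each replacing one link by a random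
  permutation, alternate with about \<open>t\<^sub>u / t\<^sub>q\<close> times as many random queries with positive answers.
  The columns are updated in digit-reversed order to base \<open>b = O(B (1 + t\<^sub>u / t\<^sub>q))\<close>, and the blocks
  of time form the leaves of a \<open>b\<close>-ary tree of depth \<open>d = \<Omega>(lg n / lg b)\<close>.

  Every read of a cell is charged to the tree level on which the blocks writing and reading it get
  separated. If \<open>t\<^sub>q\<close> were much smaller than \<open>d\<close>, then on some level few cells would be transferred
  from the earlier siblings \<open>I\<close> of a group of blocks into the group, and most queries at some slot
  of the group would read nothing written in \<open>I\<close>. The permutations of \<open>I\<close> could then be recovered
  from too little information: the transferred cells, the answers in the group, and a set of cells
  that contains those read in the group, but not written in \<open>I\<close>, and avoids those written in \<open>I\<close>.
  Such a set lets one trust any accepting thread of a nondeterministic query. It is the zero set of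
  a function to \<open>2 q\<close> values, where \<open>q\<close> is about \<open>t\<^sub>u / t\<^sub>q\<close>; averaging over all these functions costs
  \<open>O(lg q)\<close> bits per cell read, and this is affordable because \<open>t\<^sub>q lg q\<close> is small compared to
  \<open>lg n\<close>.\<close>

section \<open>Reads and writes of an operation\<close>

text \<open>The permutations of \<open>I\<close> carry on the order of \<open>P * M * lg n\<close>
  bits, and each part of the encoding must stay a constant factor below this. A query names its end
  vertex, which depends on the hidden permutations; so the ends of all queries of the group,
  \<open>L * q * M\<close> numbers of \<open>O(lg n)\<close> bits, have to be recorded, which forces
  \<open>b\<close> to be a large multiple of \<open>q\<close>. A transferred cell costs
  \<open>O(B * lg n)\<close> bits for address and content, whence the factor \<open>B\<close> of
  \<open>b\<close>.

  Digit reversal puts the columns of \<open>I\<close> into one residue class modulo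
  \<open>g\<close>, where \<open>N = P * g\<close>. Hence \<open>P\<close> prefixes whose ends lie
  \<open>g\<close> apart isolate them. These prefixes are asked hypothetically at one slot, all
  \<open>P * M\<close> of them in the same memory; each is a possible value of the random query
  there, so averages bound their cost.

  Since \<open>q\<close> is at least \<open>t\<^sub>u / t\<^sub>q\<close>, updates cost no more than
  a constant times the queries. Cells written in \<open>I\<close> may outnumber the hypothetical
  queries by a factor of about \<open>q * t\<^sub>q\<close>; with \<open>2 * q\<close> values each
  such cell loses only \<open>O(1 / q)\<close> bits.\<close>

primrec reads :: "'r prog \<Rightarrow> memory \<Rightarrow> nat set" where
  "reads (Return r) m = {}"
| "reads (Read a k) m = insert a (reads (k (m a)) m)"
| "reads (Write a x p) m = reads p (m(a := x))"

lemma finite_reads: "finite (reads p m)"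
  by (induction p arbitrary: m) auto

lemma finite_dom_writes: "finite (dom (writes p m))"
  by (induction p arbitrary: m) auto

lemma card_reads_writes: "card (reads p m) + card (dom (writes p m)) \<le> probes p m"
proof (induction p arbitrary: m)
  case (Read a k)
  have "card (reads (k (m a)) m) + card (dom (writes (k (m a)) m)) \<le> probes (k (m a)) m"
    using Read by blast
  then show ?case
    by (simp add: card_insert_if finite_reads)
next
  case (Write a x p)
  have "dom (writes (Write a x p) m) \<subseteq> insert a (dom (writes p (m(a := x))))"
    by auto
  then have "card (dom (writes (Write a x p) m)) \<le> Suc (card (dom (writes p (m(a := x)))))"
    by (metis card_insert_if card_mono finite.insertI finite_dom_writes le_SucI)
  then show ?case
    using Write[of "m(a := x)"] by (simp del: fun_upd_apply)
qed simp

lemma prog_cong: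
  assumes "\<And>a. a \<in> reads p m \<Longrightarrow> m' a = m a"
  shows "result p m' = result p m \<and> writes p m' = writes p m"
  using assms
proof (induction p arbitrary: m m')
  case (Read a k)
  have "m' a = m a" using Read.prems[of a] by simp
  moreover have "result (k (m a)) m' = result (k (m a)) m \<and> writes (k (m a)) m' = writes (k (m a)) m"
    by (rule Read.IH[OF rangeI]) (simp add: Read.prems)
  ultimately show ?case by simp
next
  case (Write a x p)
  have "result p (m'(a := x)) = result p (m(a := x)) \<and> writes p (m'(a := x)) = writes p (m(a := x))"
  proof (rule Write.IH)
    fix b assume "b \<in> reads p (m(a := x))"
    then show "(m'(a := x)) b = (m(a := x)) b" using Write.prems[of b] by simp
  qed
  then show ?case by (simp del: fun_upd_apply)
qed simp

definition valid_memory :: "nat \<Rightarrow> nat \<Rightarrow> memory \<Rightarrow> bool" where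
  "valid_memory S w m \<longleftrightarrow> (\<forall>a<S. m a < 2 ^ w)"

lemma wf_prog_bounds:
  assumes "wf_prog S w p" "valid_memory S w m"
  shows "reads p m \<subseteq> {..<S} \<and> (\<forall>a x. writes p m a = Some x \<longrightarrow> a < S \<and> x < 2 ^ w)"
  using assms
proof (induction p arbitrary: m)
  case (Read a k)
  then have "wf_prog S w (k (m a))" by (auto simp: valid_memory_def)
  with Read.IH[OF rangeI this Read.prems(2)] Read.prems show ?case by simp
next
  case (Write a x p)
  have "valid_memory S w (m(a := x))"
    using Write.prems by (auto simp: valid_memory_def)
  then have *: "reads p (m(a := x)) \<subseteq> {..<S} \<and>
      (\<forall>b y. writes p (m(a := x)) b = Some y \<longrightarrow> b < S \<and> y < 2 ^ w)"
    using Write.IH[of "m(a := x)"] Write.prems(1) unfolding wf_prog.simps by blast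
  have "b < S \<and> y < 2 ^ w" if "writes (Write a x p) m b = Some y" for b y
  proof -
    have "writes p (m(a := x)) b = Some y \<or> b = a \<and> y = x"
      using that unfolding writes.simps map_add_Some_iff by (auto split: if_splits)
    then show ?thesis using * Write.prems(1) unfolding wf_prog.simps by blast
  qed
  then show ?case using * unfolding reads.simps by blast
qed simp

lemma valid_final_memory:
  assumes "wf_prog S w p" "valid_memory S w m"
  shows "valid_memory S w (final_memory p m)"
  using wf_prog_bounds[OF assms] assms(2)
  by (auto simp: valid_memory_def final_memory_def split: option.split)

text \<open>The chosen thread is literally the one in \<open>query_memory\<close>; so the memory
  after an accepted query is the final memory of this thread, whether or not the write discipline
  holds. After a rejection the choice is meaningless, and therefore \<open>accepted\<close> is
  assumed below.\<close>

fun query_prog :: "query \<Rightarrow> memory \<Rightarrow> bool prog" where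
  "query_prog (Deterministic p) m = p"
| "query_prog (Nondeterministic T) m = (SOME p. p \<in> T \<and> result p m)"

fun op_reads :: "data_structure \<Rightarrow> operation \<Rightarrow> memory \<Rightarrow> nat set" where
  "op_reads D (Insert u v) m = reads (insert_prog D u v) m"
| "op_reads D (Delete u v) m = reads (delete_prog D u v) m"
| "op_reads D (Connected u v) m = reads (query_prog (connected_query D u v) m) m"

fun op_writes :: "data_structure \<Rightarrow> operation \<Rightarrow> memory \<Rightarrow> (nat \<rightharpoonup> nat)" where
  "op_writes D (Insert u v) m = writes (insert_prog D u v) m"
| "op_writes D (Delete u v) m = writes (delete_prog D u v) m"
| "op_writes D (Connected u v) m = writes (query_prog (connected_query D u v) m) m"

fun accepted :: "data_structure \<Rightarrow> operation \<Rightarrow> memory \<Rightarrow> bool" where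
  "accepted D (Connected u v) m \<longleftrightarrow> answer (connected_query D u v) m"
| "accepted D _ m \<longleftrightarrow> True"

fun disciplined :: "data_structure \<Rightarrow> operation \<Rightarrow> memory \<Rightarrow> bool" where
  "disciplined D (Connected u v) m \<longleftrightarrow> write_discipline (connected_query D u v) m"
| "disciplined D _ m \<longleftrightarrow> True"

fun wf_op :: "nat \<Rightarrow> nat \<Rightarrow> data_structure \<Rightarrow> operation \<Rightarrow> bool" where
  "wf_op S w D (Insert u v) \<longleftrightarrow> wf_prog S w (insert_prog D u v)"
| "wf_op S w D (Delete u v) \<longleftrightarrow> wf_prog S w (delete_prog D u v)"
| "wf_op S w D (Connected u v) \<longleftrightarrow> wf_query S w (connected_query D u v)"

lemma query_prog_accepting:
  assumes "answer Q m"
  shows "result (query_prog Q m) m"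
    and "query_memory Q m = final_memory (query_prog Q m) m"
    and "Q = Nondeterministic T \<Longrightarrow> query_prog Q m \<in> T"
proof -
  have *: "result (query_prog Q m) m \<and> (\<forall>T. Q = Nondeterministic T \<longrightarrow> query_prog Q m \<in> T)"
  proof (cases Q)
    case (Nondeterministic T)
    then have "\<exists>p. p \<in> T \<and> result p m" using assms by auto
    from someI_ex[OF this] Nondeterministic show ?thesis by simp
  qed (use assms in simp)
  show "result (query_prog Q m) m" using * by blast
  show "Q = Nondeterministic T \<Longrightarrow> query_prog Q m \<in> T" using * by blast
  show "query_memory Q m = final_memory (query_prog Q m) m"
    using assms by (cases Q) auto
qed

lemma wf_query_prog: "wf_query S w Q \<Longrightarrow> answer Q m \<Longrightarrow> wf_prog S w (query_prog Q m)"
  using query_prog_accepting(3) by (cases Q) auto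

lemma probes_query_prog:
  assumes "wf_query S w Q" "answer Q m"
  shows "probes (query_prog Q m) m \<le> query_cost Q m"
proof (cases Q)
  case (Nondeterministic T)
  have "query_prog Q m \<in> T"
    using query_prog_accepting(3)[OF assms(2) Nondeterministic] .
  with Nondeterministic assms(1) show ?thesis by auto
qed simp

text \<open>The thread that accepts in \<open>m\<close> sees the same cells in \<open>m'\<close> and
  accepts there too. Another thread may be the chosen one in \<open>m'\<close>, but the write
  discipline in \<open>m'\<close> makes all accepting threads write the same. Only acceptance
  carries over: a rejection depends on the reads of all threads.\<close>

lemma query_cong:
  assumes "answer Q m" "write_discipline Q m'" "\<And>a. a \<in> reads (query_prog Q m) m \<Longrightarrow> m' a = m a"
  shows "answer Q m' \<and> writes (query_prog Q m') m' = writes (query_prog Q m) m"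
proof -
  let ?p = "query_prog Q m"
  have cong: "result ?p m' = result ?p m" "writes ?p m' = writes ?p m"
    using prog_cong[of ?p m m'] assms(3) by blast+
  show ?thesis
  proof (cases Q)
    case (Deterministic p)
    then show ?thesis using cong assms(1) by simp
  next
    case (Nondeterministic T)
    have p: "?p \<in> T" "result ?p m'"
      using query_prog_accepting(1,3)[OF assms(1)] Nondeterministic cong(1) by blast+
    then have ans: "answer Q m'" unfolding Nondeterministic answer.simps by blast
    have "query_prog Q m' \<in> T" "result (query_prog Q m') m'"
      using query_prog_accepting(1,3)[OF ans] Nondeterministic by blast+
    moreover have "\<forall>p\<in>T. \<forall>q\<in>T. result p m' \<longrightarrow> result q m' \<longrightarrow> writes p m' = writes q m'"
      using assms(2) unfolding Nondeterministic write_discipline.simps by blast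
    ultimately have "writes (query_prog Q m') m' = writes ?p m'"
      using p by blast
    with ans cong(2) show ?thesis by metis
  qed
qed

lemma finite_op_reads: "finite (op_reads D f m)"
  by (cases f) (auto simp: finite_reads)

lemma finite_op_writes: "finite (dom (op_writes D f m))"
  by (cases f) (auto simp: finite_dom_writes)

lemma card_op_reads_writes:
  assumes "wf_op S w D f" "accepted D f m"
  shows "card (op_reads D f m) + card (dom (op_writes D f m)) \<le> op_cost D f m"
proof (cases f)
  case (Connected u v)
  then show ?thesis
    using card_reads_writes[of "query_prog (connected_query D u v) m" m]
      probes_query_prog[of S w "connected_query D u v" m] assms by simp
qed (simp_all add: card_reads_writes)

lemma op_memory_eq:
  assumes "accepted D f m"
  shows "op_memory D f m = (\<lambda>a. case op_writes D f m a of None \<Rightarrow> m a | Some x \<Rightarrow> x)"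
  using assms query_prog_accepting(2) by (cases f) (auto simp: final_memory_def)

lemma op_cong:
  assumes "accepted D f m" "disciplined D f m'" "\<And>a. a \<in> op_reads D f m \<Longrightarrow> m' a = m a"
  shows "accepted D f m' \<and> op_writes D f m' = op_writes D f m"
  using assms
proof (cases f)
  case (Insert u v)
  then show ?thesis using prog_cong[of "insert_prog D u v" m m'] assms(3) by simp
next
  case (Delete u v)
  then show ?thesis using prog_cong[of "delete_prog D u v" m m'] assms(3) by simp
next
  case (Connected u v)
  then show ?thesis using query_cong[of "connected_query D u v" m m'] assms by simp
qed

lemma op_bounded:
  assumes "wf_op S w D f" "accepted D f m" "valid_memory S w m"
  shows "op_reads D f m \<subseteq> {..<S} \<and> dom (op_writes D f m) \<subseteq> {..<S}"
proof (cases f)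
  case (Insert u v)
  then show ?thesis using wf_prog_bounds[OF _ assms(3), of "insert_prog D u v"] assms(1) by auto
next
  case (Delete u v)
  then show ?thesis using wf_prog_bounds[OF _ assms(3), of "delete_prog D u v"] assms(1) by auto
next
  case (Connected u v)
  then show ?thesis
    using wf_prog_bounds[OF wf_query_prog assms(3), of "connected_query D u v" m] assms(1,2) by auto
qed

lemma valid_op_memory:
  assumes "wf_op S w D f" "accepted D f m" "valid_memory S w m"
  shows "valid_memory S w (op_memory D f m)"
proof (cases f)
  case (Connected u v)
  then show ?thesis
    using valid_final_memory[OF wf_query_prog assms(3), of "connected_query D u v" m]
      query_prog_accepting(2)[of "connected_query D u v" m] assms(1,2) by auto
qed (use assms valid_final_memory in auto)


section \<open>Runs of operation sequences\<close>

primrec run :: "data_structure \<Rightarrow> (nat \<Rightarrow> operation) \<Rightarrow> memory \<Rightarrow> nat \<Rightarrow> memory" where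
  "run D f m 0 = m"
| "run D f m (Suc k) = op_memory D (f k) (run D f m k)"

definition rd :: "data_structure \<Rightarrow> (nat \<Rightarrow> operation) \<Rightarrow> memory \<Rightarrow> nat \<Rightarrow> nat set" where
  "rd D f m k = op_reads D (f k) (run D f m k)"

definition wr :: "data_structure \<Rightarrow> (nat \<Rightarrow> operation) \<Rightarrow> memory \<Rightarrow> nat \<Rightarrow> nat set" where
  "wr D f m k = dom (op_writes D (f k) (run D f m k))"

lemma finite_rd [simp]: "finite (rd D f m k)"
  by (simp add: rd_def finite_op_reads)

lemma finite_wr [simp]: "finite (wr D f m k)"
  by (simp add: wr_def finite_op_writes)

lemma run_eq_memory_after: "run D f m k = memory_after D (map f [0..<k]) m"
  by (induction k) (auto simp: memory_after_def)

lemma total_cost_append: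
  "total_cost D (xs @ ys) m = total_cost D xs m + total_cost D ys (memory_after D xs m)"
  by (induction xs arbitrary: m) (auto simp: memory_after_def)

lemma total_cost_map: "total_cost D (map f [0..<k]) m = (\<Sum>l<k. op_cost D (f l) (run D f m l))"
  by (induction k) (auto simp: total_cost_append run_eq_memory_after)

lemma run_cong:
  assumes "\<And>l. l < k \<Longrightarrow> f l = g l"
  shows "run D f m k = run D g m k"
  using assms by (induction k) auto

lemma rd_cong: "(\<And>l. l \<le> k \<Longrightarrow> f l = g l) \<Longrightarrow> rd D f m k = rd D g m k"
  using run_cong[of k f g D m] by (simp add: rd_def)

lemma wr_cong: "(\<And>l. l \<le> k \<Longrightarrow> f l = g l) \<Longrightarrow> wr D f m k = wr D g m k"
  using run_cong[of k f g D m] by (simp add: wr_def)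

definition written :: "data_structure \<Rightarrow> (nat \<Rightarrow> operation) \<Rightarrow> memory \<Rightarrow> nat \<Rightarrow> nat \<Rightarrow> nat set" where
  "written D f m lo hi = (\<Union>l\<in>{lo..<hi}. wr D f m l)"

lemma finite_written [simp]: "finite (written D f m lo hi)"
  by (simp add: written_def)

text \<open>The reads whose contents date from before \<open>mid\<close>. Writes of operation
  \<open>k\<close> itself are not subtracted, so a cell that it first reads and then writes is
  included.\<close>

definition old_reads ::
    "data_structure \<Rightarrow> (nat \<Rightarrow> operation) \<Rightarrow> memory \<Rightarrow> nat \<Rightarrow> nat \<Rightarrow> nat set" where
  "old_reads D f m mid k = rd D f m k - written D f m mid k"

lemma run_outside_written:
  assumes "lo \<le> hi" "\<And>k. lo \<le> k \<Longrightarrow> k < hi \<Longrightarrow> accepted D (f k) (run D f m k)"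
    and "a \<notin> written D f m lo hi"
  shows "run D f m hi a = run D f m lo a"
  using assms
proof (induction hi rule: dec_induct)
  case (step k)
  have "a \<notin> written D f m lo k" "a \<notin> wr D f m k"
    using step.prems step.hyps by (auto simp: written_def)
  moreover have "accepted D (f k) (run D f m k)" using step by simp
  ultimately show ?case using step
    by (simp add: op_memory_eq wr_def domIff)
qed simp

text \<open>The invariant is kept per cell: the two memories may differ on arbitrary cells at
  \<open>mid\<close>, but cells that agree there or are written later agree at the end. The run of
  \<open>f\<close> has to accept, while the run of \<open>f'\<close> only has to be
  disciplined.\<close>

lemma run_simulation:
  assumes "mid \<le> e"
    and "\<And>k. mid \<le> k \<Longrightarrow> k < e \<Longrightarrow> f k = f' k"
    and "\<And>k. mid \<le> k \<Longrightarrow> k < e \<Longrightarrow> accepted D (f k) (run D f m k)"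
    and "\<And>k. mid \<le> k \<Longrightarrow> k < e \<Longrightarrow> disciplined D (f' k) (run D f' m k)"
    and "\<And>k a. mid \<le> k \<Longrightarrow> k < e \<Longrightarrow> a \<in> old_reads D f m mid k \<Longrightarrow>
           run D f' m mid a = run D f m mid a"
  shows "written D f' m mid e = written D f m mid e \<and>
         (\<forall>a. a \<in> written D f m mid e \<or> run D f' m mid a = run D f m mid a \<longrightarrow>
           run D f' m e a = run D f m e a)"
  using assms
proof (induction e rule: dec_induct)
  case base
  then show ?case by (auto simp: written_def)
next
  case (step k)
  have IH: "written D f' m mid k = written D f m mid k"
    "\<And>a. a \<in> written D f m mid k \<or> run D f' m mid a = run D f m mid a \<Longrightarrow>
       run D f' m k a = run D f m k a"
    using step by auto
  have eq: "f' k = f k" using step.prems(1)[of k] step.hyps by simp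
  have acc: "accepted D (f k) (run D f m k)" using step by simp
  \<comment> \<open>A cell read at \<open>k\<close> was either written since \<open>mid\<close>,
    where the invariant applies, or is an old read, where the two memories agree at
    \<open>mid\<close>.\<close>
  have "run D f' m k a = run D f m k a" if "a \<in> op_reads D (f k) (run D f m k)" for a
    using IH(2) step.prems(4)[of k a] step.hyps that by (auto simp: old_reads_def rd_def)
  then have cong: "accepted D (f k) (run D f' m k)"
      "op_writes D (f k) (run D f' m k) = op_writes D (f k) (run D f m k)"
    using op_cong[OF acc, of "run D f' m k"] step.prems(3)[of k] step.hyps eq by auto
  have wr: "wr D f' m k = wr D f m k" using cong eq by (simp add: wr_def)
  have split: "written D g m mid (Suc k) = written D g m mid k \<union> wr D g m k" for g
    using step.hyps by (auto simp: written_def atLeastLessThanSuc)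
  have "run D f' m (Suc k) a = run D f m (Suc k) a"
    if "a \<in> written D f m mid (Suc k) \<or> run D f' m mid a = run D f m mid a" for a
  proof (cases "op_writes D (f k) (run D f m k) a")
    case None
    then have "a \<notin> wr D f m k" by (auto simp: wr_def)
    then have "run D f' m k a = run D f m k a" using that IH(2)[of a] split[of f] by blast
    with None show ?thesis
      using op_memory_eq[OF acc] op_memory_eq[OF cong(1)] cong(2) eq by simp
  next
    case (Some x)
    then show ?thesis
      using op_memory_eq[OF acc] op_memory_eq[OF cong(1)] cong(2) eq by simp
  qed
  then show ?case
    using IH(1) wr split by blast
qed

text \<open>The operation \<open>g\<close> need not belong to either sequence: it is asked
  hypothetically at time \<open>e\<close>. So many queries can be tested in one and the same
  memory.\<close>

lemma answer_simulation:
  assumes "mid \<le> e"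
    and "\<And>k. mid \<le> k \<Longrightarrow> k < e \<Longrightarrow> f k = f' k"
    and "\<And>k. mid \<le> k \<Longrightarrow> k < e \<Longrightarrow> accepted D (f k) (run D f m k)"
    and "\<And>k. mid \<le> k \<Longrightarrow> k < e \<Longrightarrow> disciplined D (f' k) (run D f' m k)"
    and "accepted D g (run D f m e)" "disciplined D g (run D f' m e)"
    and "\<And>k a. mid \<le> k \<Longrightarrow> k < e \<Longrightarrow> a \<in> old_reads D f m mid k \<Longrightarrow>
           run D f' m mid a = run D f m mid a"
    and "\<And>a. a \<in> op_reads D g (run D f m e) \<Longrightarrow> a \<notin> written D f m mid e \<Longrightarrow>
           run D f' m mid a = run D f m mid a"
  shows "accepted D g (run D f' m e)"
proof -
  have "run D f' m e a = run D f m e a" if "a \<in> op_reads D g (run D f m e)" for a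
    using run_simulation[of mid e f f' D m] assms(1-4,7) assms(8)[OF that] by blast
  then show ?thesis
    using op_cong[OF assms(5,6)] by blast
qed


section \<open>Unions of paths\<close>

definition edges :: "(nat \<times> nat) set \<Rightarrow> graph" where
  "edges F = (\<lambda>(u, v). {u, v}) ` F"

lemma path_edges_Nil [simp]: "path_edges [] = {}"
  by (auto simp: path_edges_def)

lemma path_edges_singleton [simp]: "path_edges [x] = {}"
  by (auto simp: path_edges_def)

lemma path_edges_Cons [simp]: "path_edges (x # y # zs) = insert {x, y} (path_edges (y # zs))"
proof (rule set_eqI)
  fix e
  have "(\<exists>i. e = {(x # y # zs) ! i, (x # y # zs) ! Suc i} \<and> Suc i < length (x # y # zs)) \<longleftrightarrow>
    e = {x, y} \<or> (\<exists>i. e = {(y # zs) ! i, (y # zs) ! Suc i} \<and> Suc i < length (y # zs))"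
    (is "(\<exists>i. ?P i) \<longleftrightarrow> ?Q")
  proof
    assume "\<exists>i. ?P i"
    then obtain i where "?P i" by blast
    then show ?Q by (cases i) auto
  next
    assume ?Q
    then show "\<exists>i. ?P i"
    proof
      assume "e = {x, y}"
      then show ?thesis by (intro exI[of _ 0]) simp
    next
      assume "\<exists>i. e = {(y # zs) ! i, (y # zs) ! Suc i} \<and> Suc i < length (y # zs)"
      then obtain i where "e = {(y # zs) ! i, (y # zs) ! Suc i}" "Suc i < length (y # zs)" by blast
      then show ?thesis by (intro exI[of _ "Suc i"]) simp
    qed
  qed
  then show "e \<in> path_edges (x # y # zs) \<longleftrightarrow> e \<in> insert {x, y} (path_edges (y # zs))"
    by (simp add: path_edges_def)
qed

lemma path_edges_append:
  assumes "p \<noteq> []" "q \<noteq> []"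
  shows "path_edges (p @ q) = insert {last p, hd q} (path_edges p \<union> path_edges q)"
  using assms(1)
proof (induction p)
  case (Cons x p)
  show ?case
  proof (cases p)
    case Nil
    then show ?thesis using assms(2) by (cases q) auto
  next
    case (Cons y p')
    then show ?thesis using Cons.IH by auto
  qed
qed simp

lemma sorted_hd_le_last:
  assumes "sorted_wrt (<) p" "p \<noteq> []"
  shows "hd p \<le> (last p :: nat)"
  using assms by (cases p) (auto simp: less_imp_le)

text \<open>The induction inserts the edges one by one; each insertion concatenates the path ending in
  \<open>u\<close> with the one beginning in \<open>v\<close>, which differ because all paths are increasing.\<close>

lemma edges_in_unions_of_paths:
  assumes "finite F" "\<forall>u v. (u, v) \<in> F \<longrightarrow> u < v" "single_valued F" "single_valued (F\<inverse>)"
  shows "edges F \<in> unions_of_paths"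
proof -
  have "\<exists>P. (\<forall>p\<in>P. p \<noteq> [] \<and> sorted_wrt (<) p) \<and>
      (\<forall>p\<in>P. \<forall>q\<in>P. p \<noteq> q \<longrightarrow> set p \<inter> set q = {}) \<and> edges F = (\<Union>p\<in>P. path_edges p) \<and>
      (\<forall>u. u \<notin> Domain F \<longrightarrow> (\<exists>p\<in>P. last p = u)) \<and> (\<forall>v. v \<notin> Range F \<longrightarrow> (\<exists>p\<in>P. hd p = v))"
    using assms
  proof (induction F rule: finite_induct)
    case empty
    \<comment> \<open>Every natural number starts as a path of its own, so the paths cover all
      vertices and every vertex without an outgoing edge ends one of them.\<close>
    show ?case
      by (rule exI[of _ "range (\<lambda>v. [v])"]) (auto simp: edges_def)
  next
    case (insert e F)
    obtain u v where e: "e = (u, v)" by force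
    have uv: "u < v" using insert.prems(1) e by simp
    have sv: "single_valued F" "single_valued (F\<inverse>)"
      using insert.prems(2,3) by (auto simp: single_valued_def)
    have u: "u \<notin> Domain F"
      using insert.prems(2) insert.hyps(2) e unfolding single_valued_def by blast
    have v: "v \<notin> Range F"
      using insert.prems(3) insert.hyps(2) e unfolding single_valued_def by blast
    have "\<forall>u v. (u, v) \<in> F \<longrightarrow> u < v" using insert.prems(1) by blast
    from insert.IH[OF this sv] obtain P where
      P0: "\<forall>p\<in>P. p \<noteq> [] \<and> sorted_wrt (<) p"
        "\<forall>p\<in>P. \<forall>q\<in>P. p \<noteq> q \<longrightarrow> set p \<inter> set q = {}"
        "edges F = (\<Union>p\<in>P. path_edges p)"
        "\<forall>u. u \<notin> Domain F \<longrightarrow> (\<exists>p\<in>P. last p = u)" "\<forall>v. v \<notin> Range F \<longrightarrow> (\<exists>p\<in>P. hd p = v)"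
      by (elim exE conjE) (rule that)
    note P = P0(1)[rule_format] P0(2)[rule_format] P0(3) P0(4)[rule_format] P0(5)[rule_format]
    obtain p where p: "p \<in> P" "last p = u" using P(4)[OF u] by blast
    obtain q where q: "q \<in> P" "hd q = v" using P(5)[OF v] by blast
    have pq: "p \<noteq> q"
      using sorted_hd_le_last[of p] P(1)[OF p(1)] p q uv by auto
    note ne = P(1)[OF p(1)] P(1)[OF q(1)]
    let ?P = "insert (p @ q) (P - {p, q})"
    have below: "w \<le> u" if "w \<in> set p" for w
    proof -
      from that obtain xs ys where "p = xs @ w # ys" by (meson split_list)
      then show ?thesis
        using ne(1) p(2) by (cases ys rule: rev_cases) (simp_all add: sorted_wrt_append less_imp_le)
    qed
    have above: "v \<le> w" if "w \<in> set q" for w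
      using that ne(2) q(2) by (cases q) (auto simp: less_imp_le)
    have "x < y" if "x \<in> set p" "y \<in> set q" for x y
      using below[OF that(1)] above[OF that(2)] uv by linarith
    then have "sorted_wrt (<) (p @ q)"
      using ne unfolding sorted_wrt_append by blast
    then have 1: "\<forall>r\<in>?P. r \<noteq> [] \<and> sorted_wrt (<) r"
      using P(1) ne by simp
    have 2: "\<forall>r\<in>?P. \<forall>s\<in>?P. r \<noteq> s \<longrightarrow> set r \<inter> set s = {}"
    proof -
      have "set (p @ q) \<inter> set r = {}" if "r \<in> P - {p, q}" for r
        using P(2)[of p r] P(2)[of q r] p(1) q(1) that unfolding set_append by blast
      then have "set (p @ q) \<inter> set r = {} \<and> set r \<inter> set (p @ q) = {}" if "r \<in> P - {p, q}" for r
        using that by (simp add: Int_commute)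
      then show ?thesis using P(2) by blast
    qed
    have 3: "edges (insert e F) = (\<Union>r\<in>?P. path_edges r)"
    proof -
      have "edges (insert e F) = insert {u, v} (\<Union>r\<in>P. path_edges r)"
        using P(3) by (simp add: edges_def e)
      also have "\<dots> = (\<Union>r\<in>?P. path_edges r)"
        using path_edges_append[of p q] ne p q unfolding UN_insert by blast
      finally show ?thesis .
    qed
    have 4: "\<exists>r\<in>?P. last r = w" if w: "w \<notin> Domain (insert e F)" for w
    proof -
      obtain r where r: "r \<in> P" "last r = w" using P(4)[of w] w by blast
      have "w \<noteq> u" using w e by blast
      then have "r \<noteq> p" using r p by blast
      then show ?thesis using r ne by (cases "r = q") auto
    qed
    have 5: "\<exists>r\<in>?P. hd r = w" if w: "w \<notin> Range (insert e F)" for w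
    proof -
      obtain r where r: "r \<in> P" "hd r = w" using P(5)[of w] w by blast
      have "w \<noteq> v" using w e by blast
      then have "r \<noteq> q" using r q by blast
      then show ?thesis using r ne by (cases "r = p") auto
    qed
    show ?case
      by (rule exI[of _ ?P], intro conjI allI impI) (fact 1 2 3 4 5)+
  qed
  then obtain P where P: "\<forall>p\<in>P. p \<noteq> [] \<and> sorted_wrt (<) p"
      "\<forall>p\<in>P. \<forall>q\<in>P. p \<noteq> q \<longrightarrow> set p \<inter> set q = {}" "edges F = (\<Union>p\<in>P. path_edges p)"
    by (elim exE conjE) (rule that)
  have "distinct p" if "p \<in> P" for p
    using P(1) that strict_sorted_iff by blast
  then have "\<forall>p\<in>P. distinct p" ..
  then show ?thesis
    unfolding unions_of_paths_def mem_Collect_eq using P(2,3) by (intro exI[of _ P] conjI)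
qed


section \<open>Layered networks\<close>

text \<open>Vertex \<open>a\<close> of layer \<open>c\<close> has the number \<open>c * M + a\<close>, and \<open>g c\<close> is the partial function that
  the edges between the layers \<open>c\<close> and \<open>c + 1\<close> describe.\<close>

definition links :: "nat \<Rightarrow> nat \<Rightarrow> (nat \<Rightarrow> nat \<rightharpoonup> nat) \<Rightarrow> (nat \<times> nat) set" where
  "links M N g = {(c * M + a, Suc c * M + b) | c a b. c < N \<and> a < M \<and> b < M \<and> g c a = Some b}"

lemma layer_unique:
  assumes "c * M + a = c' * M + a'" "a < M" "a' < (M::nat)"
  shows "c = c' \<and> a = a'"
proof -
  have "(c * M + a) div M = (c' * M + a') div M" "(c * M + a) mod M = (c' * M + a') mod M"
    using assms(1) by simp_all
  then show ?thesis using assms(2,3) by simp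
qed

lemma links_cong:
  assumes "\<And>c a. c < N \<Longrightarrow> a < M \<Longrightarrow> g c a = g' c a"
  shows "links M N g = links M N g'"
proof -
  have "links M N g \<subseteq> links M N g'"
    if "\<And>c a. c < N \<Longrightarrow> a < M \<Longrightarrow> g c a = g' c a" for g g' :: "nat \<Rightarrow> nat \<rightharpoonup> nat"
    using that unfolding links_def by fastforce
  from this[of g g'] this[of g' g] assms show ?thesis by simp
qed

lemma layer_bound:
  assumes "c < N" "a < M" "b < M" "Suc N * M \<le> n"
  shows "c * M + a < n" "Suc c * M + b < (n::nat)"
proof -
  have "Suc c * M + M \<le> Suc N * M"
    using mult_le_mono1[of "Suc (Suc c)" "Suc N" M] assms(1) by simp
  then show "c * M + a < n" "Suc c * M + b < n" using assms by auto
qed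

lemma links_iff:
  assumes "c < N" "a < M" "b < M"
  shows "(c * M + a, Suc c * M + b) \<in> links M N g \<longleftrightarrow> g c a = Some b"
proof
  assume "(c * M + a, Suc c * M + b) \<in> links M N g"
  then obtain c' a' b' where *: "c * M + a = c' * M + a'" "Suc c * M + b = Suc c' * M + b'"
    "a' < M" "b' < M" "g c' a' = Some b'" unfolding links_def by blast
  then show "g c a = Some b"
    using layer_unique[OF *(1) assms(2) *(3)] layer_unique[OF *(2) assms(3) *(4)] by simp
qed (use assms in \<open>auto simp: links_def\<close>)

lemma links_less: "(u, v) \<in> links M N g \<Longrightarrow> u < v"
  by (auto simp: links_def)

lemma edges_mem_iff:
  assumes "\<And>u v. (u, v) \<in> F \<Longrightarrow> u < v" "u < v"
  shows "{u, v} \<in> edges F \<longleftrightarrow> (u, v) \<in> F"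
  using assms by (fastforce simp: edges_def doubleton_eq_iff image_iff)

lemma links_in_unions_of_paths:
  assumes "\<And>c a a' b. c < N \<Longrightarrow> a < M \<Longrightarrow> a' < M \<Longrightarrow> g c a = Some b \<Longrightarrow> g c a' = Some b \<Longrightarrow> a = a'"
  shows "edges (links M N g) \<in> unions_of_paths"
proof (rule edges_in_unions_of_paths)
  have "links M N g \<subseteq> {..<Suc N * M} \<times> {..<Suc N * M}"
  proof
    fix e assume "e \<in> links M N g"
    then obtain c a b where "e = (c * M + a, Suc c * M + b)" "c < N" "a < M" "b < M"
      unfolding links_def by blast
    then show "e \<in> {..<Suc N * M} \<times> {..<Suc N * M}"
      using layer_bound[of c N a M b "Suc N * M"] by (simp del: mult_Suc)
  qed
  then show "finite (links M N g)" by (rule finite_subset) simp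
  show "single_valued (links M N g)"
    unfolding single_valued_def
  proof (intro allI impI)
    fix u v v' assume "(u, v) \<in> links M N g" "(u, v') \<in> links M N g"
    then obtain c a b c' a' b' where *: "u = c * M + a" "v = Suc c * M + b" "a < M" "g c a = Some b"
      "u = c' * M + a'" "v' = Suc c' * M + b'" "a' < M" "g c' a' = Some b'"
      unfolding links_def by blast
    have "c = c' \<and> a = a'" using * by (intro layer_unique[where M = M]) simp_all
    then show "v = v'" using * by simp
  qed
  show "single_valued ((links M N g)\<inverse>)"
    unfolding single_valued_def
  proof (intro allI impI)
    fix u v v' assume "(u, v) \<in> (links M N g)\<inverse>" "(u, v') \<in> (links M N g)\<inverse>"
    then obtain c a b c' a' b' where *: "v = c * M + a" "u = Suc c * M + b" "a < M" "g c a = Some b"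
      "v' = c' * M + a'" "u = Suc c' * M + b'" "a' < M" "g c' a' = Some b'" "b < M" "b' < M" "c < N"
      unfolding links_def by blast
    have "Suc c = Suc c' \<and> b = b'" using * by (intro layer_unique[where M = M]) simp_all
    moreover from this have "a = a'" using assms[of c a a' b] * by simp
    ultimately show "v = v'" using * by simp
  qed
qed (simp add: links_less)

lemma insert_link:
  assumes "c < N" "a < M" "b < M" "g c a = None" "Suc N * M \<le> n"
    and "\<And>c' a'. c' < N \<Longrightarrow> a' < M \<Longrightarrow> g' c' a' = (if c' = c \<and> a' = a then Some b else g c' a')"
  shows "legal_op n (Insert (c * M + a) (Suc c * M + b)) (edges (links M N g))"
    and "apply_op (Insert (c * M + a) (Suc c * M + b)) (edges (links M N g)) = edges (links M N g')"
proof -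
  have "(c * M + a, Suc c * M + b) \<notin> links M N g"
    using links_iff[OF assms(1-3)] assms(4) by simp
  then have "{c * M + a, Suc c * M + b} \<notin> edges (links M N g)"
    using edges_mem_iff[of "links M N g", OF links_less] assms by simp
  then show "legal_op n (Insert (c * M + a) (Suc c * M + b)) (edges (links M N g))"
    using layer_bound[OF assms(1-3,5)] assms(2) by simp
  have "links M N g' = insert (c * M + a, Suc c * M + b) (links M N g)"
  proof (intro equalityI subsetI)
    fix e assume "e \<in> links M N g'"
    then show "e \<in> insert (c * M + a, Suc c * M + b) (links M N g)"
      using assms(6) unfolding links_def by (auto split: if_splits)
  next
    fix e assume "e \<in> insert (c * M + a, Suc c * M + b) (links M N g)"
    then show "e \<in> links M N g'"
    proof
      assume "e = (c * M + a, Suc c * M + b)"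
      then show ?thesis using links_iff[OF assms(1-3), of g'] assms(1,2,6) by simp
    next
      assume "e \<in> links M N g"
      then obtain c' a' b' where e: "e = (c' * M + a', Suc c' * M + b')" "c' < N" "a' < M" "b' < M"
        "g c' a' = Some b'" unfolding links_def by blast
      then have "g' c' a' = Some b'" using assms(4,6) by auto
      then show ?thesis using e links_iff[of c' N a' M b' g'] by simp
    qed
  qed
  then show "apply_op (Insert (c * M + a) (Suc c * M + b)) (edges (links M N g)) = edges (links M N g')"
    by (simp add: edges_def)
qed

text \<open>Read backwards, the deletion inserts the same edge into the network of
  \<open>g'\<close>; both claims follow from \<open>insert_link\<close>.\<close>

lemma delete_link:
  assumes "c < N" "a < M" "b < M" "g c a = Some b" "Suc N * M \<le> n"
    and "\<And>c' a'. c' < N \<Longrightarrow> a' < M \<Longrightarrow> g' c' a' = (if c' = c \<and> a' = a then None else g c' a')"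
  shows "legal_op n (Delete (c * M + a) (Suc c * M + b)) (edges (links M N g))"
    and "apply_op (Delete (c * M + a) (Suc c * M + b)) (edges (links M N g)) = edges (links M N g')"
proof -
  have None: "g' c a = None" using assms by simp
  have eq: "g c' a' = (if c' = c \<and> a' = a then Some b else g' c' a')" if "c' < N" "a' < M" for c' a'
    using assms(4,6) that by simp
  have ins: "insert {c * M + a, Suc c * M + b} (edges (links M N g')) = edges (links M N g)"
    using insert_link(2)[of c N a M b g' n g, OF assms(1-3) None assms(5) eq] by simp
  have nin: "{c * M + a, Suc c * M + b} \<notin> edges (links M N g')"
    using insert_link(1)[of c N a M b g' n g, OF assms(1-3) None assms(5) eq] by simp
  show "legal_op n (Delete (c * M + a) (Suc c * M + b)) (edges (links M N g))"
    using ins layer_bound[OF assms(1-3,5)] by auto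
  show "apply_op (Delete (c * M + a) (Suc c * M + b)) (edges (links M N g)) = edges (links M N g')"
    using nin unfolding ins[symmetric] by simp
qed

text \<open>The product of the factors \<open>p 0\<close>, ..., \<open>p (j - 1)\<close>, with
  \<open>p 0\<close> applied first.\<close>

fun prefix_map :: "(nat \<Rightarrow> nat \<Rightarrow> nat) \<Rightarrow> nat \<Rightarrow> nat \<Rightarrow> nat" where
  "prefix_map p 0 a = a"
| "prefix_map p (Suc c) a = p c (prefix_map p c a)"

lemma prefix_map_cong:
  assumes "\<And>c. c < j \<Longrightarrow> p c = p' c"
  shows "prefix_map p j = prefix_map p' j"
  using assms by (induction j) auto

lemma prefix_map_permutes:
  assumes "\<And>c. c < j \<Longrightarrow> p c permutes A"
  shows "prefix_map p j permutes A"
  using assms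
proof (induction j)
  case 0
  then show ?case using permutes_id by (simp add: id_def)
next
  case (Suc j)
  have "prefix_map p (Suc j) = p j \<circ> prefix_map p j" by auto
  moreover have "p j \<circ> prefix_map p j permutes A"
    using permutes_compose[of "prefix_map p j" A "p j"] Suc by simp
  ultimately show ?case by metis
qed

text \<open>An edge preserves the row \<open>a\<close> of layer \<open>0\<close> from which a vertex is reached.\<close>

lemma joined_layers_iff:
  assumes "\<And>c. c < N \<Longrightarrow> p c permutes {..<M}" "j \<le> N" "a < M" "b < M"
    and "\<And>c a. c < N \<Longrightarrow> a < M \<Longrightarrow> g c a = Some (p c a)"
  shows "joined (edges (links M N g)) a (j * M + b) \<longleftrightarrow> prefix_map p j a = b"
proof
  define src where "src v \<longleftrightarrow> prefix_map p (v div M) a = v mod M" for v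
  have step: "src u \<longleftrightarrow> src v" if "(u, v) \<in> links M N g" for u v
  proof -
    from that obtain c a' b' where e: "u = c * M + a'" "v = Suc c * M + b'" "c < N" "a' < M" "b' < M"
      "b' = p c a'" unfolding links_def using assms(5) by auto
    have "u div M = c" "u mod M = a'" "v div M = Suc c" "v mod M = b'"
      unfolding e(1,2) using e(4,5) by (simp_all del: mult_Suc)
    then show ?thesis
      using permutes_inj[OF assms(1)[OF e(3)]] e(6) unfolding src_def by (simp add: inj_eq)
  qed
  assume j: "joined (edges (links M N g)) a (j * M + b)"
  have "src v" if "(a, v) \<in> {(x, y). {x, y} \<in> edges (links M N g)}\<^sup>*" for v
    using that
  proof (induction rule: rtrancl_induct)
    case base
    show ?case using assms(3) by (simp add: src_def)
  next
    case (step y z)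
    then have "(y, z) \<in> links M N g \<or> (z, y) \<in> links M N g"
      by (auto simp: edges_def doubleton_eq_iff)
    then show ?case using step.IH \<open>\<And>u v. (u, v) \<in> links M N g \<Longrightarrow> src u \<longleftrightarrow> src v\<close> by blast
  qed
  from this[of "j * M + b"] j assms(4) show "prefix_map p j a = b"
    by (simp add: joined_def src_def)
next
  assume b: "prefix_map p j a = b"
  have "(a, i * M + prefix_map p i a) \<in> {(x, y). {x, y} \<in> edges (links M N g)}\<^sup>*" if "i \<le> N" for i
    using that
  proof (induction i)
    case (Suc i)
    have lt: "prefix_map p i a < M" "prefix_map p (Suc i) a < M"
      using prefix_map_permutes[of i p "{..<M}"] prefix_map_permutes[of "Suc i" p "{..<M}"]
        assms(1,3) Suc.prems permutes_in_image[of _ "{..<M}" a] by (auto simp del: prefix_map.simps)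
    have "(i * M + prefix_map p i a, Suc i * M + prefix_map p (Suc i) a) \<in> links M N g"
      using links_iff[of i N "prefix_map p i a" M "prefix_map p (Suc i) a" g] lt Suc.prems assms(5)
      by simp
    then have "{i * M + prefix_map p i a, Suc i * M + prefix_map p (Suc i) a} \<in> edges (links M N g)"
      unfolding edges_def by (rule rev_image_eqI) simp
    then show ?case
      using Suc by (intro rtrancl_into_rtrancl[OF Suc.IH]) auto
  qed simp
  from this[OF assms(2)] b show "joined (edges (links M N g)) a (j * M + b)"
    by (simp add: joined_def)
qed


section \<open>The hard operation sequences\<close>

lemma legal_ops_append:
  "legal_ops n \<G> (xs @ ys) E \<longleftrightarrow> legal_ops n \<G> xs E \<and> legal_ops n \<G> ys (fold apply_op xs E)"
  by (induction xs arbitrary: E) auto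

lemma legal_ops_UNIV: "legal_ops n \<G> xs E \<Longrightarrow> legal_ops n UNIV xs E"
  by (induction xs arbitrary: E) auto

lemma legal_ops_run:
  assumes "E 0 = {}"
    and "\<And>k. k < K \<Longrightarrow> legal_op n (f k) (E k) \<and> apply_op (f k) (E k) = E (Suc k) \<and> E (Suc k) \<in> \<G>"
  shows "legal_ops n \<G> (map f [0..<K]) {} \<and> graph_after (map f [0..<K]) = E K"
  using assms(2)
proof (induction K)
  case (Suc K)
  then have "legal_ops n \<G> (map f [0..<K]) {} \<and> graph_after (map f [0..<K]) = E K" by simp
  then show ?case using Suc.prems[of K] by (auto simp: legal_ops_append graph_after_def)
qed (simp add: graph_after_def assms(1))

text \<open>First all layers are linked by identity maps. In block \<open>t\<close> the links after layer \<open>col t\<close> are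
  replaced by the permutation \<open>x t\<close>; then come \<open>Kq\<close> queries, given by pairs of a column and a row,
  which all have positive answers.\<close>

locale schedule =
  fixes M N Kq n :: nat and col :: "nat \<Rightarrow> nat"
  assumes M_pos: "0 < M" and col: "col permutes {..<N}" and size: "Suc N * M \<le> n"
begin

definition bl :: nat where
  "bl = 2 * M + Kq"

text \<open>The links once the first \<open>t\<close> blocks are complete; \<open>inv col c\<close>
  is the block in which column \<open>c\<close> is replaced.\<close>

definition perms :: "(nat \<Rightarrow> nat \<Rightarrow> nat) \<Rightarrow> nat \<Rightarrow> nat \<Rightarrow> nat \<Rightarrow> nat" where
  "perms x t c = (if inv col c < t then x (inv col c) else id)"

text \<open>Both successors count inclusively: the queries of block \<open>t\<close> come after its
  own updates, and a query of column \<open>j\<close> crosses this column and ends in layer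
  \<open>j + 1\<close>.\<close>

definition target :: "(nat \<Rightarrow> nat \<Rightarrow> nat) \<Rightarrow> nat \<Rightarrow> nat \<times> nat \<Rightarrow> nat" where
  "target x t y = prefix_map (perms x (Suc t)) (Suc (fst y)) (snd y)"

definition query_op :: "(nat \<Rightarrow> nat \<Rightarrow> nat) \<Rightarrow> nat \<Rightarrow> nat \<times> nat \<Rightarrow> operation" where
  "query_op x t y = Connected (snd y) (Suc (fst y) * M + target x t y)"

text \<open>Each column is replaced only once, so the edges deleted are always those of the
  identity.\<close>

definition block_op ::
    "(nat \<Rightarrow> nat \<Rightarrow> nat) \<Rightarrow> (nat \<times> nat \<Rightarrow> nat \<times> nat) \<Rightarrow> nat \<Rightarrow> nat \<Rightarrow> operation" where
  "block_op x Y t r =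
     (if r < M then Delete (col t * M + r) (Suc (col t) * M + r)
      else if r < 2 * M then Insert (col t * M + (r - M)) (Suc (col t) * M + x t (r - M))
      else query_op x t (Y (t, r - 2 * M)))"

definition start :: "nat \<Rightarrow> nat" where
  "start t = N * M + t * bl"

definition sched ::
    "(nat \<Rightarrow> nat \<Rightarrow> nat) \<Rightarrow> (nat \<times> nat \<Rightarrow> nat \<times> nat) \<Rightarrow> nat \<Rightarrow> operation" where
  "sched x Y k =
     (if k < N * M then Insert (k div M * M + k mod M) (Suc (k div M) * M + k mod M)
      else block_op x Y ((k - N * M) div bl) ((k - N * M) mod bl))"

text \<open>The links just before operation \<open>r\<close> of block \<open>t\<close>: in the
  column under change, row \<open>a\<close> keeps its identity link until operation \<open>a\<close>
  and gets its new link by operation \<open>M + a\<close>.\<close>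

definition layout :: "(nat \<Rightarrow> nat \<Rightarrow> nat) \<Rightarrow> nat \<Rightarrow> nat \<Rightarrow> nat \<Rightarrow> nat \<rightharpoonup> nat" where
  "layout x t r c a =
     (if c \<noteq> col t then Some (perms x t c a)
      else if r \<le> a then Some a
      else if M + a < r then Some (x t a) else None)"

definition state :: "(nat \<Rightarrow> nat \<Rightarrow> nat) \<Rightarrow> nat \<Rightarrow> graph" where
  "state x k = edges (links M N
     (if k < N * M then \<lambda>c a. if c * M + a < k then Some a else None
      else layout x ((k - N * M) div bl) ((k - N * M) mod bl)))"

definition valid_input ::
    "(nat \<Rightarrow> nat \<Rightarrow> nat) \<Rightarrow> (nat \<times> nat \<Rightarrow> nat \<times> nat) \<Rightarrow> bool" where
  "valid_input x Y \<longleftrightarrow> (\<forall>t<N. x t permutes {..<M}) \<and>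
     (\<forall>t<N. \<forall>s<Kq. fst (Y (t, s)) < N \<and> snd (Y (t, s)) < M)"

lemma bl_pos: "0 < bl"
  using M_pos by (simp add: bl_def)

lemma inv_col [simp]: "inv col (col t) = t" "col (inv col c) = c"
  using permutes_inverses[OF col] by auto

lemma col_less_iff: "col t < N \<longleftrightarrow> t < N"
  using permutes_in_image[OF col] by simp

lemma inv_col_less_iff: "inv col c < N \<longleftrightarrow> c < N"
  using permutes_in_image[OF permutes_inv[OF col]] by simp

lemma perms_permutes:
  assumes "\<forall>t<N. x t permutes {..<M}" "c < N"
  shows "perms x t c permutes {..<M}"
  using assms inv_col_less_iff permutes_id by (simp add: perms_def)

lemma target_less:
  assumes "\<forall>t<N. x t permutes {..<M}" "fst y < N" "snd y < M"
  shows "target x t y < M"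
proof -
  have "prefix_map (perms x (Suc t)) (Suc (fst y)) permutes {..<M}"
    using prefix_map_permutes[of "Suc (fst y)" "perms x (Suc t)" "{..<M}"] perms_permutes assms
    by simp
  from permutes_in_image[OF this, of "snd y"] show ?thesis
    using assms(3) by (simp add: target_def del: prefix_map.simps)
qed

lemma index_block:
  assumes "r < bl"
  shows "(start t + r - N * M) div bl = t" "(start t + r - N * M) mod bl = r"
  using assms by (simp_all add: start_def)

lemma sched_block: "r < bl \<Longrightarrow> sched x Y (start t + r) = block_op x Y t r"
  using index_block[of r t] by (simp add: sched_def start_def)

lemma sched_query: "s < Kq \<Longrightarrow> sched x Y (start t + 2 * M + s) = query_op x t (Y (t, s))"
  using sched_block[of "2 * M + s" x Y t] by (simp add: block_op_def bl_def add.assoc)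

lemma state_block: "r < bl \<Longrightarrow> state x (start t + r) = edges (links M N (layout x t r))"
  using index_block[of r t] by (simp add: state_def start_def)

lemma layout_end: 
  assumes "a < M" "2 * M \<le> r"
  shows "layout x t r c a = Some (perms x (Suc t) c a)"
proof (cases "c = col t")
  case False
  then have "inv col c \<noteq> t" by (metis inv_col(2))
  then show ?thesis using False by (auto simp: layout_def perms_def less_Suc_eq)
qed (use assms in \<open>auto simp: layout_def perms_def\<close>)

lemma layout_start: "layout x t 0 c a = Some (perms x t c a)"
  by (auto simp: layout_def perms_def)

lemma state_start: "state x (start t) = edges (links M N (\<lambda>c a. Some (perms x t c a)))"
proof -
  have "layout x t 0 = (\<lambda>c a. Some (perms x t c a))" by (intro ext) (simp add: layout_start)
  then show ?thesis using state_block[OF bl_pos, of x t] by simp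
qed

lemma state_Suc_block:
  assumes "r < bl"
  shows "state x (Suc (start t + r)) = edges (links M N (layout x t (Suc r)))"
proof (cases "Suc r < bl")
  case True
  then show ?thesis using state_block[of "Suc r" x t] by simp
next
  case False
  then have "Suc (start t + r) = start (Suc t)" using assms by (simp add: start_def)
  moreover have "links M N (\<lambda>c a. Some (perms x (Suc t) c a)) = links M N (layout x t (Suc r))"
    using False by (intro links_cong) (simp add: layout_end bl_def)
  ultimately show ?thesis using state_start[of x "Suc t"] by simp
qed

lemma state_in_unions_of_paths:
  assumes "\<forall>t<N. x t permutes {..<M}"
  shows "state x k \<in> unions_of_paths"
proof -
  have inj: "inj (perms x t c)" if "c < N" for t c
    using permutes_inj[OF perms_permutes[OF assms that]] .
  have x: "inj (x t)" if "col t < N" for t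
    using permutes_inj assms that col_less_iff by blast
  have xM: "x t a < M" if "col t < N" "a < M" for t a
    using permutes_in_image[of "x t" "{..<M}" a] assms that col_less_iff by simp
  have 1: "edges (links M N (\<lambda>c a. if c * M + a < k then Some a else None)) \<in> unions_of_paths"
    by (rule links_in_unions_of_paths) (auto split: if_splits)
  have 2: "edges (links M N (layout x t r)) \<in> unions_of_paths" for t r
  proof (rule links_in_unions_of_paths)
    fix c a a' b
    assume *: "c < N" "a < M" "a' < M" "layout x t r c a = Some b" "layout x t r c a' = Some b"
    show "a = a'"
    proof (cases "c = col t")
      case False
      then show ?thesis using * inj[of c t] by (auto simp: layout_def inj_eq)
    next
      case c: True
      then consider "r \<le> a" "r \<le> a'" | "M + a < r" "M + a' < r" | "r \<le> a \<and> M + a' < r \<or> r \<le> a' \<and> M + a < r"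
        using * by (auto simp: layout_def split: if_splits)
      then show ?thesis
      proof cases
        case 1
        then show ?thesis using * c by (auto simp: layout_def)
      next
        case 2
        then show ?thesis using * c x[of t] by (auto simp: layout_def inj_eq)
      next
        \<comment> \<open>An identity link and a new link cannot coexist in one column, because all
          deletions precede the insertions: \<open>r \<le> a < M\<close> contradicts
          \<open>M + a' < r\<close>.\<close>
        case 3
        then show ?thesis using * by auto
      qed
    qed
  qed
  show ?thesis using 1 2 by (simp add: state_def)
qed

lemma block_op_correct:
  assumes "valid_input x Y" "t < N" "r < bl"
  shows "legal_op n (block_op x Y t r) (edges (links M N (layout x t r))) \<and>
    apply_op (block_op x Y t r) (edges (links M N (layout x t r))) =
      edges (links M N (layout x t (Suc r)))"
proof -
  have c: "col t < N" using assms(2) col_less_iff by simp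
  have x: "x t permutes {..<M}" using assms(1,2) by (simp add: valid_input_def)
  consider "r < M" | "M \<le> r" "r < 2 * M" | "2 * M \<le> r" by linarith
  then show ?thesis
  proof cases
    case 1
    have "layout x t (Suc r) c' a' = (if c' = col t \<and> a' = r then None else layout x t r c' a')"
      if "a' < M" for c' a'
      using 1 that by (auto simp: layout_def)
    then show ?thesis
      using delete_link[of "col t" N r M r "layout x t r" n "layout x t (Suc r)"] c 1 size
      by (simp add: block_op_def layout_def)
  next
    case 2
    have a: "r - M < M" using 2 by linarith
    have b: "x t (r - M) < M" using permutes_in_image[OF x, of "r - M"] a by simp
    have "layout x t (Suc r) c' a' =
        (if c' = col t \<and> a' = r - M then Some (x t (r - M)) else layout x t r c' a')"
      if "a' < M" for c' a'
      using 2 that by (auto simp: layout_def)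
    then show ?thesis
      using insert_link[of "col t" N "r - M" M "x t (r - M)" "layout x t r" n "layout x t (Suc r)"]
        a b c 2 size by (simp add: block_op_def layout_def)
  next
    case 3
    have y: "fst (Y (t, r - 2 * M)) < N" "snd (Y (t, r - 2 * M)) < M"
      using assms 3 by (auto simp: valid_input_def bl_def)
    have "links M N (layout x t (Suc r)) = links M N (layout x t r)"
      using 3 by (intro links_cong) (simp add: layout_end)
    moreover have "target x t (Y (t, r - 2 * M)) < M"
      using target_less y assms(1) by (simp add: valid_input_def)
    ultimately show ?thesis
      using 3 y layer_bound[OF y _ size, of "target x t (Y (t, r - 2 * M))"]
        layer_bound[of 0 N "snd (Y (t, r - 2 * M))" M _ n] size
      by (auto simp: block_op_def query_op_def)
  qed
qed

lemma sched_correct: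
  assumes "valid_input x Y" "k < start N"
  shows "legal_op n (sched x Y k) (state x k) \<and> apply_op (sched x Y k) (state x k) = state x (Suc k)"
proof (cases "k < N * M")
  case True
  let ?g = "\<lambda>k c a. if c * M + a < k then Some a else None"
  have c: "k div M < N" using True by (simp add: less_mult_imp_div_less)
  have a: "k mod M < M" using M_pos by simp
  have "?g (Suc k) c' a' = (if c' = k div M \<and> a' = k mod M then Some (k mod M) else ?g k c' a')"
    if "a' < M" for c' a'
  proof -
    have "c' * M + a' = k \<longleftrightarrow> c' = k div M \<and> a' = k mod M"
    proof
      assume "c' * M + a' = k"
      then have "c' * M + a' = k div M * M + k mod M" by simp
      from layer_unique[OF this \<open>a' < M\<close> a] show "c' = k div M \<and> a' = k mod M" .
    qed simp
    then show ?thesis unfolding less_Suc_eq by auto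
  qed
  note ins = insert_link[of "k div M" N "k mod M" M "k mod M" "?g k" n "?g (Suc k)",
      OF c a a _ size this]
  have state: "state x k = edges (links M N (?g k))" using True by (simp add: state_def)
  have "state x (Suc k) = edges (links M N (?g (Suc k)))"
  proof (cases "Suc k < N * M")
    case False
    then have k: "Suc k = N * M" using True by simp
    have "c * M + a < N * M" if "c < N" "a < M" for c a
    proof -
      have "Suc c * M \<le> N * M" using that by (intro mult_le_mono1) simp
      then show ?thesis using that by simp
    qed
    then have "links M N (\<lambda>c a. Some (perms x 0 c a)) = links M N (?g (Suc k))"
      unfolding k by (intro links_cong) (simp add: perms_def)
    then show ?thesis using state_start[of x 0] k by (simp add: start_def)
  qed (simp add: state_def)
  with ins state True show ?thesis by (simp add: sched_def)
next
  case False
  define t r where "t = (k - N * M) div bl" and "r = (k - N * M) mod bl"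
  have k: "k = start t + r" using False div_mult_mod_eq[of "k - N * M" bl]
    unfolding start_def t_def r_def by linarith
  have r: "r < bl" using bl_pos by (simp add: r_def)
  have "t < N"
    using assms(2) False by (simp add: t_def start_def less_mult_imp_div_less)
  from block_op_correct[OF assms(1) this r] show ?thesis
    unfolding k state_Suc_block[OF r] state_block[OF r] sched_block[OF r] .
qed

lemma
  assumes "valid_input x Y" "k \<le> start N"
  shows legal_sched: "legal_ops n unions_of_paths (map (sched x Y) [0..<k]) {}"
    and graph_after_sched: "graph_after (map (sched x Y) [0..<k]) = state x k"
proof -
  have "state x 0 = {}"
  proof (cases "N = 0")
    case True
    then show ?thesis unfolding state_def links_def edges_def by simp
  next
    case False
    then show ?thesis using M_pos by (simp add: state_def links_def edges_def)
  qed
  then have "legal_ops n unions_of_paths (map (sched x Y) [0..<k]) {} \<and>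
      graph_after (map (sched x Y) [0..<k]) = state x k"
    using sched_correct[OF assms(1)] state_in_unions_of_paths assms
    by (intro legal_ops_run) (auto simp: valid_input_def)
  then show "legal_ops n unions_of_paths (map (sched x Y) [0..<k]) {}"
    "graph_after (map (sched x Y) [0..<k]) = state x k" by blast+
qed

lemma start_mono: "t \<le> u \<Longrightarrow> start t \<le> start u"
  by (simp add: start_def)

lemma slot_less: "t < N \<Longrightarrow> s < Kq \<Longrightarrow> start t + 2 * M + s < start N"
  using start_mono[of "Suc t" N] by (simp add: start_def bl_def)

lemma joined_query:
  assumes "valid_input x Y" "t < N" "s < Kq" "j \<le> N" "a < M" "b < M"
  shows "joined (graph_after (map (sched x Y) [0..<start t + 2 * M + s])) a (j * M + b) \<longleftrightarrow>
    prefix_map (perms x (Suc t)) j a = b"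
proof -
  have g: "graph_after (map (sched x Y) [0..<start t + 2 * M + s]) =
      edges (links M N (layout x t (2 * M + s)))"
    using graph_after_sched[OF assms(1), of "start t + 2 * M + s"] slot_less[OF assms(2,3)]
      state_block[of "2 * M + s" x t] assms(3) by (simp add: bl_def add.assoc)
  have "\<forall>t<N. x t permutes {..<M}" using assms(1) by (simp add: valid_input_def)
  then show ?thesis
    unfolding g by (intro joined_layers_iff[OF _ assms(4-6)] perms_permutes layout_end) auto
qed

lemma sum_schedule:
  "(\<Sum>k<start N. f k) = (\<Sum>k<N * M. f k) + (\<Sum>t<N. \<Sum>r<bl. f (start t + r :: nat) :: 'b :: comm_monoid_add)"
proof -
  have "(\<Sum>t<K. \<Sum>r<bl. f (start t + r)) + (\<Sum>k<N * M. f k) = (\<Sum>k<start K. f k)" for K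
  proof (induction K)
    case (Suc K)
    have "(\<Sum>k<start (Suc K). f k) = (\<Sum>k<start K. f k) + (\<Sum>r<bl. f (start K + r))"
    proof -
      have "start (Suc K) = start K + bl" by (simp add: start_def)
      moreover have "(\<Sum>k<A + L. f k) = (\<Sum>k<A. f k) + (\<Sum>r<L. f (A + r))" for A L
        by (induction L) (simp_all add: ac_simps)
      ultimately show ?thesis by simp
    qed
    then show ?case unfolding Suc.IH[symmetric] by (simp add: ac_simps)
  qed (simp add: start_def)
  then show ?thesis by (simp add: add.commute)
qed

lemma
  shows count_queries: "length (filter is_query (map (sched x Y) [0..<start N])) = N * Kq"
    and count_updates: "length (filter (\<lambda>f. \<not> is_query f) (map (sched x Y) [0..<start N])) = 3 * N * M"
proof -
  have len: "length (filter P (map f [0..<K])) = (\<Sum>k<K. if P (f k) then 1 else 0)"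
    for P and f :: "nat \<Rightarrow> operation" and K
    by (induction K) auto
  have q: "is_query (block_op x Y t r) \<longleftrightarrow> \<not> r < 2 * M" for t r
    by (auto simp: block_op_def query_op_def)
  have sp: "(\<Sum>r<bl. if \<not> r < 2 * M then 1 else 0) = Kq"
      "(\<Sum>r<bl. if \<not> \<not> r < 2 * M then 1 else 0) = 2 * M"
  proof -
    have "(\<Sum>r<2 * M + K. if \<not> r < 2 * M then 1 else 0) = K \<and>
        (\<Sum>r<2 * M + K. if \<not> \<not> r < 2 * M then 1 else 0) = 2 * M" for K
      by (induction K) auto
    then show "(\<Sum>r<bl. if \<not> r < 2 * M then 1 else 0) = Kq"
      "(\<Sum>r<bl. if \<not> \<not> r < 2 * M then 1 else 0) = 2 * M" by (simp_all add: bl_def)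
  qed
  have no_query: "\<not> is_query (sched x Y k)" if "k < N * M" for k
    using that by (simp add: sched_def)
  have eq: "is_query (sched x Y (start t + r)) \<longleftrightarrow> \<not> r < 2 * M" if "r < bl" for t r
    using sched_block[OF that] q by simp
  have "(\<Sum>k<start N. if is_query (sched x Y k) then 1 else 0) = N * Kq"
  proof -
    have "(\<Sum>r<bl. if is_query (sched x Y (start t + r)) then 1 else 0) = Kq" for t
      by (rule trans[OF _ sp(1)], intro sum.cong) (simp_all only: lessThan_iff eq)
    then show ?thesis unfolding sum_schedule by (simp add: no_query)
  qed
  then show "length (filter is_query (map (sched x Y) [0..<start N])) = N * Kq"
    by (simp only: len)
  \<comment> \<open>The identity links take \<open>N * M\<close> insertions, and each of the
    \<open>N\<close> blocks contributes \<open>2 * M\<close> updates.\<close>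
  have "(\<Sum>k<start N. if \<not> is_query (sched x Y k) then 1 else 0) = 3 * N * M"
  proof -
    have "(\<Sum>r<bl. if \<not> is_query (sched x Y (start t + r)) then 1 else 0) = 2 * M" for t
      by (rule trans[OF _ sp(2)], intro sum.cong) (simp_all only: lessThan_iff eq)
    then show ?thesis unfolding sum_schedule by (simp add: no_query)
  qed
  then show "length (filter (\<lambda>f. \<not> is_query f) (map (sched x Y) [0..<start N])) = 3 * N * M"
    by (simp only: len)
qed

end


section \<open>Digit reversal\<close>

primrec digit_rev :: "nat \<Rightarrow> nat \<Rightarrow> nat \<Rightarrow> nat" where
  "digit_rev b 0 t = 0"
| "digit_rev b (Suc d) t = (t mod b) * b ^ d + digit_rev b d (t div b)"

lemma digit_rev_less: "0 < b \<Longrightarrow> digit_rev b d t < b ^ d"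
proof (induction d arbitrary: t)
  case (Suc d)
  have "Suc (t mod b) * b ^ d \<le> b * b ^ d"
    using Suc.prems by (intro mult_le_mono1) (simp add: Suc_leI)
  then show ?case using Suc.IH[OF Suc.prems, of "t div b"] by simp
qed simp

lemma digit_rev_inj:
  assumes "0 < b" "t < b ^ d" "u < b ^ d" "digit_rev b d t = digit_rev b d u"
  shows "t = u"
  using assms
proof (induction d arbitrary: t u)
  case (Suc d)
  note less = digit_rev_less[OF Suc.prems(1), of d]
  have eq: "t mod b * b ^ d + digit_rev b d (t div b) = u mod b * b ^ d + digit_rev b d (u div b)"
    using Suc.prems(4) by simp
  have "t mod b = u mod b \<and> digit_rev b d (t div b) = digit_rev b d (u div b)"
    by (rule layer_unique[OF eq less less])
  moreover have "t div b < b ^ d" "u div b < b ^ d"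
    using Suc.prems(2,3) by (simp_all add: less_mult_imp_div_less power_Suc2 del: power_Suc)
  ultimately have "t mod b = u mod b" "t div b = u div b"
    using Suc.IH[OF Suc.prems(1)] by blast+
  then show ?case by (metis div_mult_mod_eq)
qed simp

text \<open>The low digits of the reversed number are the high digits of \<open>t\<close>. Blocks
  below a common node of the tree share their high digits, so their columns are congruent.\<close>

lemma digit_rev_mod:
  assumes "0 < b"
  shows "digit_rev b (d + e) t mod b ^ d = digit_rev b d (t div b ^ e)"
proof (induction e arbitrary: t)
  case 0
  then show ?case using digit_rev_less[OF assms] by simp
next
  case (Suc e)
  have "digit_rev b (d + Suc e) t mod b ^ d = digit_rev b (d + e) (t div b) mod b ^ d"
    by (simp add: power_add mult.assoc[symmetric] mult.commute[of _ "b ^ d"])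
      (metis mod_mult_self4 mult.assoc)
  then show ?case using Suc[of "t div b"] by (simp add: div_mult2_eq)
qed


section \<open>Counting\<close>

text \<open>A set of at most \<open>k\<close> elements is listed and padded with \<open>None\<close>
  to length \<open>k\<close>, which leaves \<open>Suc (card Z)\<close> choices per position.\<close>

lemma card_small_subsets_le:
  assumes "finite Z"
  shows "card {G. G \<subseteq> Z \<and> card G \<le> k} \<le> Suc (card Z) ^ k"
proof -
  let ?L = "{xs. set xs \<subseteq> insert None (Some ` Z) \<and> length xs = k}"
  have fin: "finite (insert None (Some ` Z))" using assms by simp
  have "G \<in> (\<lambda>xs. {z. Some z \<in> set xs}) ` ?L" if G: "G \<subseteq> Z" "card G \<le> k" for G
  proof -
    obtain ys where ys: "set ys = G" "distinct ys"
      using finite_distinct_list[OF finite_subset[OF G(1) assms]] by blast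
    let ?xs = "map Some ys @ replicate (k - card G) None"
    have "length ?xs = k" using ys G(2) distinct_card[of ys] by simp
    moreover have "set ?xs \<subseteq> insert None (Some ` Z)" using ys G(1) by auto
    moreover have "G = {z. Some z \<in> set ?xs}" using ys by auto
    ultimately show ?thesis by blast
  qed
  then have "{G. G \<subseteq> Z \<and> card G \<le> k} \<subseteq> (\<lambda>xs. {z. Some z \<in> set xs}) ` ?L" by blast
  then have "card {G. G \<subseteq> Z \<and> card G \<le> k} \<le> card ?L"
    by (rule surj_card_le[OF finite_lists_length_eq[OF fin]])
  also have "\<dots> = Suc (card Z) ^ k"
    using card_lists_length_eq[OF fin] assms by (simp add: card_image)
  finally show ?thesis .
qed

text \<open>A random function to \<open>Q\<close> values separates \<open>R\<close> from \<open>W\<close> by its zeros.\<close>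

lemma card_separating:
  assumes "R \<subseteq> {..<S}" "W \<subseteq> {..<S}" "R \<inter> W = {}" "0 < Q" "card R \<le> r" "card W \<le> v"
  shows "Q ^ S * (Q - 1) ^ v \<le>
    card {h \<in> {..<S} \<rightarrow>\<^sub>E {..<Q}. (\<forall>a\<in>R. h a = 0) \<and> (\<forall>a\<in>W. h a \<noteq> 0)} * Q ^ (r + v)"
proof -
  have fin: "finite R" "finite W" using assms finite_subset by blast+
  let ?F = "\<lambda>a. if a \<in> R then {0} else if a \<in> W then {1..<Q} else {..<Q}"
  have eq: "{h \<in> {..<S} \<rightarrow>\<^sub>E {..<Q}. (\<forall>a\<in>R. h a = 0) \<and> (\<forall>a\<in>W. h a \<noteq> 0)} = PiE {..<S} ?F"
    (is "?A = ?B")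
  proof (intro equalityI subsetI)
    fix h assume h: "h \<in> ?A"
    then have "h a \<in> ?F a" if "a < S" for a
      using that PiE_mem[of h "{..<S}" "\<lambda>_. {..<Q}" a] by (auto simp: Suc_le_eq)
    then show "h \<in> ?B" using h by (auto simp: PiE_iff)
  next
    fix h assume h: "h \<in> ?B"
    then have *: "h a \<in> ?F a" if "a < S" for a using that by (auto simp: PiE_iff)
    have "h a < Q" if "a < S" for a using *[OF that] assms(4) by (auto split: if_splits)
    moreover have "h a = 0" if "a \<in> R" for a using *[of a] that assms(1) by auto
    moreover have "h a \<noteq> 0" if "a \<in> W" for a
    proof -
      have "a \<notin> R" "a < S" using that assms(2,3) by auto
      then show ?thesis using *[of a] that by simp
    qed
    ultimately show "h \<in> ?A" using h by (auto simp: PiE_iff)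
  qed
  \<comment> \<open>With the exact cardinalities this is an equation: an address of \<open>R\<close>
    keeps one of its \<open>Q\<close> values, one of \<open>W\<close> keeps \<open>Q - 1\<close>,
    all others keep \<open>Q\<close>.\<close>
  have "Q ^ S * (Q - 1) ^ card W = card ?B * Q ^ (card R + card W)"
  proof -
    have "card ?B = (\<Prod>a<S. card (?F a))" by (simp add: card_PiE)
    moreover have "(\<Prod>a<S. card (?F a)) * Q ^ (card R + card W) = Q ^ S * (Q - 1) ^ card W"
    proof -
      have "(\<Prod>a<S. card (?F a)) * ((\<Prod>a<S. if a \<in> R then Q else 1) * (\<Prod>a<S. if a \<in> W then Q else 1)) =
          (\<Prod>a<S. Q) * (\<Prod>a<S. if a \<in> W then Q - 1 else 1)"
        unfolding prod.distrib[symmetric] using assms(3) by (intro prod.cong) auto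
      moreover have "(\<Prod>a<S. if a \<in> X then c else 1) = c ^ card X" if "X \<subseteq> {..<S}" for X and c :: nat
      proof -
        have "(\<Prod>a<S. if a \<in> X then c else 1) = (\<Prod>a\<in>{..<S} \<inter> X. c)"
          by (subst prod.inter_restrict) auto
        then show ?thesis using that by (simp add: Int_absorb1)
      qed
      ultimately show ?thesis using assms(1,2) by (simp add: power_add)
    qed
    ultimately show ?thesis by simp
  qed
  \<comment> \<open>Passing to the bounds \<open>r\<close> and \<open>v\<close>, which do not depend
    on the input, weakens the inequality because \<open>Q - 1 \<le> Q\<close>.\<close>
  moreover have "(Q - 1) ^ (v - card W) \<le> Q ^ (v - card W)" by (intro power_mono) auto
  ultimately have "Q ^ S * (Q - 1) ^ card W * (Q - 1) ^ (v - card W) \<le>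
      card ?B * Q ^ (card R + card W) * Q ^ (v - card W)"
    by (metis mult_le_mono2)
  then have "Q ^ S * (Q - 1) ^ v \<le> card ?B * Q ^ (card R + v)"
    using assms(6) by (simp add: mult.assoc power_add[symmetric])
  also have "\<dots> \<le> card ?B * Q ^ (r + v)"
    using assms(4,5) by (intro mult_le_mono power_increasing) auto
  finally show ?thesis by (simp only: eq)
qed

text \<open>Pairs are counted in two ways: each \<open>x\<close> is served by at least the fraction
  \<alpha> / \<beta> of all \<open>h\<close>, and each \<open>h\<close> serves at most \<gamma> of
  the \<open>x\<close>. The fraction is kept as two naturals to stay free of division.\<close>

lemma double_counting_le:
  fixes \<alpha> \<beta> \<gamma> :: nat
  assumes "finite X" "finite H"
    and "\<And>x. x \<in> X \<Longrightarrow> card H * \<alpha> \<le> card {h \<in> H. P x h} * \<beta>"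
    and "\<And>h. h \<in> H \<Longrightarrow> card {x \<in> X. P x h} \<le> \<gamma>" "H \<noteq> {}"
  shows "card X * \<alpha> \<le> \<gamma> * \<beta>"
proof -
  have "card H * (card X * \<alpha>) = (\<Sum>x\<in>X. card H * \<alpha>)" by simp
  also have "\<dots> \<le> (\<Sum>x\<in>X. card {h \<in> H. P x h}) * \<beta>"
    unfolding sum_distrib_right by (intro sum_mono assms(3))
  also have "(\<Sum>x\<in>X. card {h \<in> H. P x h}) = (\<Sum>h\<in>H. card {x \<in> X. P x h})"
  proof -
    have "(\<Sum>x\<in>X. card {h \<in> H. P x h}) = (\<Sum>x\<in>X. \<Sum>h\<in>H. if P x h then 1 else 0)"
      using assms(2) by (intro sum.cong) (simp_all add: sum.If_cases Int_def)
    also have "\<dots> = (\<Sum>h\<in>H. \<Sum>x\<in>X. if P x h then 1 else 0)" by (rule sum.swap)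
    also have "\<dots> = (\<Sum>h\<in>H. card {x \<in> X. P x h})"
      using assms(1) by (intro sum.cong) (simp_all add: sum.If_cases Int_def)
    finally show ?thesis .
  qed
  also have "\<dots> \<le> card H * \<gamma>"
    using sum_bounded_above[of H "\<lambda>h. card {x \<in> X. P x h}" \<gamma>] assms(4) by simp
  finally have "card H * (card X * \<alpha>) \<le> card H * (\<gamma> * \<beta>)" by (simp add: mult.assoc)
  then show ?thesis using assms(2,5) by (simp add: card_gt_0_iff)
qed


section \<open>Averaging\<close>

lemma exists_le_average:
  fixes f :: "'a \<Rightarrow> real" and c :: real
  assumes "finite A" "A \<noteq> {}" "(\<Sum>a\<in>A. f a) \<le> c * card A"
  shows "\<exists>a\<in>A. f a \<le> c"
proof (rule ccontr)
  assume "\<not> ?thesis"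
  then have "(\<Sum>a\<in>A. c) < (\<Sum>a\<in>A. f a)"
    using assms(1,2) by (intro sum_strict_mono) auto
  with assms(3) show False by (simp add: mult.commute)
qed

text \<open>Markov's inequality in counting form.\<close>

lemma half_le_twice_average:
  fixes f :: "'a \<Rightarrow> real" and c :: real
  assumes "finite A" "\<And>a. a \<in> A \<Longrightarrow> 0 \<le> f a" "(\<Sum>a\<in>A. f a) \<le> c * card A" "0 < c"
  shows "card A \<le> 2 * card {a \<in> A. f a \<le> 2 * c}"
proof -
  let ?G = "{a \<in> A. f a \<le> 2 * c}"
  have "2 * c * card (A - ?G) = (\<Sum>a\<in>A - ?G. 2 * c)" by simp
  also have "\<dots> \<le> (\<Sum>a\<in>A - ?G. f a)" by (intro sum_mono) auto
  also have "\<dots> \<le> (\<Sum>a\<in>A. f a)" using assms by (intro sum_mono2) auto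
  finally have "c * (2 * real (card (A - ?G))) \<le> c * card A" using assms(3) by linarith
  then have "2 * real (card (A - ?G)) \<le> card A" using assms(4) by (rule mult_left_le_imp_le)
  moreover have "card (A - ?G) = card A - card ?G" "card ?G \<le> card A"
    using assms(1) by (auto intro: card_Diff_subset card_mono)
  ultimately show ?thesis by linarith
qed

text \<open>Fresh independent values for the coordinates in \<open>I\<close> leave the uniform
  distribution unchanged: exchanging these coordinates between \<open>z\<close> and \<open>x\<close>
  is an involution on pairs.\<close>

lemma sum_resample:
  fixes g :: "('a \<Rightarrow> 'b) \<Rightarrow> real"
  assumes "finite A" "I \<subseteq> A" "finite F"
  shows "(\<Sum>z\<in>A \<rightarrow>\<^sub>E F. \<Sum>x\<in>I \<rightarrow>\<^sub>E F. g (\<lambda>a. if a \<in> I then x a else z a)) =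
    card (I \<rightarrow>\<^sub>E F) * (\<Sum>z\<in>A \<rightarrow>\<^sub>E F. g z)"
proof -
  let ?P = "(A \<rightarrow>\<^sub>E F) \<times> (I \<rightarrow>\<^sub>E F)"
  let ?i = "\<lambda>(z, x). (\<lambda>a. if a \<in> I then x a else z a, restrict z I)"
  have "?i (?i p) = p \<and> ?i p \<in> ?P" if pP: "p \<in> ?P" for p
  proof -
    obtain z x where p: "p = (z, x)" "z \<in> A \<rightarrow>\<^sub>E F" "x \<in> I \<rightarrow>\<^sub>E F" using pP by (cases p) auto
    have "restrict (\<lambda>a. if a \<in> I then x a else z a) I = x"
      using p(3) by (auto simp: restrict_def PiE_iff extensional_def)
    moreover have "(\<lambda>a. if a \<in> I then restrict z I a else if a \<in> I then x a else z a) = z" by auto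
    moreover have "(\<lambda>a. if a \<in> I then x a else z a) \<in> A \<rightarrow>\<^sub>E F" "restrict z I \<in> I \<rightarrow>\<^sub>E F"
      using p assms(2) by (auto simp: PiE_iff extensional_def)
    ultimately show ?thesis unfolding p by simp
  qed
  then have "(\<Sum>p\<in>?P. g (fst (?i p))) = (\<Sum>p\<in>?P. g (fst p))"
    by (intro sum.reindex_bij_witness[of _ ?i ?i]) auto
  moreover have "(\<Sum>p\<in>?P. g (fst (?i p))) =
      (\<Sum>z\<in>A \<rightarrow>\<^sub>E F. \<Sum>x\<in>I \<rightarrow>\<^sub>E F. g (\<lambda>a. if a \<in> I then x a else z a))"
    unfolding sum.cartesian_product by (simp add: case_prod_unfold)
  moreover have "(\<Sum>p\<in>?P. g (fst p)) = (\<Sum>z\<in>A \<rightarrow>\<^sub>E F. \<Sum>x\<in>I \<rightarrow>\<^sub>E F. g z)"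
    unfolding sum.cartesian_product by (simp add: case_prod_unfold)
  ultimately show ?thesis by (simp add: sum_distrib_left)
qed

lemma sum_resample_single:
  fixes g :: "('a \<Rightarrow> 'b) \<Rightarrow> real"
  assumes "finite A" "i \<in> A" "finite F"
  shows "(\<Sum>z\<in>A \<rightarrow>\<^sub>E F. \<Sum>y\<in>F. g (z(i := y))) = card F * (\<Sum>z\<in>A \<rightarrow>\<^sub>E F. g z)"
proof -
  let ?P = "(A \<rightarrow>\<^sub>E F) \<times> F"
  let ?i = "\<lambda>(z, y). (z(i := y), z i)"
  have "?i (?i p) = p \<and> ?i p \<in> ?P" if "p \<in> ?P" for p
    using that assms(2) by (auto simp: PiE_iff extensional_def)
  then have "(\<Sum>p\<in>?P. g (fst (?i p))) = (\<Sum>p\<in>?P. g (fst p))"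
    by (intro sum.reindex_bij_witness[of _ ?i ?i]) auto
  moreover have "(\<Sum>p\<in>?P. g (fst (?i p))) = (\<Sum>z\<in>A \<rightarrow>\<^sub>E F. \<Sum>y\<in>F. g (z(i := y)))"
    unfolding sum.cartesian_product by (simp add: case_prod_unfold)
  moreover have "(\<Sum>p\<in>?P. g (fst p)) = (\<Sum>z\<in>A \<rightarrow>\<^sub>E F. \<Sum>y\<in>F. g z)"
    unfolding sum.cartesian_product by (simp add: case_prod_unfold)
  ultimately show ?thesis by (simp add: sum_distrib_left)
qed

lemma sum_offsets:
  fixes f :: "nat \<Rightarrow> 'b :: comm_monoid_add"
  shows "(\<Sum>j<m * g. f j) = (\<Sum>o'<g. \<Sum>k<m. f (o' + g * k))"
proof -
  have "(\<Sum>j<m * g. f j) = (\<Sum>k<m. \<Sum>o'<g. f (o' + g * k))"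
  proof (induction m)
    case (Suc m)
    have "(\<Sum>j<A + L. f j) = (\<Sum>j<A. f j) + (\<Sum>j<L. f (j + A))" for A L
      by (induction L) (simp_all add: ac_simps)
    from this[of "m * g" g] Suc show ?case by (simp add: ac_simps)
  qed simp
  then show ?thesis by (simp add: sum.swap[of _ "{..<g}"])
qed


section \<open>Recovering the factors of a product from its prefixes\<close>

lemma prefix_map_cancel:
  assumes "c < j" "j \<le> e" "\<And>c'. c < c' \<Longrightarrow> c' < e \<Longrightarrow> p c' = p' c' \<and> inj (p c')"
    and "prefix_map p e a = prefix_map p' e a"
  shows "prefix_map p j a = prefix_map p' j a"
  using assms(2,1)
proof (induction rule: inc_induct)
  case base
  then show ?case using assms(4) by simp
next
  case (step j)
  have eq: "p j = p' j" and inj: "inj (p j)"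
    using assms(3)[OF step.prems step.hyps(2)] by blast+
  have "p j (prefix_map p j a) = p j (prefix_map p' j a)" using step eq by simp
  then show ?case by (rule injD[OF inj])
qed

text \<open>Between consecutive known prefixes at most one factor is unknown, because the columns in
  question are congruent modulo \<open>g\<close>.\<close>

lemma prefix_maps_determine:
  assumes p: "\<And>c. c < N \<Longrightarrow> p c permutes A \<and> p' c permutes A"
    and spread: "\<And>c c'. c < N \<Longrightarrow> c' < N \<Longrightarrow> p c \<noteq> p' c \<Longrightarrow> p c' \<noteq> p' c' \<Longrightarrow> c mod g = c' mod g"
    and N: "N = m * g" and o: "o' < g"
    and known: "\<And>k a. k < m \<Longrightarrow> a \<in> A \<Longrightarrow>
      prefix_map p (Suc (o' + g * k)) a = prefix_map p' (Suc (o' + g * k)) a"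
    and all: "\<And>a. a \<in> A \<Longrightarrow> prefix_map p N a = prefix_map p' N a"
    and c: "c < N"
  shows "p c = p' c"
proof (rule ccontr)
  assume "p c \<noteq> p' c"
  \<comment> \<open>Before the least column of disagreement the products agree; a known prefix that
    reaches beyond it without meeting another disagreement then determines the factor at
    \<open>c0\<close>.\<close>
  define c0 where "c0 = (LEAST c. c < N \<and> p c \<noteq> p' c)"
  have c0: "c0 < N" "p c0 \<noteq> p' c0"
    using LeastI[of "\<lambda>c. c < N \<and> p c \<noteq> p' c" c] c \<open>p c \<noteq> p' c\<close> by (auto simp: c0_def)
  have below: "p c' = p' c'" if "c' < c0" for c'
    using not_less_Least[of c' "\<lambda>c. c < N \<and> p c \<noteq> p' c"] that c0(1) by (auto simp: c0_def)
  \<comment> \<open>the first known prefix that contains the column \<open>c0\<close>\<close>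
  have "\<exists>e. c0 < e \<and> e \<le> N \<and> e \<le> c0 + g \<and> (\<forall>a\<in>A. prefix_map p e a = prefix_map p' e a)"
  proof (cases "c0 + g < N")
    \<comment> \<open>Within \<open>g\<close> columns of the end there may be no further known
      prefix; the product of all factors takes its place.\<close>
    case False
    then show ?thesis using c0 all by (intro exI[of _ N]) auto
  next
    case True
    \<comment> \<open>The least \<open>k\<close> with \<open>c0 \<le> o' + g * k\<close>, written as
      a rounded-up quotient in which the subtraction of naturals cannot truncate because
      \<open>o' < g\<close>.\<close>
    define k where "k = (c0 + (g - 1 - o')) div g"
    have up: "g * k \<le> c0 + (g - 1 - o')" unfolding k_def by simp
    have "c0 + (g - 1 - o') < g * k + g"
      unfolding k_def using o by (metis dividend_less_times_div add.commute gr_zeroI mult_Suc_right not_less_zero)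
    then have lo: "c0 \<le> o' + g * k" using o by linarith
    have "o' + g * k < N" using up o True by linarith
    then have "g * k < g * m" unfolding N mult.commute[of m] by linarith
    then have "k < m" unfolding mult_less_cancel1 ..
    then show ?thesis
      using known lo up o \<open>o' + g * k < N\<close> by (intro exI[of _ "Suc (o' + g * k)"]) auto
  qed
  then obtain e where e: "c0 < e" "e \<le> N" "e \<le> c0 + g"
    "\<And>a. a \<in> A \<Longrightarrow> prefix_map p e a = prefix_map p' e a" by blast
  have mid: "p c' = p' c' \<and> inj (p c')" if "c0 < c'" "c' < e" for c'
  proof
    show "p c' = p' c'"
    proof (rule ccontr)
      assume "p c' \<noteq> p' c'"
      then have "c0 mod g = c' mod g" using spread[of c0 c'] c0 that e by simp
      then have "g dvd c' - c0" using that by (metis mod_eq_dvd_iff_nat less_imp_le)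
      then have "g \<le> c' - c0" using that by (simp add: dvd_imp_le)
      then show False using that e by linarith
    qed
    show "inj (p c')" using p[of c'] permutes_inj that e by auto
  qed
  have "p c0 (prefix_map p c0 a) = p' c0 (prefix_map p c0 a)" if "a \<in> A" for a
  proof -
    have "prefix_map p (Suc c0) a = prefix_map p' (Suc c0) a"
      using e by (intro prefix_map_cancel[of c0 "Suc c0" e p p' a] mid e(4) that) simp_all
    then show ?thesis using prefix_map_cong[of c0 p p', OF below] by simp
  qed
  moreover have "prefix_map p c0 permutes A"
    using prefix_map_permutes[of c0 p A] p c0(1) by simp
  ultimately have "p c0 b = p' c0 b" if "b \<in> A" for b
  proof -
    obtain a where "b = prefix_map p c0 a"
      using permutes_surj[OF \<open>prefix_map p c0 permutes A\<close>] by (rule surjE)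
    moreover from this have "a \<in> A"
      using permutes_in_image[OF \<open>prefix_map p c0 permutes A\<close>] that by simp
    ultimately show ?thesis
      using \<open>\<And>a. a \<in> A \<Longrightarrow> p c0 (prefix_map p c0 a) = p' c0 (prefix_map p c0 a)\<close> by simp
  qed
  moreover have "p c0 b = p' c0 b" if "b \<notin> A" for b
    using p[OF c0(1)] that permutes_not_in by metis
  ultimately show False using c0(2) by blast
qed


section \<open>A data structure running the hard sequences\<close>

text \<open>The initial memory \<open>m0\<close> is fixed here; \<open>exists_cheap_memory\<close>
  will supply one that is cheap on average over the inputs. An even \<open>b\<close> lets the
  children of a node be split into two equal halves.\<close>

locale hard = schedule M N Kq n col
  for M N Kq n :: nat and col :: "nat \<Rightarrow> nat" +
  fixes C B b d q :: nat and D :: data_structure and m0 :: memory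
  assumes solves: "solves_connectivity C n B unions_of_paths D"
    and m0: "m0 \<in> initial_memories n B D"
    and b_pos: "0 < b" and even_b: "even b" and N_eq: "N = b ^ d"
    and col_eq: "\<And>t. t < N \<Longrightarrow> col t = digit_rev b d t"
    and Kq_eq: "Kq = q * M" and q_pos: "0 < q"
begin

abbreviation "S \<equiv> num_pages D"
abbreviation "w \<equiv> page_bits n B"
abbreviation "mem x Y k \<equiv> run D (sched x Y) m0 k"

lemma Kq_pos: "0 < Kq"
  using M_pos q_pos by (simp add: Kq_eq)

lemma N_pos: "0 < N"
  using b_pos by (simp add: N_eq)

lemma wf_D: "wf_data_structure C n B D"
  using solves by (simp add: solves_connectivity_def)

lemma query_slotE:
  assumes "k < start N" "sched x Y k = Connected u v"
  obtains t s where "t < N" "s < Kq" "k = start t + 2 * M + s"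
proof -
  have k: "\<not> k < N * M" using assms(2) by (auto simp: sched_def)
  define t r where "t = (k - N * M) div bl" and "r = (k - N * M) mod bl"
  have k_eq: "k = start t + r"
    using k div_mult_mod_eq[of "k - N * M" bl] unfolding start_def t_def r_def by linarith
  have r: "r < bl" using bl_pos by (simp add: r_def)
  have t: "t < N" using assms(1) k by (simp add: t_def start_def less_mult_imp_div_less)
  have "2 * M \<le> r"
    using assms(2) sched_block[OF r, of x Y t] k_eq by (auto simp: block_op_def split: if_splits)
  then show thesis using that[of t "r - 2 * M"] t r k_eq by (simp add: bl_def)
qed

lemma answers:
  assumes "valid_input x Y" "k \<le> start N" "u < n" "v < n"
  shows "write_discipline (connected_query D u v) (mem x Y k)"
    and "answer (connected_query D u v) (mem x Y k) \<longleftrightarrow>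
      joined (graph_after (map (sched x Y) [0..<k])) u v"
  using solves m0 legal_sched[OF assms(1,2)] assms(3,4)
  unfolding solves_connectivity_def run_eq_memory_after by blast+

text \<open>The end \<open>c\<close> is arbitrary, not necessarily the correct one: at a wrong end
  the query is rejected. This turns an acceptance into knowledge of the permutations.\<close>

lemma query_answer:
  assumes "valid_input x Y" "t < N" "s < Kq" "j < N" "a < M" "c < M"
  shows "accepted D (Connected a (Suc j * M + c)) (mem x Y (start t + 2 * M + s)) \<longleftrightarrow>
      prefix_map (perms x (Suc t)) (Suc j) a = c"
    and "disciplined D (Connected a (Suc j * M + c)) (mem x Y (start t + 2 * M + s))"
proof -
  have n: "a < n" "Suc j * M + c < n"
    using layer_bound[OF N_pos assms(5,6) size] layer_bound[OF assms(4-6) size] by simp_all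
  have le: "start t + 2 * M + s \<le> start N" using slot_less[OF assms(2,3)] by simp
  show "accepted D (Connected a (Suc j * M + c)) (mem x Y (start t + 2 * M + s)) \<longleftrightarrow>
      prefix_map (perms x (Suc t)) (Suc j) a = c"
    using answers(2)[OF assms(1) le n] joined_query[OF assms(1-3) _ assms(5,6), of "Suc j"] assms(4)
    by (simp del: mult_Suc prefix_map.simps)
  show "disciplined D (Connected a (Suc j * M + c)) (mem x Y (start t + 2 * M + s))"
    using answers(1)[OF assms(1) le n] by simp
qed

lemma
  assumes "valid_input x Y" "t < N" "s < Kq" "fst y < N" "snd y < M"
  shows accepted_query_op: "accepted D (query_op x t y) (mem x Y (start t + 2 * M + s))"
    and disciplined_query_op: "disciplined D (query_op x t y) (mem x Y (start t + 2 * M + s))"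
proof -
  have "target x t y < M" using target_less assms by (simp add: valid_input_def)
  note qa = query_answer[OF assms(1-5) this]
  show "accepted D (query_op x t y) (mem x Y (start t + 2 * M + s))"
    using qa(1) unfolding query_op_def target_def by blast
  show "disciplined D (query_op x t y) (mem x Y (start t + 2 * M + s))"
    using qa(2) unfolding query_op_def .
qed

text \<open>The query is worded according to \<open>x'\<close> but asked in a run on
  \<open>x\<close>. If it is accepted there, correctness makes the two inputs agree on its
  end.\<close>

lemma accepted_query_op_imp:
  assumes "valid_input x Y" "t < N" "s < Kq" "fst y < N" "snd y < M" "valid_input x' Y'"
    and "accepted D (query_op x' t y) (mem x Y (start t + 2 * M + s))"
  shows "target x t y = target x' t y"
proof -
  have "target x' t y < M" using target_less assms(4-6) by (simp add: valid_input_def)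
  from query_answer(1)[OF assms(1-5) this] assms(7) show ?thesis
    unfolding query_op_def target_def by blast
qed

lemma
  assumes "valid_input x Y" "k < start N"
  shows accepted_sched: "accepted D (sched x Y k) (mem x Y k)"
    and disciplined_sched: "disciplined D (sched x Y k) (mem x Y k)"
proof -
  have "accepted D (sched x Y k) (mem x Y k) \<and> disciplined D (sched x Y k) (mem x Y k)"
  proof (cases "sched x Y k")
    case (Connected u v)
    then obtain t s where ts: "t < N" "s < Kq" "k = start t + 2 * M + s"
      using query_slotE[OF assms(2)] by blast
    have y: "fst (Y (t, s)) < N" "snd (Y (t, s)) < M"
      using assms(1) ts by (auto simp: valid_input_def)
    show ?thesis
      unfolding ts(3) sched_query[OF ts(2)]
      using accepted_query_op[OF assms(1) ts(1,2) y] disciplined_query_op[OF assms(1) ts(1,2) y]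
      by blast
  qed auto
  then show "accepted D (sched x Y k) (mem x Y k)" "disciplined D (sched x Y k) (mem x Y k)"
    by blast+
qed

lemma wf_legal_op:
  assumes "legal_op n f E"
  shows "wf_op S w D f"
  using wf_D assms by (cases f) (auto simp: wf_data_structure_def Let_def)

lemma wf_sched:
  assumes "valid_input x Y" "k < start N"
  shows "wf_op S w D (sched x Y k)"
  using sched_correct[OF assms] wf_legal_op by blast

lemma wf_query_op:
  assumes "valid_input x Y" "fst y < N" "snd y < M"
  shows "wf_op S w D (query_op x t y)"
proof -
  have "target x t y < M" using target_less assms by (simp add: valid_input_def)
  then have "snd y < n" "Suc (fst y) * M + target x t y < n"
    using layer_bound[OF N_pos assms(3) _ size] layer_bound[OF assms(2,3) _ size] by auto
  then have "legal_op n (query_op x t y) {}" by (simp add: query_op_def)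
  then show ?thesis by (rule wf_legal_op)
qed

lemma valid_mem:
  assumes "valid_input x Y" "k \<le> start N"
  shows "valid_memory S w (mem x Y k)"
  using assms(2)
proof (induction k)
  case 0
  have "random_pages D \<subseteq> {..<S}" "\<forall>a<S. init_page D a < 2 ^ w"
    using wf_D by (simp_all add: wf_data_structure_def Let_def)
  moreover have "\<forall>a\<in>random_pages D. m0 a < 2 ^ w" "\<forall>a. a \<notin> random_pages D \<longrightarrow> m0 a = init_page D a"
    using m0 by (simp_all add: initial_memories_def)
  ultimately show ?case unfolding valid_memory_def run.simps by metis
next
  case (Suc k)
  then show ?case
    using valid_op_memory[OF wf_sched accepted_sched] assms(1) by simp
qed

lemma rd_wr_bounded:
  assumes "valid_input x Y" "k < start N"
  shows "rd D (sched x Y) m0 k \<subseteq> {..<S}" "wr D (sched x Y) m0 k \<subseteq> {..<S}"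
  using op_bounded[OF wf_sched accepted_sched valid_mem, of x Y k] assms
  by (auto simp: rd_def wr_def)

lemma card_rd_wr_le_total_cost:
  assumes "valid_input x Y"
  shows "(\<Sum>k<start N. card (rd D (sched x Y) m0 k) + card (wr D (sched x Y) m0 k)) \<le>
    total_cost D (map (sched x Y) [0..<start N]) m0"
  unfolding total_cost_map rd_def wr_def
  by (intro sum_mono card_op_reads_writes[OF wf_sched accepted_sched]) (use assms in auto)

end


section \<open>Certificates\<close>

text \<open>The slot \<open>s\<close> of block \<open>t\<close> on level \<open>i\<close>: \<open>I\<close> contains the blocks between \<open>lo\<close> and \<open>mid\<close>, the
  earlier siblings of the group of \<open>L\<close> blocks to which \<open>t\<close> belongs, in their parent of \<open>P\<close> blocks.\<close>

locale window = hard M N Kq n col C B b d q D m0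
  for M N Kq n :: nat and col :: "nat \<Rightarrow> nat" and C B b d q :: nat
    and D :: data_structure and m0 :: memory +
  fixes i t s :: nat
  assumes i: "i < d" and t: "t < N" and s: "s < Kq"
begin

definition L :: nat where "L = b ^ i"
definition P :: nat where "P = b ^ Suc i"
text \<open>At once the number of parents, since \<open>N = P * g\<close>, and the modulus to which
  the columns of blocks in one parent are congruent.\<close>

definition g :: nat where "g = b ^ (d - Suc i)"
definition lo :: nat where "lo = start (P * (t div P))"
definition mid :: nat where "mid = start (L * (t div L))"
definition slot :: nat where "slot = start t + 2 * M + s"
definition I :: "nat set" where "I = {P * (t div P)..<L * (t div L)}"
definition J :: "(nat \<times> nat) set" where "J = {L * (t div L)..<L * (t div L) + L} \<times> {..<Kq}"

lemma L_pos: "0 < L" and P_pos: "0 < P" and g_pos: "0 < g"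
  using b_pos by (simp_all add: L_def P_def g_def)

lemma P_eq: "P = L * b"
  by (simp add: P_def L_def)

lemma N_eq': "N = P * g"
proof -
  have "d = Suc i + (d - Suc i)" using i by simp
  then show ?thesis unfolding N_eq P_def g_def by (metis power_add)
qed

lemma window_order: "P * (t div P) \<le> L * (t div L)" "L * (t div L) \<le> t"
    "L * (t div L) + L \<le> N"
proof -
  have "P * (t div P) = L * (b * (t div L div b))"
    by (simp add: P_eq div_mult2_eq)
  also have "\<dots> \<le> L * (t div L)" by (intro mult_le_mono2) simp
  finally show "P * (t div P) \<le> L * (t div L)" .
  show "L * (t div L) \<le> t" by simp
  have "N = L * (b * g)" by (simp add: N_eq' P_eq)
  then have "t div L < b * g" using t by (simp add: less_mult_imp_div_less mult.commute)
  then have "L * Suc (t div L) \<le> L * (b * g)" by (intro mult_le_mono2) simp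
  then show "L * (t div L) + L \<le> N" using \<open>N = L * (b * g)\<close> by simp
qed

lemma index_order: "lo \<le> mid" "mid \<le> slot" "slot < start N"
proof -
  show "lo \<le> mid" using window_order(1) by (simp add: lo_def mid_def start_mono)
  have "mid \<le> start t" using window_order(2) by (simp add: mid_def start_mono)
  then show "mid \<le> slot" by (simp add: slot_def)
  show "slot < start N" using slot_less[OF t s] by (simp add: slot_def)
qed

lemma I_less:
  assumes "u \<in> I"
  shows "u < t" "u < N"
proof -
  have "u < L * (t div L)" using assms by (simp add: I_def)
  then show "u < t" using window_order(2) by linarith
  then show "u < N" using t by linarith
qed

text \<open>All blocks of \<open>I\<close> have the same quotient by \<open>P\<close>, that is the
  same high digits, and reversal moves these to the low end.\<close>

lemma col_I_mod:
  assumes "u \<in> I" "v \<in> I"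
  shows "col u mod g = col v mod g"
proof -
  have "col u mod g = digit_rev b (d - Suc i) (t div P)" if "u \<in> I" for u
  proof -
    have "u \<le> t" using I_less(1)[OF that] by simp
    then have "u div P \<le> t div P" by (rule div_le_mono)
    moreover have "t div P \<le> u div P"
      using that div_le_mono[of "P * (t div P)" u P] P_pos by (simp add: I_def)
    ultimately have "u div P = t div P" by simp
    moreover have "col u = digit_rev b ((d - Suc i) + Suc i) u"
      using col_eq[OF I_less(2)[OF that]] i by simp
    ultimately show ?thesis
      using digit_rev_mod[OF b_pos, of "d - Suc i" "Suc i" u] by (simp add: g_def P_def del: digit_rev.simps)
  qed
  then show ?thesis using assms by simp
qed

end

text \<open>The permutations of the blocks outside \<open>I\<close> are those of \<open>x0\<close>, all queries before the slot are
  those of \<open>Y0\<close>, and the queries considered at the slot are those of \<open>Yo\<close>.\<close>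

locale certificate = window M N Kq n col C B b d q D m0 i t s
  for M N Kq n :: nat and col :: "nat \<Rightarrow> nat" and C B b d q :: nat
    and D :: data_structure and m0 :: memory and i t s :: nat +
  fixes o' :: nat and x0 :: "nat \<Rightarrow> nat \<Rightarrow> nat" and Y0 :: "nat \<times> nat \<Rightarrow> nat \<times> nat"
  assumes o': "o' < g" and valid0: "valid_input x0 Y0"
begin

definition completed :: "(nat \<Rightarrow> nat \<Rightarrow> nat) \<Rightarrow> nat \<Rightarrow> nat \<Rightarrow> nat" where
  "completed z u = (if u \<in> I then z u else x0 u)"

text \<open>All rows are asked at each of \<open>P\<close> columns that are \<open>g\<close> apart;
  hence the targets determine whole prefix products.\<close>

definition Yo :: "(nat \<times> nat) set" where
  "Yo = (\<lambda>(k, a). (o' + g * k, a)) ` ({..<P} \<times> {..<M})"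

definition W where "W x = written D (sched x Y0) m0 lo mid"
definition V where "V x = written D (sched x Y0) m0 mid slot"
definition old where "old x = (\<Union>k\<in>{mid..<slot}. old_reads D (sched x Y0) m0 mid k)"
definition query_old where "query_old x y = op_reads D (query_op x t y) (mem x Y0 slot) - V x"
definition bad where "bad x = {y \<in> Yo. query_old x y \<inter> W x \<noteq> {}}"
text \<open>The cells from before \<open>mid\<close> that the simulation reads and that
  \<open>I\<close> leaves untouched. Their contents are those at time \<open>lo\<close>, so nothing
  has to be recorded about them except that they are untouched.\<close>

definition R where "R x = (old x - W x) \<union> (\<Union>y\<in>Yo - bad x. query_old x y)"
definition T where "T x = old x \<inter> W x"

text \<open>One \<open>h\<close> serves many inputs at once: if it separates for \<open>x\<close>
  and for \<open>x'\<close>, then \<open>R x\<close> is disjoint from \<open>W x'\<close> as well,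
  which permits comparing the two runs.\<close>

definition separates :: "(nat \<Rightarrow> nat) \<Rightarrow> (nat \<Rightarrow> nat \<Rightarrow> nat) \<Rightarrow> bool" where
  "separates h x \<longleftrightarrow> (\<forall>a\<in>R x. h a = 0) \<and> (\<forall>a\<in>W x. h a \<noteq> 0)"

text \<open>The final component is the product of all permutations: the prefixes queried in \<open>Yo\<close> may end
  before the last column of \<open>I\<close>.\<close>

definition cert where
  "cert x = ((\<lambda>a. (a, mem x Y0 mid a)) ` T x, restrict (\<lambda>(u, r). target x u (Y0 (u, r))) J,
     (\<lambda>y. (y, target x t y)) ` bad x, prefix_map (perms x (Suc t)) N)"

lemma Yo_bounds: "y \<in> Yo \<Longrightarrow> fst y < N \<and> snd y < M"
proof -
  assume "y \<in> Yo"
  then obtain k a where y: "y = (o' + g * k, a)" "k < P" "a < M" by (auto simp: Yo_def)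
  have "g * Suc k \<le> g * P" using y(2) by (intro mult_le_mono2) simp
  then have "o' + g * k < N" using o' by (simp add: N_eq' mult.commute)
  with y show ?thesis by simp
qed

lemma valid_completed:
  assumes "z \<in> I \<rightarrow>\<^sub>E {p. p permutes {..<M}}"
  shows "valid_input (completed z) Y0"
  using assms valid0 by (auto simp: valid_input_def completed_def PiE_iff)

lemma sched_before_window:
  assumes "k < lo"
  shows "sched (completed z) Y k = sched x0 Y k"
proof (cases "k < N * M")
  case False
  let ?u = "(k - N * M) div bl"
  have "?u < P * (t div P)"
    using assms False by (simp add: lo_def start_def less_mult_imp_div_less)
  then have eq: "completed z u = x0 u" if "u \<le> ?u" for u
    using that by (simp add: completed_def I_def)
  have "perms (completed z) (Suc ?u) c = perms x0 (Suc ?u) c" for c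
    by (simp add: perms_def eq less_Suc_eq_le)
  then have "perms (completed z) (Suc ?u) = perms x0 (Suc ?u)" by blast
  then have "target (completed z) ?u y = target x0 ?u y" for y
    by (simp only: target_def)
  then show ?thesis using False eq[of ?u]
    by (simp add: sched_def block_op_def query_op_def)
qed (simp add: sched_def)

text \<open>The updates from \<open>mid\<close> on are those of \<open>x0\<close>, but the wording
  of a query contains its target, which depends on the permutations of \<open>I\<close>; hence the
  assumption on the targets in \<open>J\<close>.\<close>

lemma sched_after_window:
  assumes "mid \<le> k" "k < slot"
    and targets: "\<And>u r. (u, r) \<in> J \<Longrightarrow> target (completed z) u (Y0 (u, r)) = target (completed z') u (Y0 (u, r))"
  shows "sched (completed z) Y0 k = sched (completed z') Y0 k"
proof -
  let ?u = "(k - N * M) div bl" and ?r = "(k - N * M) mod bl"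
  have k: "\<not> k < N * M" using assms(1) by (simp add: mid_def start_def)
  have u1: "L * (t div L) \<le> ?u"
  proof -
    have "L * (t div L) * bl \<le> k - N * M" using assms(1) by (simp add: mid_def start_def)
    from div_le_mono[OF this, of bl] show ?thesis using bl_pos by simp
  qed
  have u2: "?u \<le> t"
  proof -
    have "k - N * M < Suc t * bl"
      using assms(2) s by (simp add: slot_def start_def bl_def)
    then show ?thesis by (metis less_Suc_eq_le less_mult_imp_div_less)
  qed
  have "t < L * (t div L) + L"
    using dividend_less_times_div[OF L_pos, of t] by (simp add: add.commute)
  then have J: "(?u, r) \<in> J" if "r < Kq" for r
    using that u1 u2 by (auto simp: J_def)
  have x: "completed z ?u = completed z' ?u"
    using u1 by (simp add: completed_def I_def)
  have r: "?r < bl" using bl_pos by simp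
  have "query_op (completed z) ?u (Y0 (?u, ?r - 2 * M)) = query_op (completed z') ?u (Y0 (?u, ?r - 2 * M))"
    if "2 * M \<le> ?r"
    using targets[OF J, of "?r - 2 * M"] that r by (simp add: query_op_def bl_def)
  then show ?thesis using k x by (simp add: sched_def block_op_def)
qed

lemma T_subset_W: "T x \<subseteq> W x" and R_disjoint_W: "R x \<inter> W x = {}"
  by (auto simp: T_def R_def bad_def)

text \<open>For a bad query the target is listed in the certificate. For any other query the run on
  \<open>x'\<close> simulates the one on \<open>x\<close>: the operations from \<open>mid\<close> on
  coincide, and an old read lies in \<open>T x\<close>, whose contents are listed, or in
  \<open>R x\<close>, unchanged since \<open>lo\<close> in both runs. So the query worded for
  \<open>x\<close> is accepted on \<open>x'\<close> too.\<close>

lemma target_eq: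
  assumes z: "z \<in> I \<rightarrow>\<^sub>E {p. p permutes {..<M}}" and z': "z' \<in> I \<rightarrow>\<^sub>E {p. p permutes {..<M}}"
    and sep: "separates h (completed z)" "separates h (completed z')"
    and cert: "cert (completed z) = cert (completed z')" and y: "y \<in> Yo"
  shows "target (completed z) t y = target (completed z') t y"
proof -
  define x x' where "x = completed z" and "x' = completed z'"
  have valid: "valid_input x Y0" "valid_input x' Y0"
    using valid_completed z z' by (simp_all add: x_def x'_def)
  have c1: "(\<lambda>a. (a, mem x Y0 mid a)) ` T x = (\<lambda>a. (a, mem x' Y0 mid a)) ` T x'"
    and c2: "restrict (\<lambda>(u, r). target x u (Y0 (u, r))) J = restrict (\<lambda>(u, r). target x' u (Y0 (u, r))) J"
    and c3: "(\<lambda>y. (y, target x t y)) ` bad x = (\<lambda>y. (y, target x' t y)) ` bad x'"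
    using cert by (simp_all add: cert_def x_def x'_def)
  show ?thesis
  proof (cases "y \<in> bad x")
    case True
    then have "(y, target x t y) \<in> (\<lambda>y. (y, target x' t y)) ` bad x'" using c3 by blast
    then show ?thesis by (auto simp: x_def x'_def)
  next
    case good: False
    have targets: "target x u (Y0 (u, r)) = target x' u (Y0 (u, r))" if "(u, r) \<in> J" for u r
      using fun_cong[OF c2, of "(u, r)"] that by simp
    have same_ops: "sched x Y0 k = sched x' Y0 k" if "mid \<le> k" "k < slot" for k
      using sched_after_window[OF that, of z z'] targets by (simp add: x_def x'_def)
    have lo: "mem x Y0 lo = mem x' Y0 lo"
      by (intro run_cong) (simp add: x_def x'_def sched_before_window)
    have less: "k < start N" if "k \<le> slot" for k
      using that index_order(3) by simp
    have frame: "mem v Y0 mid a = mem v Y0 lo a" if "valid_input v Y0" "a \<notin> W v" for v a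
      using run_outside_written[OF index_order(1)] accepted_sched[OF that(1) less] that(2) index_order(2)
      unfolding W_def by simp
    have agree: "mem x' Y0 mid a = mem x Y0 mid a" if "a \<in> T x \<or> a \<in> R x" for a
      using that
    proof
      assume "a \<in> T x"
      then have "(a, mem x Y0 mid a) \<in> (\<lambda>a. (a, mem x' Y0 mid a)) ` T x'" using c1 by blast
      then show ?thesis by auto
    next
      assume a: "a \<in> R x"
      then have "a \<notin> W x" using R_disjoint_W by blast
      \<comment> \<open>Here \<open>h a = 0\<close> because of \<open>R x\<close>, while
        \<open>h\<close> has no zeros in \<open>W x'\<close>.\<close>
      moreover have "a \<notin> W x'"
        using a sep unfolding separates_def x_def x'_def by blast
      ultimately show ?thesis using frame valid lo by simp
    qed
    note yb = Yo_bounds[OF y]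
    have "accepted D (query_op x t y) (mem x' Y0 slot)"
    proof (rule answer_simulation[OF index_order(2) same_ops])
      show "accepted D (sched x Y0 k) (mem x Y0 k)" if "mid \<le> k" "k < slot" for k
        using accepted_sched[OF valid(1) less] that by simp
      show "disciplined D (sched x' Y0 k) (mem x' Y0 k)" if "mid \<le> k" "k < slot" for k
        using disciplined_sched[OF valid(2) less] that by simp
      show "accepted D (query_op x t y) (mem x Y0 slot)"
        using accepted_query_op[OF valid(1) t s] yb by (simp add: slot_def)
      have "target x t y < M" using target_less[of x y t] yb valid(1) by (simp add: valid_input_def)
      then show "disciplined D (query_op x t y) (mem x' Y0 slot)"
        using query_answer(2)[OF valid(2) t s, of "fst y" "snd y" "target x t y"] yb
        by (simp only: query_op_def slot_def)
      show "mem x' Y0 mid a = mem x Y0 mid a"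
        if "mid \<le> k" "k < slot" "a \<in> old_reads D (sched x Y0) m0 mid k" for k a
      proof (rule agree)
        have "a \<in> old x" using that by (auto simp: old_def)
        then show "a \<in> T x \<or> a \<in> R x" by (auto simp: T_def R_def)
      qed
      show "mem x' Y0 mid a = mem x Y0 mid a"
        if "a \<in> op_reads D (query_op x t y) (mem x Y0 slot)" "a \<notin> written D (sched x Y0) m0 mid slot" for a
      proof (rule agree)
        have "a \<in> query_old x y" using that by (simp add: query_old_def V_def)
        then show "a \<in> T x \<or> a \<in> R x" using y good by (auto simp: R_def)
      qed
    qed
    then show ?thesis
      using accepted_query_op_imp[OF valid(2) t s _ _ valid(1), of y] yb
      unfolding x_def x'_def slot_def by simp
  qed
qed

text \<open>The targets at \<open>Yo\<close> and the full product determine every factor, because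
  factors can differ only in columns of \<open>I\<close>, which are congruent modulo
  \<open>g\<close>.\<close>

lemma cert_inj:
  assumes z: "z \<in> I \<rightarrow>\<^sub>E {p. p permutes {..<M}}" and z': "z' \<in> I \<rightarrow>\<^sub>E {p. p permutes {..<M}}"
    and sep: "separates h (completed z)" "separates h (completed z')"
    and cert: "cert (completed z) = cert (completed z')"
  shows "z = z'"
proof -
  let ?p = "perms (completed z) (Suc t)" and ?p' = "perms (completed z') (Suc t)"
  have valid: "\<forall>u<N. completed z u permutes {..<M}" "\<forall>u<N. completed z' u permutes {..<M}"
    using valid_completed z z' by (simp_all add: valid_input_def)
  have inI: "inv col c \<in> I" if "?p c \<noteq> ?p' c" for c
    using that by (auto simp: perms_def completed_def split: if_splits)
  have eq: "?p c = ?p' c" if "c < N" for c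
  proof (rule prefix_maps_determine[OF _ _ N_eq' o' _ _ that])
    show "?p c permutes {..<M} \<and> ?p' c permutes {..<M}" if "c < N" for c
      using perms_permutes valid that by blast
    show "c mod g = c' mod g" if "c < N" "c' < N" "?p c \<noteq> ?p' c" "?p c' \<noteq> ?p' c'" for c c'
      using col_I_mod[OF inI inI, OF that(3,4)] by simp
    show "prefix_map ?p (Suc (o' + g * k)) a = prefix_map ?p' (Suc (o' + g * k)) a"
      if "k < P" "a \<in> {..<M}" for k a
    proof -
      have "(o' + g * k, a) \<in> Yo" using that by (auto simp: Yo_def)
      from target_eq[OF assms this] show ?thesis unfolding target_def fst_conv snd_conv .
    qed
    show "prefix_map ?p N a = prefix_map ?p' N a" for a
      using cert by (simp add: cert_def)
  qed
  show "z = z'"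
  proof (rule PiE_ext[OF z z'])
    fix u assume u: "u \<in> I"
    have "?p (col u) = ?p' (col u)" using eq col_less_iff I_less(2)[OF u] by simp
    then show "z u = z' u" using u I_less(1)[OF u] by (simp add: perms_def completed_def)
  qed
qed

lemma W_R_bounded:
  assumes "valid_input x Y0"
  shows "W x \<subseteq> {..<S}" "R x \<subseteq> {..<S}"
proof -
  have less: "k < start N" if "k < slot" for k
    using that index_order(3) by simp
  show W: "W x \<subseteq> {..<S}"
    unfolding W_def written_def using index_order(2)
    by (intro UN_least rd_wr_bounded(2)[OF assms less]) simp
  have old: "old x \<subseteq> {..<S}"
    unfolding old_def old_reads_def
    by (intro UN_least order_trans[OF Diff_subset rd_wr_bounded(1)[OF assms less]]) simp
  have "query_old x y \<subseteq> {..<S}" if "y \<in> Yo" for y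
  proof -
    note yb = Yo_bounds[OF that]
    have "op_reads D (query_op x t y) (mem x Y0 slot) \<subseteq> {..<S}"
      using op_bounded[OF wf_query_op[OF assms] accepted_query_op[OF assms t s]
        valid_mem[OF assms, of slot, unfolded slot_def]] yb index_order(3)
      by (simp add: slot_def)
    then show ?thesis by (auto simp: query_old_def)
  qed
  then show "R x \<subseteq> {..<S}" using old unfolding R_def by blast
qed

lemma cert_mem:
  assumes "valid_input x Y0" "card (T x) \<le> t1" "card (bad x) \<le> t2"
  shows "cert x \<in> {A. A \<subseteq> {..<S} \<times> {..<2 ^ w} \<and> card A \<le> t1} \<times> (J \<rightarrow>\<^sub>E {..<M}) \<times>
    {A. A \<subseteq> Yo \<times> {..<M} \<and> card A \<le> t2} \<times> {p. p permutes {..<M}}"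
proof -
  have perm: "\<forall>t<N. x t permutes {..<M}" using assms(1) by (simp add: valid_input_def)
  have "mid \<le> start N" using index_order by simp
  note vm = valid_mem[OF assms(1) this]
  have "finite (T x)"
    using T_subset_W W_R_bounded(1)[OF assms(1)] by (meson finite_subset finite_lessThan)
  then have "card ((\<lambda>a. (a, mem x Y0 mid a)) ` T x) \<le> t1"
    using card_image_le[of "T x"] assms(2) le_trans by blast
  moreover have "(\<lambda>a. (a, mem x Y0 mid a)) ` T x \<subseteq> {..<S} \<times> {..<2 ^ w}"
    using T_subset_W[of x] W_R_bounded(1)[OF assms(1)] vm by (auto simp: valid_memory_def)
  moreover have "restrict (\<lambda>(u, r). target x u (Y0 (u, r))) J \<in> J \<rightarrow>\<^sub>E {..<M}"
  proof (rule restrict_PiE_iff[THEN iffD2], rule ballI)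
    fix ur assume "ur \<in> J"
    then obtain u r where "ur = (u, r)" "u < N" "r < Kq" using window_order(3) by (auto simp: J_def)
    then show "(case ur of (u, r) \<Rightarrow> target x u (Y0 (u, r))) \<in> {..<M}"
      using target_less[OF perm] valid0 by (simp add: valid_input_def)
  qed
  moreover have "finite (bad x)" by (simp add: bad_def Yo_def)
  then have "card ((\<lambda>y. (y, target x t y)) ` bad x) \<le> t2"
    using card_image_le[of "bad x"] assms(3) le_trans by blast
  moreover have "(\<lambda>y. (y, target x t y)) ` bad x \<subseteq> Yo \<times> {..<M}"
    using target_less[OF perm] Yo_bounds by (auto simp: bad_def)
  moreover have "prefix_map (perms x (Suc t)) N permutes {..<M}"
    using prefix_map_permutes perms_permutes[OF perm] by blast
  ultimately show ?thesis by (simp add: cert_def)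
qed

text \<open>For a fixed \<open>h\<close> the certificates are injective on the inputs that it
  separates, and each input is separated by at least the fraction
  \<open>(Q - 1) ^ v / Q ^ (r + v)\<close> of all \<open>h\<close>. Averaging over \<open>h\<close>
  avoids recording it.\<close>

lemma certificate_count:
  assumes "0 < Q" "G \<subseteq> I \<rightarrow>\<^sub>E {p. p permutes {..<M}}"
    and "\<And>z. z \<in> G \<Longrightarrow> card (T (completed z)) \<le> t1 \<and> card (bad (completed z)) \<le> t2 \<and>
       card (R (completed z)) \<le> r \<and> card (W (completed z)) \<le> v"
  shows "card G * (Q - 1) ^ v \<le>
    (Suc (S * 2 ^ w) ^ t1 * M ^ (L * Kq) * Suc (P * M * M) ^ t2 * fact M) * Q ^ (r + v)"
proof (rule double_counting_le[where P = "\<lambda>z h. separates h (completed z)"])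
  let ?XI = "I \<rightarrow>\<^sub>E {p. p permutes {..<M}}"
  have "finite ?XI" by (intro finite_PiE) (auto simp: I_def finite_permutations)
  then show finG: "finite G" using assms(2) finite_subset by blast
  show "finite ({..<S} \<rightarrow>\<^sub>E {..<Q})" by (intro finite_PiE) auto
  have "(\<lambda>a\<in>{..<S}. 0) \<in> {..<S} \<rightarrow>\<^sub>E {..<Q}" using assms(1) by simp
  then show "{..<S} \<rightarrow>\<^sub>E {..<Q} \<noteq> {}" by blast
  show "card ({..<S} \<rightarrow>\<^sub>E {..<Q}) * (Q - 1) ^ v
      \<le> card {h \<in> {..<S} \<rightarrow>\<^sub>E {..<Q}. separates h (completed z)} * Q ^ (r + v)" if "z \<in> G" for z
  proof -
    have "valid_input (completed z) Y0" using valid_completed assms(2) that by blast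
    note bounded = W_R_bounded[OF this]
    show ?thesis
      using card_separating[OF bounded(2,1) R_disjoint_W assms(1), of r v] assms(3)[OF that]
      by (simp add: card_PiE separates_def)
  qed
  show "card {z \<in> G. separates h (completed z)} \<le>
      Suc (S * 2 ^ w) ^ t1 * M ^ (L * Kq) * Suc (P * M * M) ^ t2 * fact M" for h
  proof -
    let ?A1 = "{A. A \<subseteq> {..<S} \<times> {..<2 ^ w :: nat} \<and> card A \<le> t1}"
    let ?A3 = "{A. A \<subseteq> Yo \<times> {..<M} \<and> card A \<le> t2}"
    let ?A4 = "{p. p permutes {..<M}}"
    let ?A = "?A1 \<times> (J \<rightarrow>\<^sub>E {..<M}) \<times> ?A3 \<times> ?A4"
    let ?G = "{z \<in> G. separates h (completed z)}"
    have finYo: "finite Yo" by (simp add: Yo_def)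
    have "finite J" by (simp add: J_def)
    then have "finite ?A"
      using finYo by (intro finite_cartesian_product finite_PiE) (auto simp: finite_permutations)
    moreover have "inj_on (cert \<circ> completed) ?G"
    proof (rule inj_onI)
      fix z z' assume z: "z \<in> ?G" "z' \<in> ?G" "(cert \<circ> completed) z = (cert \<circ> completed) z'"
      then have "z \<in> G" "z' \<in> G" "separates h (completed z)" "separates h (completed z')"
        "cert (completed z) = cert (completed z')" by simp_all
      then show "z = z'" using cert_inj[of z z' h] assms(2) by blast
    qed
    moreover have "(cert \<circ> completed) ` ?G \<subseteq> ?A"
    proof
      fix c assume "c \<in> (cert \<circ> completed) ` ?G"
      then obtain z where z: "z \<in> G" "c = cert (completed z)" by auto
      have "valid_input (completed z) Y0" using valid_completed assms(2) z(1) by blast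
      then show "c \<in> ?A"
        unfolding z(2) using assms(3)[OF z(1)] by (intro cert_mem) simp_all
    qed
    ultimately have "card ?G \<le> card ?A" by (meson card_inj_on_le)
    also have "\<dots> = card ?A1 * (card (J \<rightarrow>\<^sub>E {..<M}) * (card ?A3 * card ?A4))"
      by (simp only: card_cartesian_product)
    also have "\<dots> \<le> Suc (S * 2 ^ w) ^ t1 * (M ^ (L * Kq) * (Suc (P * M * M) ^ t2 * fact M))"
    proof (intro mult_le_mono)
      show "card ?A1 \<le> Suc (S * 2 ^ w) ^ t1"
        using card_small_subsets_le[of "{..<S} \<times> {..<2 ^ w :: nat}" t1] by simp
      show "card (J \<rightarrow>\<^sub>E {..<M}) \<le> M ^ (L * Kq)"
        by (simp add: card_PiE J_def)
      have "card Yo \<le> P * M"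
        unfolding Yo_def using card_image_le[of "{..<P} \<times> {..<M}"] by simp
      then have "Suc (card (Yo \<times> {..<M})) ^ t2 \<le> Suc (P * M * M) ^ t2"
        by (intro power_mono) (simp_all add: card_cartesian_product)
      then show "card ?A3 \<le> Suc (P * M * M) ^ t2"
        using card_small_subsets_le[of "Yo \<times> {..<M}" t2] finYo le_trans by blast
      show "card ?A4 \<le> fact M" by (simp add: card_permutations)
    qed
    finally show ?thesis by (simp add: mult.assoc)
  qed
qed

end


section \<open>Averaging over levels and slots\<close>

text \<open>Each \<open>f u\<close> occurs in the sums of at most \<open>L\<close> indices
  \<open>t\<close>, those of its own group, and is divided by \<open>L\<close>.\<close>

lemma sum_groups_le:
  fixes f :: "nat \<Rightarrow> real"
  assumes "0 < L" "\<And>u. 0 \<le> f u"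
  shows "(\<Sum>t<N. (\<Sum>u | u < N \<and> u div L = t div L. f u) / L) \<le> (\<Sum>u<N. f u)"
proof -
  have "(\<Sum>t<N. (\<Sum>u | u < N \<and> u div L = t div L. f u)) =
      (\<Sum>t<N. \<Sum>u<N. if u div L = t div L then f u else 0)"
    by (rule sum.cong) (simp_all add: sum.If_cases Int_def)
  also have "\<dots> = (\<Sum>u<N. \<Sum>t<N. if u div L = t div L then f u else 0)" by (rule sum.swap)
  also have "\<dots> = (\<Sum>u<N. card {t. t < N \<and> u div L = t div L} * f u)"
    by (rule sum.cong) (simp_all add: sum.If_cases Int_def)
  also have "\<dots> \<le> (\<Sum>u<N. L * f u)"
  proof (intro sum_mono mult_right_mono assms(2))
    fix u
    have "{t. t < N \<and> u div L = t div L} \<subseteq> {L * (u div L)..<L * (u div L) + L}"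
    proof
      fix t assume "t \<in> {t. t < N \<and> u div L = t div L}"
      then have "u div L = t div L" by simp
      then show "t \<in> {L * (u div L)..<L * (u div L) + L}"
        using dividend_less_times_div[OF assms(1), of t] by (simp add: add.commute)
    qed
    from card_mono[OF _ this] show "real (card {t. t < N \<and> u div L = t div L}) \<le> real L" by simp
  qed
  finally have "(\<Sum>t<N. (\<Sum>u | u < N \<and> u div L = t div L. f u)) \<le> L * (\<Sum>u<N. f u)"
    by (simp add: sum_distrib_left)
  then show ?thesis using assms(1) by (simp add: sum_divide_distrib[symmetric] field_simps)
qed

lemma sum_sum_linear:
  fixes f\<^sub>1 :: "'a \<Rightarrow> 'b \<Rightarrow> real"
  shows "(\<Sum>t\<in>A. \<Sum>s\<in>B. (f\<^sub>1 t s + f\<^sub>2 t s) * c + (f\<^sub>3 t s + f\<^sub>4 t s + f\<^sub>5 t s) / e) =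
    ((\<Sum>t\<in>A. \<Sum>s\<in>B. f\<^sub>1 t s) + (\<Sum>t\<in>A. \<Sum>s\<in>B. f\<^sub>2 t s)) * c +
    ((\<Sum>t\<in>A. \<Sum>s\<in>B. f\<^sub>3 t s) + (\<Sum>t\<in>A. \<Sum>s\<in>B. f\<^sub>4 t s) + (\<Sum>t\<in>A. \<Sum>s\<in>B. f\<^sub>5 t s)) / e"
  by (simp add: sum.distrib sum_distrib_right[symmetric] sum_divide_distrib[symmetric])

context hard
begin

text \<open>The time at which the subtree of height \<open>j\<close> containing block
  \<open>u\<close> begins.\<close>

definition level_start :: "nat \<Rightarrow> nat \<Rightarrow> nat" where
  "level_start j u = start (b ^ j * (u div b ^ j))"

text \<open>A cell read is counted on one level only: the one on which the blocks writing and reading it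
  get separated.\<close>

definition transfer :: "(nat \<Rightarrow> nat \<Rightarrow> nat) \<Rightarrow> (nat \<times> nat \<Rightarrow> nat \<times> nat) \<Rightarrow> nat \<Rightarrow> nat \<Rightarrow> nat \<Rightarrow> nat set" where
  "transfer x Y i u k = old_reads D (sched x Y) m0 (level_start i u) k \<inter>
     written D (sched x Y) m0 (level_start (Suc i) u) (level_start i u)"

definition block_reads where
  "block_reads x Y u = (\<Sum>r<bl. card (rd D (sched x Y) m0 (start u + r)))"

definition block_writes where
  "block_writes x Y u = (\<Sum>r<bl. card (wr D (sched x Y) m0 (start u + r)))"

definition block_transfer where
  "block_transfer x Y i u = (\<Sum>r<bl. card (transfer x Y i u (start u + r)))"

definition cost where
  "cost x Y = total_cost D (map (sched x Y) [0..<start N]) m0"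

lemma level_mono: "j \<le> j' \<Longrightarrow> level_start j' u \<le> level_start j u"
proof -
  assume "j \<le> j'"
  then have "b ^ j' = b ^ j * b ^ (j' - j)" by (simp add: power_add[symmetric])
  then have "b ^ j' * (u div b ^ j') = b ^ j * (b ^ (j' - j) * (u div b ^ j div b ^ (j' - j)))"
    by (simp add: div_mult2_eq)
  also have "\<dots> \<le> b ^ j * (u div b ^ j)" by (intro mult_le_mono2) simp
  finally show ?thesis unfolding level_start_def by (rule start_mono)
qed

lemma level_start_le: "level_start j u \<le> start u"
  unfolding level_start_def by (intro start_mono) simp

lemma finite_transfer [simp]: "finite (transfer x Y i u k)"
  by (simp add: transfer_def)

text \<open>For \<open>i < j\<close> a cell transferred on level \<open>i\<close> was written after
  \<open>level_start j u\<close> and before \<open>k\<close>; so it is no old read on level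
  \<open>j\<close>.\<close>

lemma sum_transfer_le:
  assumes "start u \<le> k"
  shows "(\<Sum>i<d. card (transfer x Y i u k)) \<le> card (rd D (sched x Y) m0 k)"
proof -
  have disj: "transfer x Y i u k \<inter> transfer x Y j u k = {}" if "i < j" for i j
  proof -
    have "level_start j u \<le> level_start (Suc i) u" "level_start i u \<le> k"
      using that level_mono[of "Suc i" j u] level_start_le[of i u] assms by simp_all
    then have "written D (sched x Y) m0 (level_start (Suc i) u) (level_start i u) \<subseteq>
        written D (sched x Y) m0 (level_start j u) k"
      unfolding written_def by (intro UN_mono) auto
    then show ?thesis unfolding transfer_def old_reads_def by blast
  qed
  have "(\<Sum>i<d. card (transfer x Y i u k)) = card (\<Union>i<d. transfer x Y i u k)"
  proof (rule card_UN_disjoint[symmetric])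
    show "\<forall>i\<in>{..<d}. \<forall>j\<in>{..<d}. i \<noteq> j \<longrightarrow> transfer x Y i u k \<inter> transfer x Y j u k = {}"
      using disj by (metis Int_commute nat_neq_iff)
  qed auto
  also have "\<dots> \<le> card (rd D (sched x Y) m0 k)"
    by (intro card_mono) (auto simp: transfer_def old_reads_def)
  finally show ?thesis .
qed

lemma sum_block_transfer_le: "(\<Sum>i<d. block_transfer x Y i u) \<le> block_reads x Y u"
  unfolding block_transfer_def block_reads_def
  by (subst sum.swap) (intro sum_mono sum_transfer_le, simp)

lemma sum_blocks_le_cost:
  assumes "valid_input x Y"
  shows "(\<Sum>u<N. block_reads x Y u) + (\<Sum>u<N. block_writes x Y u) \<le> cost x Y"
proof -
  have "(\<Sum>u<N. block_reads x Y u) + (\<Sum>u<N. block_writes x Y u) =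
      (\<Sum>u<N. \<Sum>r<bl. card (rd D (sched x Y) m0 (start u + r)) + card (wr D (sched x Y) m0 (start u + r)))"
    by (simp add: block_reads_def block_writes_def sum.distrib)
  also have "\<dots> \<le> (\<Sum>k<start N. card (rd D (sched x Y) m0 k) + card (wr D (sched x Y) m0 k))"
    unfolding sum_schedule by simp
  also have "\<dots> \<le> cost x Y"
    unfolding cost_def by (rule card_rd_wr_le_total_cost[OF assms])
  finally show ?thesis .
qed

text \<open>All summands that should be small, scaled such that the total over all levels and slots is at
  most four times the cost times \<open>d / tq\<close>: block sums are averaged over the slots of their group,
  and transfers get the weight \<open>d\<close> because the \<open>d\<close> levels share the reads.\<close>

definition load :: "real \<Rightarrow> nat \<Rightarrow> nat \<Rightarrow> nat \<Rightarrow> (nat \<Rightarrow> nat \<Rightarrow> nat) \<Rightarrow> (nat \<times> nat \<Rightarrow> nat \<times> nat) \<Rightarrow> real" where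
  "load tq i t s x Y =
     ((\<Sum>u | u < N \<and> u div b ^ i = t div b ^ i. real (block_transfer x Y i u)) / (b ^ i * Kq)
       + card (transfer x Y i t (start t + 2 * M + s))) * (d / tq)
   + ((\<Sum>u | u < N \<and> u div b ^ i = t div b ^ i. real (block_reads x Y u)) / (b ^ i * Kq)
       + card (rd D (sched x Y) m0 (start t + 2 * M + s))
       + (\<Sum>u | u < N \<and> u div b ^ Suc i = t div b ^ Suc i. real (block_writes x Y u)) / (b ^ Suc i * Kq)) / tq"

lemma load_nonneg: "0 < tq \<Longrightarrow> 0 \<le> load tq i t s x Y"
  unfolding load_def by (intro add_nonneg_nonneg mult_nonneg_nonneg divide_nonneg_nonneg sum_nonneg) auto

lemma sum_slots_le:
  fixes f :: "nat \<Rightarrow> nat"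
  shows "(\<Sum>s<Kq. real (f (start t + 2 * M + s))) \<le> real (\<Sum>r<bl. f (start t + r))"
proof -
  have "(\<Sum>r<2 * M + L. f (start t + r)) =
      (\<Sum>r<2 * M. f (start t + r)) + (\<Sum>s<L. f (start t + 2 * M + s))" for L
    by (induction L) (simp_all add: add.assoc)
  from this[of Kq] show ?thesis by (simp add: bl_def sum_nonneg)
qed

text \<open>The reads enter at most four times: directly and through the transfers, whose sum over
  all levels is at most the reads, and each time once by group and once by slot. The writes enter
  once.\<close>

lemma sum_load_le:
  assumes "0 < tq" "valid_input x Y"
  shows "(\<Sum>i<d. \<Sum>t<N. \<Sum>s<Kq. load tq i t s x Y) \<le> 4 * d * cost x Y / tq"
proof -
  let ?R = "\<Sum>u<N. real (block_reads x Y u)" and ?Wr = "\<Sum>u<N. real (block_writes x Y u)"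
  let ?T = "\<lambda>i. \<Sum>u<N. real (block_transfer x Y i u)"
  have group: "(\<Sum>t<N. \<Sum>s<Kq. (\<Sum>u | u < N \<and> u div b ^ j = t div b ^ j. real (f u)) / (b ^ j * Kq))
      \<le> (\<Sum>u<N. real (f u))" for j and f :: "nat \<Rightarrow> nat"
    using sum_groups_le[of "b ^ j" "\<lambda>u. real (f u)" N] b_pos Kq_pos by simp
  have level: "(\<Sum>t<N. \<Sum>s<Kq. load tq i t s x Y) \<le> (2 * ?T i) * (d / tq) + (2 * ?R + ?Wr) / tq" for i
  proof -
    have "(\<Sum>t<N. \<Sum>s<Kq. load tq i t s x Y) =
        ((\<Sum>t<N. \<Sum>s<Kq. (\<Sum>u | u < N \<and> u div b ^ i = t div b ^ i. real (block_transfer x Y i u)) / (b ^ i * Kq))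
          + (\<Sum>t<N. \<Sum>s<Kq. real (card (transfer x Y i t (start t + 2 * M + s))))) * (d / tq)
      + ((\<Sum>t<N. \<Sum>s<Kq. (\<Sum>u | u < N \<and> u div b ^ i = t div b ^ i. real (block_reads x Y u)) / (b ^ i * Kq))
          + (\<Sum>t<N. \<Sum>s<Kq. real (card (rd D (sched x Y) m0 (start t + 2 * M + s))))
          + (\<Sum>t<N. \<Sum>s<Kq. (\<Sum>u | u < N \<and> u div b ^ Suc i = t div b ^ Suc i. real (block_writes x Y u)) / (b ^ Suc i * Kq))) / tq"
      unfolding load_def by (rule sum_sum_linear)
    also have "\<dots> \<le> (?T i + ?T i) * (d / tq) + (?R + ?R + ?Wr) / tq"
    proof (intro add_mono mult_right_mono divide_right_mono group)
      show "(\<Sum>t<N. \<Sum>s<Kq. real (card (transfer x Y i t (start t + 2 * M + s)))) \<le> ?T i"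
        unfolding block_transfer_def by (intro sum_mono sum_slots_le)
      show "(\<Sum>t<N. \<Sum>s<Kq. real (card (rd D (sched x Y) m0 (start t + 2 * M + s)))) \<le> ?R"
        unfolding block_reads_def by (intro sum_mono sum_slots_le)
    qed (use assms(1) in auto)
    finally show ?thesis by simp
  qed
  have T: "(\<Sum>i<d. ?T i) \<le> ?R"
  proof -
    have "(\<Sum>i<d. ?T i) = (\<Sum>u<N. real (\<Sum>i<d. block_transfer x Y i u))"
      by (subst sum.swap) simp
    also have "\<dots> \<le> ?R" by (intro sum_mono of_nat_mono sum_block_transfer_le)
    finally show ?thesis .
  qed
  have c: "?R + ?Wr \<le> cost x Y"
    using of_nat_mono[OF sum_blocks_le_cost[OF assms(2)], where 'a = real] by simp
  have "(\<Sum>i<d. \<Sum>t<N. \<Sum>s<Kq. load tq i t s x Y) \<le>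
      (\<Sum>i<d. (2 * ?T i) * (d / tq) + (2 * ?R + ?Wr) / tq)"
    by (intro sum_mono level)
  also have "\<dots> = 2 * (\<Sum>i<d. ?T i) * (d / tq) + d * ((2 * ?R + ?Wr) / tq)"
  proof -
    have "(\<Sum>i<d. 2 * f i * c + e) = 2 * (\<Sum>i<d. f i) * c + d * e" for f and c e :: real
      by (simp add: sum.distrib sum_distrib_left sum_distrib_right)
    then show ?thesis .
  qed
  also have "\<dots> = (2 * (\<Sum>i<d. ?T i) + (2 * ?R + ?Wr)) * (d / tq)"
    by (simp add: add_divide_distrib distrib_right distrib_left mult.commute)
  also have "\<dots> \<le> (4 * cost x Y) * (d / tq)"
  proof (intro mult_right_mono)
    have "0 \<le> ?Wr" by (intro sum_nonneg) simp
    then show "2 * (\<Sum>i<d. ?T i) + (2 * ?R + ?Wr) \<le> 4 * cost x Y" using T c by linarith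
  qed (use assms(1) in auto)
  finally show ?thesis by (simp add: ac_simps)
qed

text \<open>The blocks in the second half of their parent, which have at least \<open>b ^ Suc i / 2\<close> earlier
  blocks in it.\<close>

definition late :: "nat \<Rightarrow> nat set" where
  "late i = {t. t < N \<and> b div 2 \<le> t div b ^ i mod b}"

lemma card_late:
  assumes "i < d"
  shows "N \<le> 2 * card (late i)"
proof -
  let ?L = "b ^ i"
  have L: "0 < ?L" using b_pos by simp
  have N: "N = ?L * b * b ^ (d - Suc i)"
  proof -
    have "d = i + Suc (d - Suc i)" using assms by simp
    then show ?thesis unfolding N_eq by (metis power_add power_Suc mult.assoc)
  qed
  \<comment> \<open>Adding \<open>b div 2\<close> to digit \<open>i\<close> produces no carry for a
    block in the first half of its parent and moves it injectively into the second half.\<close>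
  let ?f = "\<lambda>t. t + ?L * (b div 2)"
  have "?f ` ({..<N} - late i) \<subseteq> late i"
  proof
    fix v assume "v \<in> ?f ` ({..<N} - late i)"
    then obtain t where "v = ?f t" "t \<in> {..<N} - late i" by (rule imageE)
    then have t: "v = ?f t" "t < N" "t div ?L mod b < b div 2" by (auto simp: late_def)
    have v: "v div ?L = t div ?L + b div 2" using L t(1) by simp
    have digit: "v div ?L mod b = t div ?L mod b + b div 2"
    proof -
      have lt: "t div ?L mod b + b div 2 < b" using t(3) by linarith
      have "v div ?L mod b = (t div ?L mod b + b div 2) mod b" unfolding v by (simp add: mod_add_left_eq)
      then show ?thesis using lt by simp
    qed
    have "v div ?L div b = t div ?L div b"
    proof -
      have "b * (v div ?L div b) + v div ?L mod b = b * (t div ?L div b) + t div ?L mod b + b div 2"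
        using v by simp
      then have "b * (v div ?L div b) = b * (t div ?L div b)" using digit by linarith
      then show ?thesis using b_pos by simp
    qed
    moreover have "t div (?L * b) < b ^ (d - Suc i)"
      using t(2) unfolding N by (simp add: less_mult_imp_div_less mult.commute)
    ultimately have "v div (?L * b) < b ^ (d - Suc i)" by (simp add: div_mult2_eq)
    then have "v < b ^ (d - Suc i) * (?L * b)" using L b_pos by (subst (asm) div_less_iff_less_mult) auto
    then have "v < N" unfolding N by (simp add: mult.commute)
    then show "v \<in> late i" using digit by (simp add: late_def)
  qed
  moreover have "finite (late i)" by (simp add: late_def)
  moreover have "inj_on ?f ({..<N} - late i)" by (simp add: inj_on_def)
  ultimately have "card ({..<N} - late i) \<le> card (late i)" by (meson card_inj_on_le)
  moreover have "card ({..<N} - late i) = N - card (late i)"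
    by (subst card_Diff_subset) (auto simp: late_def)
  ultimately show ?thesis by linarith
qed

definition Xs :: "(nat \<Rightarrow> nat \<Rightarrow> nat) set" where
  "Xs = {..<N} \<rightarrow>\<^sub>E {p. p permutes {..<M}}"

definition Ys :: "(nat \<times> nat \<Rightarrow> nat \<times> nat) set" where
  "Ys = ({..<N} \<times> {..<Kq}) \<rightarrow>\<^sub>E ({..<N} \<times> {..<M})"

lemma valid_Xs_Ys: "x \<in> Xs \<Longrightarrow> Y \<in> Ys \<Longrightarrow> valid_input x Y"
  by (fastforce simp: valid_input_def Xs_def Ys_def PiE_iff mem_Times_iff)

lemma finite_Xs [simp]: "finite Xs" and finite_Ys [simp]: "finite Ys"
  unfolding Xs_def Ys_def by (intro finite_PiE; simp add: finite_permutations)+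

lemma Xs_nonempty: "Xs \<noteq> {}" and Ys_nonempty: "Ys \<noteq> {}"
proof -
  have "{p. p permutes {..<M}} \<noteq> {}" using permutes_id by blast
  then show "Xs \<noteq> {}" unfolding Xs_def PiE_eq_empty_iff by blast
  have "{..<N} \<times> {..<M} \<noteq> {}" using M_pos N_pos by auto
  then show "Ys \<noteq> {}" unfolding Ys_def PiE_eq_empty_iff by blast
qed

text \<open>The bound of \<open>sum_load_le\<close> and the cost hypothesis contribute a factor 4
  each. At least half of all triples of level, block and slot are late, which doubles the average to
  32.\<close>

lemma exists_light_slot:
  fixes tq :: real
  assumes "0 < tq" "0 < d"
    and cost: "(\<Sum>x\<in>Xs. \<Sum>Y\<in>Ys. real (cost x Y)) \<le> 4 * N * Kq * tq * (card Xs * card Ys)"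
  shows "\<exists>i<d. \<exists>t\<in>late i. \<exists>s<Kq.
    (\<Sum>x\<in>Xs. \<Sum>Y\<in>Ys. load tq i t s x Y) \<le> 32 * (card Xs * card Ys)"
proof -
  let ?A = "SIGMA i:{..<d}. late i \<times> {..<Kq}"
  let ?f = "\<lambda>(i, t, s). \<Sum>x\<in>Xs. \<Sum>Y\<in>Ys. load tq i t s x Y"
  let ?c = "real (card Xs * card Ys)"
  have fin: "finite (late i)" for i by (simp add: late_def)
  have card: "d * (N * Kq) \<le> 2 * card ?A"
  proof -
    have "card ?A = (\<Sum>i<d. card (late i) * Kq)"
      using fin by (simp add: card_SigmaI card_cartesian_product)
    moreover have "(\<Sum>i<d. N * Kq) \<le> (\<Sum>i<d. 2 * (card (late i) * Kq))"
    proof (intro sum_mono)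
      fix i assume "i \<in> {..<d}"
      then have "N * Kq \<le> 2 * card (late i) * Kq" using card_late by (intro mult_le_mono1) simp
      then show "N * Kq \<le> 2 * (card (late i) * Kq)" by simp
    qed
    ultimately show ?thesis by (simp add: sum_distrib_left)
  qed
  have finA: "finite ?A" using fin by simp
  have "0 < d * (N * Kq)" using assms(2) N_pos Kq_pos by simp
  then have ne: "?A \<noteq> {}" using card by (metis card.empty mult_0_right not_le)
  have "(\<Sum>a\<in>?A. ?f a) = (\<Sum>i<d. \<Sum>t\<in>late i. \<Sum>s<Kq. \<Sum>x\<in>Xs. \<Sum>Y\<in>Ys. load tq i t s x Y)"
  proof -
    have "(\<Sum>i<d. \<Sum>t\<in>late i. \<Sum>s<Kq. F i t s) = (\<Sum>(i, t, s)\<in>?A. F i t s)"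
      for F :: "nat \<Rightarrow> nat \<Rightarrow> nat \<Rightarrow> real"
      unfolding sum.cartesian_product using fin by (intro sum.Sigma) auto
    from this[of "\<lambda>i t s. \<Sum>x\<in>Xs. \<Sum>Y\<in>Ys. load tq i t s x Y"] show ?thesis by simp
  qed
  also have "\<dots> \<le> (\<Sum>i<d. \<Sum>t<N. \<Sum>s<Kq. \<Sum>x\<in>Xs. \<Sum>Y\<in>Ys. load tq i t s x Y)"
    by (intro sum_mono sum_mono2 sum_nonneg load_nonneg assms(1)) (auto simp: late_def)
  also have "\<dots> = (\<Sum>x\<in>Xs. \<Sum>Y\<in>Ys. \<Sum>i<d. \<Sum>t<N. \<Sum>s<Kq. load tq i t s x Y)"
  proof -
    have 3: "(\<Sum>i<d. \<Sum>t<N. \<Sum>s<Kq. F i t s) =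
        (\<Sum>p\<in>{..<d} \<times> {..<N} \<times> {..<Kq}. F (fst p) (fst (snd p)) (snd (snd p)))"
      for F :: "nat \<Rightarrow> nat \<Rightarrow> nat \<Rightarrow> real"
      by (simp add: sum.cartesian_product case_prod_unfold)
    have 2: "(\<Sum>x\<in>Xs. \<Sum>Y\<in>Ys. F x Y) = (\<Sum>p\<in>Xs \<times> Ys. F (fst p) (snd p))" for F :: "_ \<Rightarrow> _ \<Rightarrow> real"
      by (simp add: sum.cartesian_product case_prod_unfold)
    show ?thesis unfolding 2 3 by (rule sum.swap)
  qed
  also have "\<dots> \<le> (\<Sum>x\<in>Xs. \<Sum>Y\<in>Ys. 4 * d * cost x Y / tq)"
    by (intro sum_mono sum_load_le assms(1) valid_Xs_Ys)
  also have "\<dots> = (4 * d / tq) * (\<Sum>x\<in>Xs. \<Sum>Y\<in>Ys. real (cost x Y))"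
    by (simp add: sum_distrib_left)
  also have "\<dots> \<le> (4 * d / tq) * (4 * N * Kq * tq * (card Xs * card Ys))"
    using cost assms(1) by (intro mult_left_mono) auto
  also have "\<dots> = 16 * real (d * (N * Kq)) * ?c" using assms(1) by simp
  also have "\<dots> \<le> 16 * real (2 * card ?A) * ?c"
    using of_nat_mono[OF card, where 'a = real] by (intro mult_right_mono mult_left_mono) simp_all
  also have "\<dots> = (32 * ?c) * card ?A" by simp
  finally have "(\<Sum>a\<in>?A. ?f a) \<le> (32 * ?c) * card ?A" .
  from exists_le_average[OF finA ne this] show ?thesis by auto
qed

end


section \<open>Fixing all randomness outside one window\<close>

context window
begin

lemma window_level_starts: "lo = level_start (Suc i) t" "mid = level_start i t"
  by (simp_all add: lo_def mid_def level_start_def L_def P_def)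

lemma card_I:
  assumes "t \<in> late i"
  shows "P \<le> 2 * card I"
proof -
  have "L * (t div L) - P * (t div P) = L * (t div L mod b)"
    by (simp add: P_eq div_mult2_eq mult.assoc diff_mult_distrib2[symmetric] minus_mult_div_eq_mod)
  then have "card I = L * (t div L mod b)" by (simp add: I_def)
  moreover have "b \<le> 2 * (t div L mod b)"
    using assms even_b by (auto simp: late_def L_def elim!: evenE)
  then have "L * b \<le> L * (2 * (t div L mod b))" by (intro mult_le_mono2)
  ultimately show ?thesis by (simp add: P_eq)
qed

text \<open>First the permutations of \<open>I\<close> and the query at the slot are drawn anew,
  which preserves the average; then the remaining input \<open>x0\<close>, \<open>Y0\<close> and the
  residue \<open>o'\<close> of the queried column modulo \<open>g\<close> are fixed at values that
  are no worse than average.\<close>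

lemma exists_frame:
  fixes f :: "(nat \<Rightarrow> nat \<Rightarrow> nat) \<Rightarrow> (nat \<times> nat \<Rightarrow> nat \<times> nat) \<Rightarrow> real" and c :: real
  assumes "(\<Sum>x\<in>Xs. \<Sum>Y\<in>Ys. f x Y) \<le> c * (card Xs * card Ys)"
  shows "\<exists>x0\<in>Xs. \<exists>Y0\<in>Ys. \<exists>o'<g.
    (\<Sum>z\<in>I \<rightarrow>\<^sub>E {p. p permutes {..<M}}. \<Sum>k<P. \<Sum>a<M.
       f (\<lambda>u. if u \<in> I then z u else x0 u) (Y0((t, s) := (o' + g * k, a))))
      \<le> c * card (I \<rightarrow>\<^sub>E {p. p permutes {..<M}}) * (P * M)"
proof -
  let ?X = "I \<rightarrow>\<^sub>E {p. p permutes {..<M}}" and ?V = "{..<N} \<times> {..<M}"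
  let ?h = "\<lambda>x Y. \<Sum>z\<in>?X. \<Sum>y\<in>?V. f (\<lambda>u. if u \<in> I then z u else x u) (Y((t, s) := y))"
  have I: "I \<subseteq> {..<N}" using I_less(2) by auto
  have rs: "(\<Sum>Y\<in>Ys. \<Sum>y\<in>?V. f' (Y((t, s) := y))) = (N * M) * (\<Sum>Y\<in>Ys. f' Y)" for f' :: "_ \<Rightarrow> real"
    unfolding Ys_def using sum_resample_single[of "{..<N} \<times> {..<Kq}" "(t, s)" ?V f'] t s
    by (simp add: card_cartesian_product)
  have rx: "(\<Sum>x\<in>Xs. \<Sum>z\<in>?X. f' (\<lambda>u. if u \<in> I then z u else x u)) = card ?X * (\<Sum>x\<in>Xs. f' x)"
    for f' :: "_ \<Rightarrow> real"
    unfolding Xs_def by (rule sum_resample[OF _ I]) (simp_all add: finite_permutations)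
  have "(\<Sum>p\<in>Xs \<times> Ys. F (fst p) (snd p)) = (\<Sum>x\<in>Xs. \<Sum>Y\<in>Ys. F x Y)" for F :: "_ \<Rightarrow> _ \<Rightarrow> real"
    by (simp add: sum.cartesian_product case_prod_unfold)
  then have "(\<Sum>p\<in>Xs \<times> Ys. ?h (fst p) (snd p)) = (\<Sum>x\<in>Xs. \<Sum>Y\<in>Ys. ?h x Y)" .
  also have "\<dots> = (\<Sum>x\<in>Xs. \<Sum>z\<in>?X. \<Sum>Y\<in>Ys. \<Sum>y\<in>?V. f (\<lambda>u. if u \<in> I then z u else x u) (Y((t, s) := y)))"
    by (intro sum.cong refl sum.swap)
  also have "\<dots> = (N * M) * (card ?X * (\<Sum>x\<in>Xs. \<Sum>Y\<in>Ys. f x Y))"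
    by (simp only: rs sum_distrib_left[symmetric] rx[of "\<lambda>x. \<Sum>Y\<in>Ys. f x Y"])
  also have "\<dots> \<le> (N * M) * (card ?X * (c * (card Xs * card Ys)))"
    using assms by (intro mult_left_mono) auto
  also have "\<dots> = (c * card ?X * (N * M)) * card (Xs \<times> Ys)"
    by (simp add: card_cartesian_product)
  finally have "(\<Sum>p\<in>Xs \<times> Ys. ?h (fst p) (snd p)) \<le> (c * card ?X * (N * M)) * card (Xs \<times> Ys)" .
  moreover have "finite (Xs \<times> Ys)" "Xs \<times> Ys \<noteq> {}" using Xs_nonempty Ys_nonempty by auto
  ultimately obtain p where "p \<in> Xs \<times> Ys" "?h (fst p) (snd p) \<le> c * card ?X * (N * M)"
    using exists_le_average by blast
  moreover define x0 Y0 where "x0 = fst p" and "Y0 = snd p"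
  ultimately have xY: "x0 \<in> Xs" "Y0 \<in> Ys" "?h x0 Y0 \<le> c * card ?X * (N * M)"
    by (simp_all only: mem_Times_iff)
  let ?F = "\<lambda>o'. \<Sum>z\<in>?X. \<Sum>k<P. \<Sum>a<M.
      f (\<lambda>u. if u \<in> I then z u else x0 u) (Y0((t, s) := (o' + g * k, a)))"
  have split: "(\<Sum>y\<in>?V. F y) = (\<Sum>o'<g. \<Sum>k<P. \<Sum>a<M. F (o' + g * k, a))" for F :: "_ \<Rightarrow> real"
  proof -
    have "(\<Sum>y\<in>?V. F y) = (\<Sum>j<N. \<Sum>a<M. F (j, a))"
      by (simp add: sum.cartesian_product)
    then show ?thesis unfolding N_eq' sum_offsets .
  qed
  have "?h x0 Y0 = (\<Sum>o'<g. ?F o')"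
    unfolding split by (rule sum.swap)
  then have "(\<Sum>o'<g. ?F o') \<le> (c * card ?X * (P * M)) * card {..<g}"
    using xY(3) by (simp add: N_eq' ac_simps)
  from exists_le_average[OF _ _ this] g_pos obtain o' where "o' < g" "?F o' \<le> c * card ?X * (P * M)"
    by auto
  then show ?thesis using xY(1,2) by blast
qed

lemma sum_block_range:
  fixes f :: "nat \<Rightarrow> nat"
  assumes "A \<le> A'"
  shows "(\<Sum>k\<in>{start A..<start A'}. f k) = (\<Sum>u\<in>{A..<A'}. \<Sum>r<bl. f (start u + r))"
  using assms
proof (induction A' rule: dec_induct)
  case (step A')
  have "(\<Sum>k\<in>{m..<m + l}. f k) = (\<Sum>r<l. f (m + r))" for m l
    by (induction l) simp_all
  moreover have "start (Suc A') = start A' + bl" by (simp add: start_def)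
  ultimately have "(\<Sum>k\<in>{start A'..<start (Suc A')}. f k) = (\<Sum>r<bl. f (start A' + r))" by simp
  moreover have "(\<Sum>k\<in>{start A..<start (Suc A')}. f k) =
      (\<Sum>k\<in>{start A..<start A'}. f k) + (\<Sum>k\<in>{start A'..<start (Suc A')}. f k)"
    using step.hyps by (intro sum.atLeastLessThan_concat[symmetric] start_mono) auto
  ultimately show ?case using step by simp
qed simp

end

section \<open>Sizes of the sets behind a certificate\<close>

context certificate
begin

definition Yq :: "nat \<Rightarrow> nat \<Rightarrow> nat \<times> nat \<Rightarrow> nat \<times> nat" where
  "Yq k a = Y0((t, s) := (o' + g * k, a))"

text \<open>Changing the query at the slot does not affect anything earlier. So \<open>W\<close>,
  \<open>old\<close> and \<open>T\<close> are the same for all hypothetical queries, and the load of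
  any of them bounds these sets.\<close>

lemma sched_Yq:
  assumes "k' < slot"
  shows "sched x (Yq k a) k' = sched x Y0 k'"
proof (cases "k' < N * M")
  case False
  let ?u = "(k' - N * M) div bl" and ?r = "(k' - N * M) mod bl"
  have k': "k' = start ?u + ?r"
    using False div_mult_mod_eq[of "k' - N * M" bl] unfolding start_def by linarith
  have "(?u, ?r - 2 * M) \<noteq> (t, s)" if "2 * M \<le> ?r"
  proof
    assume "(?u, ?r - 2 * M) = (t, s)"
    then have "?u = t" "?r = 2 * M + s" using that by auto
    then have "k' = slot" using k' by (simp add: slot_def)
    then show False using assms by simp
  qed
  then show ?thesis using False by (auto simp: sched_def block_op_def Yq_def)
qed (simp add: sched_def)

lemma mem_Yq: "k' \<le> slot \<Longrightarrow> mem x (Yq k a) k' = mem x Y0 k'"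
  by (intro run_cong sched_Yq) simp

lemma written_Yq: "hi \<le> slot \<Longrightarrow> written D (sched x (Yq k a)) m0 l hi = written D (sched x Y0) m0 l hi"
  unfolding written_def using sched_Yq by (intro SUP_cong refl wr_cong) simp

lemma old_reads_Yq:
  "k' < slot \<Longrightarrow> old_reads D (sched x (Yq k a)) m0 l k' = old_reads D (sched x Y0) m0 l k'"
  unfolding old_reads_def using rd_cong[of k' "sched x (Yq k a)" "sched x Y0" D m0] sched_Yq written_Yq
  by simp

lemma rd_slot_Yq:
  "rd D (sched x (Yq k a)) m0 slot = op_reads D (query_op x t (o' + g * k, a)) (mem x Y0 slot)"
  using sched_query[OF s, of x "Yq k a" t] mem_Yq[of slot x k a]
  by (simp add: rd_def slot_def Yq_def)

lemma same_child: "{u. u < N \<and> u div L = t div L} = {L * (t div L)..<L * (t div L) + L}"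
proof (intro equalityI subsetI)
  fix u assume "u \<in> {u. u < N \<and> u div L = t div L}"
  then have "t div L = u div L" by simp
  then show "u \<in> {L * (t div L)..<L * (t div L) + L}"
    using dividend_less_times_div[OF L_pos, of u] by (simp add: add.commute)
next
  fix u assume u: "u \<in> {L * (t div L)..<L * (t div L) + L}"
  then have "u div L = t div L" by (intro div_nat_eqI) auto
  then show "u \<in> {u. u < N \<and> u div L = t div L}" using u window_order(3) by simp
qed

lemma level_starts_same_child:
  assumes "u div L = t div L"
  shows "level_start i u = mid" "level_start (Suc i) u = lo"
proof -
  show "level_start i u = mid" using assms by (simp add: level_start_def mid_def L_def)
  have "u div P = t div P" using assms by (simp add: P_eq div_mult2_eq)
  then show "level_start (Suc i) u = lo" by (simp add: level_start_def lo_def P_def)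
qed

lemma slot_in_child: "slot \<le> start (L * (t div L) + L)"
proof -
  have "Suc t \<le> L * (t div L) + L"
    using dividend_less_times_div[OF L_pos, of t] by (simp add: add.commute Suc_le_eq)
  from start_mono[OF this] s show ?thesis by (simp add: slot_def start_def bl_def)
qed

lemma card_old_le:
  "card (old x) \<le> (\<Sum>u | u < N \<and> u div L = t div L. block_reads x (Yq k a) u)"
proof -
  have "card (old x) \<le> (\<Sum>k'\<in>{mid..<slot}. card (old_reads D (sched x Y0) m0 mid k'))"
    unfolding old_def by (intro card_UN_le) simp
  also have "\<dots> = (\<Sum>k'\<in>{mid..<slot}. card (old_reads D (sched x (Yq k a)) m0 mid k'))"
    using old_reads_Yq by (intro sum.cong) simp_all
  also have "\<dots> \<le> (\<Sum>k'\<in>{mid..<slot}. card (rd D (sched x (Yq k a)) m0 k'))"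
    unfolding old_reads_def by (intro sum_mono card_mono) auto
  also have "\<dots> \<le> (\<Sum>k'\<in>{mid..<start (L * (t div L) + L)}. card (rd D (sched x (Yq k a)) m0 k'))"
    using slot_in_child by (intro sum_mono2) auto
  also have "\<dots> = (\<Sum>u | u < N \<and> u div L = t div L. block_reads x (Yq k a) u)"
    unfolding mid_def same_child block_reads_def by (intro sum_block_range) simp
  finally show ?thesis .
qed

lemma card_T_le:
  "card (T x) \<le> (\<Sum>u | u < N \<and> u div L = t div L. block_transfer x (Yq k a) i u)"
proof -
  let ?F = "\<lambda>k'. card (old_reads D (sched x (Yq k a)) m0 mid k' \<inter> written D (sched x (Yq k a)) m0 lo mid)"
  have "T x = (\<Union>k'\<in>{mid..<slot}. old_reads D (sched x Y0) m0 mid k' \<inter> written D (sched x Y0) m0 lo mid)"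
    by (simp add: T_def old_def W_def)
  then have "card (T x) \<le>
      (\<Sum>k'\<in>{mid..<slot}. card (old_reads D (sched x Y0) m0 mid k' \<inter> written D (sched x Y0) m0 lo mid))"
    by (simp only: card_UN_le finite_atLeastLessThan)
  also have "\<dots> = (\<Sum>k'\<in>{mid..<slot}. ?F k')"
    using old_reads_Yq written_Yq index_order(2) by (intro sum.cong) simp_all
  also have "\<dots> \<le> (\<Sum>k'\<in>{mid..<start (L * (t div L) + L)}. ?F k')"
    using slot_in_child by (intro sum_mono2) auto
  also have "\<dots> = (\<Sum>u\<in>{L * (t div L)..<L * (t div L) + L}. \<Sum>r<bl. ?F (start u + r))"
    by (subst (1) mid_def) (intro sum_block_range, simp)
  also have "\<dots> = (\<Sum>u | u < N \<and> u div L = t div L. block_transfer x (Yq k a) i u)"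
    unfolding same_child[symmetric] block_transfer_def transfer_def
    using level_starts_same_child by (intro sum.cong) simp_all
  finally show ?thesis .
qed

lemma card_W_le:
  "card (W x) \<le> (\<Sum>u | u < N \<and> u div P = t div P. block_writes x (Yq k a) u)"
proof -
  have "card (W x) \<le> (\<Sum>k'\<in>{lo..<mid}. card (wr D (sched x Y0) m0 k'))"
    unfolding W_def written_def by (intro card_UN_le) simp
  also have "\<dots> = (\<Sum>k'\<in>{lo..<mid}. card (wr D (sched x (Yq k a)) m0 k'))"
  proof (intro sum.cong refl)
    fix k' assume "k' \<in> {lo..<mid}"
    then have "k' < slot" using index_order(2) by simp
    then show "card (wr D (sched x Y0) m0 k') = card (wr D (sched x (Yq k a)) m0 k')"
      using wr_cong[of k' "sched x (Yq k a)" "sched x Y0" D m0] sched_Yq by simp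
  qed
  also have "\<dots> = (\<Sum>u\<in>I. block_writes x (Yq k a) u)"
    unfolding lo_def mid_def I_def block_writes_def using window_order(1) by (intro sum_block_range)
  also have "\<dots> \<le> (\<Sum>u | u < N \<and> u div P = t div P. block_writes x (Yq k a) u)"
  proof (intro sum_mono2)
    show "I \<subseteq> {u. u < N \<and> u div P = t div P}"
    proof
      fix u assume u: "u \<in> I"
      have "u div P \<le> t div P" using I_less(1)[OF u] by (intro div_le_mono) simp
      moreover have "t div P \<le> u div P"
        using u div_le_mono[of "P * (t div P)" u P] P_pos by (simp add: I_def)
      ultimately show "u \<in> {u. u < N \<and> u div P = t div P}" using I_less(2)[OF u] by simp
    qed
  qed auto
  finally show ?thesis .
qed

lemma transfer_slot_Yq:
  "transfer x (Yq k a) i t slot = query_old x (o' + g * k, a) \<inter> W x"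
  unfolding transfer_def old_reads_def window_level_starts[symmetric]
  by (simp add: rd_slot_Yq written_Yq index_order(2) query_old_def V_def W_def)

lemma card_query_old_le: "card (query_old x (o' + g * k, a)) \<le> card (rd D (sched x (Yq k a)) m0 slot)"
  unfolding rd_slot_Yq query_old_def by (intro card_mono) (auto simp: finite_op_reads)

lemma finite_query_old: "finite (query_old x y)"
  by (simp add: query_old_def finite_op_reads)

text \<open>A bad query transfers at least one cell when it is asked at the slot.\<close>

lemma card_bad_le:
  "card (bad x) \<le> (\<Sum>k<P. \<Sum>a<M. card (transfer x (Yq k a) i t slot))"
proof -
  let ?B = "{ka \<in> {..<P} \<times> {..<M}. transfer x (Yq (fst ka) (snd ka)) i t slot \<noteq> {}}"
  have "bad x \<subseteq> (\<lambda>(k, a). (o' + g * k, a)) ` ?B"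
    unfolding bad_def Yo_def transfer_slot_Yq by force
  then have "card (bad x) \<le> card ?B" by (intro surj_card_le) auto
  also have "\<dots> = (\<Sum>ka\<in>?B. 1)" by simp
  also have "\<dots> \<le> (\<Sum>ka\<in>?B. card (transfer x (Yq (fst ka) (snd ka)) i t slot))"
    by (intro sum_mono) (simp add: Suc_le_eq card_gt_0_iff)
  also have "\<dots> \<le> (\<Sum>ka\<in>{..<P} \<times> {..<M}. card (transfer x (Yq (fst ka) (snd ka)) i t slot))"
    by (intro sum_mono2) auto
  also have "\<dots> = (\<Sum>k<P. \<Sum>a<M. card (transfer x (Yq k a) i t slot))"
    by (simp add: sum.cartesian_product case_prod_unfold)
  finally show ?thesis .
qed

lemma card_R_le:
  "card (R x) \<le> card (old x) + (\<Sum>k<P. \<Sum>a<M. card (rd D (sched x (Yq k a)) m0 slot))"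
proof -
  have fin: "finite (old x)" by (simp add: old_def old_reads_def)
  have "R x \<subseteq> old x \<union> (\<Union>ka\<in>{..<P} \<times> {..<M}. query_old x (o' + g * fst ka, snd ka))"
    unfolding R_def Yo_def by force
  then have "card (R x) \<le> card (old x \<union> (\<Union>ka\<in>{..<P} \<times> {..<M}. query_old x (o' + g * fst ka, snd ka)))"
    using fin finite_query_old by (intro card_mono) auto
  also have "\<dots> \<le> card (old x) + card (\<Union>ka\<in>{..<P} \<times> {..<M}. query_old x (o' + g * fst ka, snd ka))"
    by (rule card_Un_le)
  also have "card (\<Union>ka\<in>{..<P} \<times> {..<M}. query_old x (o' + g * fst ka, snd ka)) \<le>
      (\<Sum>ka\<in>{..<P} \<times> {..<M}. card (query_old x (o' + g * fst ka, snd ka)))"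
    by (intro card_UN_le) simp
  also have "\<dots> \<le> (\<Sum>ka\<in>{..<P} \<times> {..<M}. card (rd D (sched x (Yq (fst ka) (snd ka))) m0 slot))"
    by (intro sum_mono card_query_old_le)
  also have "\<dots> = (\<Sum>k<P. \<Sum>a<M. card (rd D (sched x (Yq k a)) m0 slot))"
    by (simp add: sum.cartesian_product case_prod_unfold)
  finally show ?thesis by simp
qed

text \<open>Summands of the load that do not depend on the query at the slot, such as the one with
  \<open>T x\<close>, are constant under the sum, and the factor \<open>P * M\<close> cancels. The
  others are summed over all hypothetical queries, which gives \<open>bad x\<close> and the query
  part of \<open>R x\<close>.\<close>

lemma light_bounds:
  fixes tq e :: real
  assumes "0 < tq" "0 < d"
    and light: "(\<Sum>k<P. \<Sum>a<M. load tq i t s x (Yq k a)) \<le> e * (P * M)"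
  shows "card (T x) \<le> e * tq * (L * Kq) / d" "card (bad x) \<le> e * tq * (P * M) / d"
    "card (R x) \<le> e * tq * (L * Kq) + e * tq * (P * M)" "card (W x) \<le> e * tq * (P * Kq)"
proof -
  define \<tau> \<rho> \<kappa> where "\<tau> k a = real (card (transfer x (Yq k a) i t slot))"
    and "\<rho> k a = real (card (rd D (sched x (Yq k a)) m0 slot))"
    and "\<kappa> k a = load tq i t s x (Yq k a)" for k a
  have load: "(card (T x) / (L * Kq) + \<tau> k a) * (d / tq) +
      (card (old x) / (L * Kq) + \<rho> k a + card (W x) / (P * Kq)) / tq \<le> \<kappa> k a" for k a
    unfolding load_def \<kappa>_def L_def[symmetric] P_def[symmetric] \<tau>_def \<rho>_def slot_def[symmetric]
    using card_T_le[of x k a] card_old_le[of x k a] card_W_le[of x k a] assms(1)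
    by (intro add_mono mult_right_mono divide_right_mono order_refl)
      (simp_all only: of_nat_sum[symmetric] of_nat_le_iff of_nat_0_le_iff less_imp_le divide_nonneg_pos)
  have PM: "0 < real (P * M)" "0 < real (L * Kq)" "0 < real (P * Kq)"
    using P_pos M_pos L_pos Kq_pos by simp_all
  have nonneg: "0 \<le> \<tau> k a" "0 \<le> \<rho> k a" for k a by (simp_all add: \<tau>_def \<rho>_def)
  have dt: "0 < d / tq" using assms by simp
  have total: "(\<Sum>k<P. \<Sum>a<M. h k a) \<le> e * (P * M)" if "\<And>k a. h k a \<le> \<kappa> k a" for h
    by (rule order_trans[OF _ light]) (intro sum_mono that[unfolded \<kappa>_def])
  have const: "c \<le> e" if "\<And>k a. c \<le> \<kappa> k a" for c
  proof -
    have "c * real (P * M) \<le> e * real (P * M)"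
      using total[of "\<lambda>_ _. c", OF that] by (simp add: ac_simps)
    then show ?thesis using PM(1) by (rule mult_right_le_imp_le)
  qed
  have parts: "card (T x) / (L * Kq) * (d / tq) \<le> \<kappa> k a" "\<tau> k a * (d / tq) \<le> \<kappa> k a"
    "card (old x) / (L * Kq) / tq \<le> \<kappa> k a" "\<rho> k a / tq \<le> \<kappa> k a" "card (W x) / (P * Kq) / tq \<le> \<kappa> k a"
    for k a
  proof -
    have "0 \<le> card (T x) / (L * Kq) * (d / tq)" "0 \<le> \<tau> k a * (d / tq)"
      "0 \<le> card (old x) / (L * Kq) / tq" "0 \<le> \<rho> k a / tq" "0 \<le> card (W x) / (P * Kq) / tq"
      using assms(1) nonneg[of k a] by simp_all
    then show "card (T x) / (L * Kq) * (d / tq) \<le> \<kappa> k a" "\<tau> k a * (d / tq) \<le> \<kappa> k a"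
      "card (old x) / (L * Kq) / tq \<le> \<kappa> k a" "\<rho> k a / tq \<le> \<kappa> k a" "card (W x) / (P * Kq) / tq \<le> \<kappa> k a"
      using load[of k a] unfolding distrib_right add_divide_distrib by linarith+
  qed
  have "card (T x) / (L * Kq) * (d / tq) \<le> e" by (rule const) (rule parts(1))
  then show "card (T x) \<le> e * tq * (L * Kq) / d"
    using PM(2) assms by (simp add: field_simps)
  have "card (W x) / (P * Kq) / tq \<le> e" by (rule const) (rule parts(5))
  then show "card (W x) \<le> e * tq * (P * Kq)"
    using PM(3) assms by (simp add: field_simps)
  have "card (old x) / (L * Kq) / tq \<le> e" by (rule const) (rule parts(3))
  then have old: "card (old x) \<le> e * tq * (L * Kq)"
    using PM(2) assms by (simp add: field_simps)
  have "(\<Sum>k<P. \<Sum>a<M. \<rho> k a) / tq \<le> e * (P * M)"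
    using total[of "\<lambda>k a. \<rho> k a / tq", OF parts(4)] by (simp add: sum_divide_distrib[symmetric])
  then have "(\<Sum>k<P. \<Sum>a<M. \<rho> k a) \<le> e * tq * (P * M)"
    using assms by (simp add: field_simps)
  then show "card (R x) \<le> e * tq * (L * Kq) + e * tq * (P * M)"
    using old of_nat_mono[OF card_R_le[of x], where 'a = real] by (simp add: \<rho>_def)
  have "(\<Sum>k<P. \<Sum>a<M. \<tau> k a) * (d / tq) \<le> e * (P * M)"
    using total[of "\<lambda>k a. \<tau> k a * (d / tq)", OF parts(2)] by (simp only: sum_distrib_right)
  then have "(\<Sum>k<P. \<Sum>a<M. \<tau> k a) \<le> e * tq * (P * M) / d"
    using assms by (simp add: field_simps)
  then show "card (bad x) \<le> e * tq * (P * M) / d"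
    using of_nat_mono[OF card_bad_le[of x], where 'a = real] by (simp add: \<tau>_def)
qed

end


section \<open>The counting inequality\<close>

text \<open>The number \<open>c\<close> will be \<open>card I\<close>. By Markov's inequality at
  least half of the permutation tuples on \<open>I\<close> have a load of at most twice the average;
  this explains both 64 = 2 * 32 and the factor 2 in the inequality.\<close>

lemma (in hard) counting_inequality:
  fixes tq :: real
  assumes "0 < tq" "0 < d"
    and cost: "(\<Sum>x\<in>Xs. \<Sum>Y\<in>Ys. real (cost x Y)) \<le> 4 * N * Kq * tq * (card Xs * card Ys)"
  shows "\<exists>L P c t1 t2 r v :: nat. 0 < L \<and> P = L * b \<and> P \<le> N \<and> P \<le> 2 * c \<and>
    t1 \<le> 64 * tq * (L * Kq) / d \<and> t2 \<le> 64 * tq * (P * M) / d \<and>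
    r \<le> 64 * tq * (L * Kq) + 64 * tq * (P * M) \<and> v \<le> 64 * tq * (P * Kq) \<and>
    (\<forall>Q>0. fact M ^ c * (Q - 1) ^ v \<le>
      2 * ((Suc (S * 2 ^ w) ^ t1 * M ^ (L * Kq) * Suc (P * M * M) ^ t2 * fact M) * Q ^ (r + v)))"
proof -
  obtain i t s where its: "i < d" "t \<in> late i" "s < Kq"
    "(\<Sum>x\<in>Xs. \<Sum>Y\<in>Ys. load tq i t s x Y) \<le> 32 * (card Xs * card Ys)"
    using exists_light_slot[OF assms] by blast
  have "t < N" using its(2) by (simp add: late_def)
  then interpret window M N Kq n col C B b d q D m0 i t s
    by unfold_locales (use its in auto)
  let ?X = "I \<rightarrow>\<^sub>E {p. p permutes {..<M}}"
  obtain x0 Y0 o' where frame: "x0 \<in> Xs" "Y0 \<in> Ys" "o' < g"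
    "(\<Sum>z\<in>?X. \<Sum>k<P. \<Sum>a<M.
       load tq i t s (\<lambda>u. if u \<in> I then z u else x0 u) (Y0((t, s) := (o' + g * k, a)))) \<le> 32 * card ?X * (P * M)"
    using exists_frame[of "load tq i t s" 32] its(4) by auto
  interpret certificate M N Kq n col C B b d q D m0 i t s o' x0 Y0
    by unfold_locales (use frame valid_Xs_Ys in auto)
  let ?f = "\<lambda>z. \<Sum>k<P. \<Sum>a<M. load tq i t s (completed z) (Yq k a)"
  let ?G = "{z \<in> ?X. ?f z \<le> 2 * (32 * real (P * M))}"
  have "completed z = (\<lambda>u. if u \<in> I then z u else x0 u)" for z
    by (simp add: completed_def fun_eq_iff)
  then have avg: "(\<Sum>z\<in>?X. ?f z) \<le> (32 * real (P * M)) * card ?X"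
    using frame(4) by (simp add: Yq_def ac_simps)
  have fin: "finite ?X" by (intro finite_PiE) (auto simp: I_def finite_permutations)
  have nonneg: "0 \<le> ?f z" for z by (intro sum_nonneg load_nonneg assms(1))
  have half: "card ?X \<le> 2 * card ?G"
    using half_le_twice_average[OF fin nonneg avg] P_pos M_pos by simp
  define t1 t2 r v where "t1 = nat \<lfloor>64 * tq * (L * Kq) / d\<rfloor>"
    and "t2 = nat \<lfloor>64 * tq * (P * M) / d\<rfloor>"
    and "r = nat \<lfloor>64 * tq * (L * Kq) + 64 * tq * (P * M)\<rfloor>"
    and "v = nat \<lfloor>64 * tq * (P * Kq)\<rfloor>"
  have bounds: "card (T (completed z)) \<le> t1 \<and> card (bad (completed z)) \<le> t2 \<and>
       card (R (completed z)) \<le> r \<and> card (W (completed z)) \<le> v" if "z \<in> ?G" for z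
  proof -
    have "?f z \<le> 64 * real (P * M)" using that by simp
    from light_bounds[OF assms(1,2) this] show ?thesis
      unfolding t1_def t2_def r_def v_def by (simp add: le_nat_floor)
  qed
  have X: "card ?X = fact M ^ card I"
    by (simp add: card_PiE I_def card_permutations)
  have ineq: "fact M ^ card I * (Q - 1) ^ v \<le>
      2 * ((Suc (S * 2 ^ w) ^ t1 * M ^ (L * Kq) * Suc (P * M * M) ^ t2 * fact M) * Q ^ (r + v))"
    if "0 < Q" for Q
  proof -
    have "card ?G * (Q - 1) ^ v \<le>
        (Suc (S * 2 ^ w) ^ t1 * M ^ (L * Kq) * Suc (P * M * M) ^ t2 * fact M) * Q ^ (r + v)"
      using bounds by (intro certificate_count that) auto
    moreover have "card ?X * (Q - 1) ^ v \<le> 2 * card ?G * (Q - 1) ^ v"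
      using half by (rule mult_le_mono1)
    ultimately show ?thesis unfolding X by (simp only: mult.assoc mult_le_mono2 le_trans)
  qed
  have floor: "real (nat \<lfloor>y\<rfloor>) \<le> y" if "0 \<le> y" for y :: real
    using that by simp
  have "P \<le> N" using g_pos by (simp add: N_eq')
  moreover have "real t1 \<le> 64 * tq * (L * Kq) / d" "real t2 \<le> 64 * tq * (P * M) / d"
    "real r \<le> 64 * tq * (L * Kq) + 64 * tq * (P * M)" "real v \<le> 64 * tq * (P * Kq)"
    unfolding t1_def t2_def r_def v_def using assms(1) by (intro floor; simp)+
  ultimately show ?thesis
    using L_pos P_eq card_I[OF its(2)] ineq by blast
qed

section \<open>Numerical contradiction\<close>

lemma fact_lower_bound: "real M ^ M \<le> exp (real M) * fact M"
proof -
  \<comment> \<open>A single term of the exponential series is at most its sum.\<close>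
  have "real M ^ M /\<^sub>R fact M \<le> (\<Sum>k. real M ^ k /\<^sub>R fact k)"
    using sum_le_suminf[OF sums_summable[OF exp_converges], of "{M}" "real M"] by simp
  also have "\<dots> = exp (real M)" using exp_converges sums_unique by metis
  finally show ?thesis by (simp add: field_simps)
qed

lemma log_fact_lower_bound:
  assumes "0 < M"
  shows "M * (log 2 M - 2) \<le> log 2 (fact M)"
proof -
  have "M * ln M \<le> M + ln (fact M)"
  proof -
    have "ln (real M ^ M) \<le> ln (exp (real M) * fact M)"
      using fact_lower_bound[of M] assms by simp
    then show ?thesis using assms by (simp add: ln_mult ln_realpow)
  qed
  then have "(M * ln M - M) / ln 2 \<le> ln (fact M) / ln 2"
    by (intro divide_right_mono) auto
  moreover have "M * (log 2 M - 2) \<le> (M * ln M - M) / ln 2"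
  proof -
    have "1 \<le> 2 * ln (2 :: real)" using ln2_ge_two_thirds by simp
    then have "1 / ln 2 \<le> (2 :: real)" by (simp add: field_simps)
    then have "M * (1 / ln 2) \<le> M * (2 :: real)" by (intro mult_left_mono) auto
    then show ?thesis by (simp add: log_def right_diff_distrib diff_divide_distrib)
  qed
  ultimately show ?thesis by (simp add: log_def)
qed

text \<open>The price, in bits, of forbidding one of the \<open>Q\<close> values at an
  address.\<close>

lemma log_quotient_le:
  assumes "2 \<le> (Q :: nat)"
  shows "log 2 Q - log 2 (Q - 1 :: nat) \<le> 4 / Q"
proof -
  have Q: "0 < real (Q - 1)" "real (Q - 1) = real Q - 1" using assms by auto
  have "ln Q - ln (real (Q - 1)) = ln (1 + 1 / real (Q - 1))"
  proof -
    have "real Q / real (Q - 1) = 1 + 1 / real (Q - 1)" using Q by (simp add: field_simps)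
    then show ?thesis using ln_div[of "real Q" "real (Q - 1)"] Q assms by simp
  qed
  also have "\<dots> \<le> 1 / real (Q - 1)"
    using Q(1) by (intro ln_add_one_self_le_self) simp
  also have "\<dots> \<le> 2 / Q" using assms Q by (simp add: field_simps)
  finally have "(ln Q - ln (real (Q - 1))) / ln 2 \<le> 2 / Q / ln 2"
    by (intro divide_right_mono) auto
  moreover have "2 / Q / ln 2 \<le> 4 / (Q :: real)"
  proof -
    have "1 \<le> 2 * ln (2 :: real)" using ln2_ge_two_thirds by simp
    then show ?thesis using assms by (simp add: field_simps)
  qed
  ultimately show ?thesis by (simp add: log_def diff_divide_distrib)
qed

text \<open>After taking logarithms everything is compared with \<open>U * l\<close>, where
  \<open>U = P * M\<close>. The entropy of the permutations is at least the fraction 1/32 of it, and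
  each part of the encoding is a smaller fraction. The function \<open>h\<close> has
  \<open>Q = 2 * q\<close> values.\<close>

lemma counting_contradiction:
  fixes b q M N L P c t1 t2 r v S w n B C d :: nat and tq \<epsilon> l :: real
  assumes l: "l = log 2 n" "40 \<le> l" and q: "1 \<le> q" and B: "1 \<le> B"
    and b: "b = 256 * (C + 2) * B * q" and L: "0 < L" and P: "P = L * b" "P \<le> 2 * c" "P * M \<le> n"
    and M: "M \<le> n" "1000 \<le> M" "l / 2 - 1 \<le> log 2 M"
    and S: "S \<le> 2 ^ (C * w)" and w: "w \<le> 2 * B * l"
    and tq: "1 \<le> tq" "tq * log 2 (2 * q) \<le> l / 32000" "tq / d \<le> 1 / 32000"
    and t1: "t1 \<le> 64 * tq * (L * (q * M)) / d" and t2: "t2 \<le> 64 * tq * (P * M) / d"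
    and r: "r \<le> 64 * tq * (L * (q * M)) + 64 * tq * (P * M)" and v: "v \<le> 64 * tq * (P * (q * M))"
    and ineq: "fact M ^ c * (2 * q - 1) ^ v \<le>
      2 * ((Suc (S * 2 ^ w) ^ t1 * M ^ (L * (q * M)) * Suc (P * M * M) ^ t2 * fact M) * (2 * q) ^ (r + v))"
  shows False
proof -
  define U where "U = real P * real M"
  have CB: "1 \<le> (C + 2) * B" using mult_le_mono[of 1 "C + 2" 1 B] B by simp
  have q_b: "256 * q \<le> b" using mult_le_mono1[OF CB, of "256 * q"] by (simp add: b algebra_simps)
  have P_pos: "256 \<le> P" using mult_le_mono[of 1 L 256 b] q_b q L P(1) by simp
  have "256 * 1000 \<le> U" unfolding U_def using P_pos M(2) by (intro mult_mono) auto
  then have U: "1000 \<le> U" by simp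
  have l0: "0 < l" using l(2) by simp
  have n: "2 \<le> n" using M(1,2) by simp
  have log_mono: "log 2 (real x) \<le> log 2 (real y)" if "x \<le> y" "0 < x" for x y :: nat
    by (subst log_le_cancel_iff) (use that in auto)
  have log_Suc: "0 \<le> log 2 (real (Suc k))" for k
    using log_mono[of 1 "Suc k"] by simp
  define lhs rhs where "lhs = fact M ^ c * (2 * q - 1) ^ v"
    and "rhs = 2 * ((Suc (S * 2 ^ w) ^ t1 * M ^ (L * (q * M)) * Suc (P * M * M) ^ t2 * fact M) *
      (2 * q) ^ (r + v))"
  have "0 < lhs" using q by (simp add: lhs_def)
  with ineq have "log 2 (real lhs) \<le> log 2 (real rhs)"
    unfolding lhs_def[symmetric] rhs_def[symmetric] by (rule log_mono)
  moreover have "log 2 (real lhs) = c * log 2 (fact M) + v * log 2 (2 * q - 1 :: nat)"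
    using q unfolding lhs_def of_nat_mult of_nat_power by (simp add: log_mult log_nat_power)
  moreover have "log 2 (real rhs)
    = 1 + (t1 * log 2 (Suc (S * 2 ^ w)) + L * (q * M) * log 2 M + t2 * log 2 (Suc (P * M * M)) + log 2 (fact M))
      + (r + v) * log 2 (2 * q)"
    using q M(2) unfolding rhs_def of_nat_mult[of 2] of_nat_mult of_nat_power
    by (simp add: log_mult log_nat_power algebra_simps del: of_nat_Suc)
  \<comment> \<open>The \<open>fact M\<close> for the full product in the certificate moves to the
    left and lowers \<open>c\<close> by one. The powers for \<open>W\<close> on both sides combine
    to a difference of logarithms.\<close>
  ultimately have main: "(real c - 1) * log 2 (fact M) \<le> 1 + t1 * log 2 (Suc (S * 2 ^ w))
      + L * (q * M) * log 2 M + t2 * log 2 (Suc (P * M * M)) + r * log 2 (2 * q)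
      + v * (log 2 (2 * q) - log 2 (2 * q - 1 :: nat))"
    by (simp add: algebra_simps)
  have lhs: "U * l / 32 \<le> (real c - 1) * log 2 (fact M)"
  proof -
    have "l / 8 \<le> log 2 M - 2" using M(3) l(2) by linarith
    then have "M * (l / 8) \<le> M * (log 2 M - 2)" by (intro mult_left_mono) auto
    also have "\<dots> \<le> log 2 (fact M)" using log_fact_lower_bound M(2) by simp
    finally have "M * (l / 8) \<le> log 2 (fact M)" .
    moreover have "P / 4 \<le> real c - 1" using P(2) P_pos by simp
    ultimately have "P / 4 * (M * (l / 8)) \<le> (real c - 1) * log 2 (fact M)"
      using l0 P_pos by (intro mult_mono) auto
    then show ?thesis by (simp add: U_def)
  qed
  \<comment> \<open>The group has \<open>L * (q * M)\<close> queries; by the choice of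
    \<open>b\<close> this is a small fraction of \<open>U\<close>, with a factor
    \<open>(C + 2) * B\<close> to spare.\<close>
  have LqM: "real (L * (q * M)) \<le> U / (256 * (C + 2) * B)"
  proof -
    have "U = real (L * (q * M)) * (256 * (C + 2) * B)" by (simp add: U_def P(1) b)
    then show ?thesis using B by simp
  qed
  have LqM': "real (L * (q * M)) \<le> U / 256"
  proof -
    have "U / (256 * (C + 2) * B) \<le> U / 256"
    proof (intro divide_left_mono)
      have "256 * 1 \<le> 256 * ((C + 2) * B)" using CB by (rule mult_le_mono2)
      then show "256 \<le> real (256 * (C + 2) * B)" by linarith
    qed (use U B in \<open>auto intro!: mult_pos_pos add_pos_nonneg\<close>)
    then show ?thesis using LqM by linarith
  qed
  have e1: "1 \<le> U * l / 1000"
  proof -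
    have "1000 * 1 \<le> U * l" using U l(2) by (intro mult_mono) auto
    then show ?thesis by simp
  qed
  have tqd: "0 \<le> tq / d" using tq(1) by simp
  \<comment> \<open>A transferred cell costs at most \<open>(C + 1) * w + 1\<close> bits for address
    and content. The factor \<open>(C + 2) * B\<close> of \<open>b\<close> absorbs this, and the
    factor \<open>d\<close> saved in \<open>t1\<close> absorbs \<open>tq\<close>.\<close>
  have e2: "t1 * log 2 (Suc (S * 2 ^ w)) \<le> U * l / 1000"
  proof -
    have "Suc (S * 2 ^ w) \<le> 2 ^ ((C + 1) * w + 1)"
    proof -
      have "S * 2 ^ w \<le> 2 ^ (C * w) * 2 ^ w" using S by (rule mult_le_mono1)
      then have "S * 2 ^ w \<le> 2 ^ ((C + 1) * w)" by (simp add: power_add[symmetric] add.commute)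
      moreover have "(1::nat) \<le> 2 ^ ((C + 1) * w)" by simp
      ultimately have "Suc (S * 2 ^ w) \<le> 2 * 2 ^ ((C + 1) * w)" by linarith
      then show ?thesis by (simp only: Suc_eq_plus1[symmetric] power_Suc)
    qed
    then have "log 2 (Suc (S * 2 ^ w)) \<le> log 2 (real (2 ^ ((C + 1) * w + 1)))"
      by (rule log_mono) simp
    also have "\<dots> = real ((C + 1) * w) + 1"
      unfolding of_nat_power by (subst log_nat_power) simp_all
    finally have "log 2 (Suc (S * 2 ^ w)) \<le> real ((C + 1) * w) + 1" .
    also have "\<dots> \<le> (C + 1) * (2 * B * l) + 2 * B * l"
    proof (intro add_mono)
      show "real ((C + 1) * w) \<le> (C + 1) * (2 * B * l)"
        using w unfolding of_nat_mult by (intro mult_left_mono) auto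
      have "1 * 1 \<le> real (2 * B) * l" using B l(2) by (intro mult_mono) auto
      then show "1 \<le> 2 * B * l" by simp
    qed
    also have "\<dots> = 2 * ((C + 2) * B) * l" by (simp add: algebra_simps)
    finally have log: "log 2 (Suc (S * 2 ^ w)) \<le> 2 * ((C + 2) * B) * l" .
    have "t1 \<le> 64 * (tq / d) * real (L * (q * M))" using t1 by simp
    also have "\<dots> \<le> 64 * (1 / 32000) * (U / (256 * (C + 2) * B))"
      using tq(3) tqd LqM by (intro mult_mono) auto
    finally have "t1 * log 2 (Suc (S * 2 ^ w)) \<le>
        (64 * (1 / 32000) * (U / (256 * (C + 2) * B))) * (2 * ((C + 2) * B) * l)"
      using U by (intro mult_mono log log_Suc) auto
    also have "\<dots> = U * l * (128 / (32000 * 256))"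
    proof -
      define K where "K = real ((C + 2) * B)"
      have K: "real (256 * (C + 2) * B) = 256 * K" "real (2 * ((C + 2) * B)) = 2 * K"
        by (simp_all add: K_def algebra_simps)
      have "K \<noteq> 0" unfolding K_def using CB by linarith
      then show ?thesis unfolding K by simp
    qed
    also have "\<dots> \<le> U * l * (1 / 1000)" using U l0 by (intro mult_left_mono) auto
    finally show ?thesis by simp
  qed
  have log_n: "log 2 m \<le> k * l" if "m \<le> n ^ k" "0 < m" for m k :: nat
  proof -
    have "log 2 m \<le> log 2 (real (n ^ k))" using that by (rule log_mono)
    then show ?thesis using n by (simp add: l(1) log_nat_power)
  qed
  have e3: "L * (q * M) * log 2 M \<le> U * l / 256"
  proof -
    have "log 2 M \<le> l" using log_n[of M 1] M(1,2) by simp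
    then have "L * (q * M) * log 2 M \<le> U / 256 * l"
      using LqM' U M(2) by (intro mult_mono) auto
    then show ?thesis by simp
  qed
  have e4: "t2 * log 2 (Suc (P * M * M)) \<le> U * l * 6 / 1000"
  proof -
    have "P * M * M \<le> n * n" using P(3) M(1) by (intro mult_le_mono)
    moreover have "1 * 1 \<le> n * n" using n by (intro mult_le_mono) auto
    moreover have "2 * (n * n) \<le> n * (n * n)" using n by (rule mult_le_mono1)
    ultimately have "Suc (P * M * M) \<le> n * (n * n)" by linarith
    then have "Suc (P * M * M) \<le> n ^ 3" by (simp add: power3_eq_cube mult.assoc)
    then have log: "log 2 (Suc (P * M * M)) \<le> 3 * l" using log_n[of "Suc (P * M * M)" 3] by simp
    have "t2 \<le> 64 * (tq / d) * U" using t2 by (simp add: U_def)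
    also have "\<dots> \<le> 64 * (1 / 32000) * U" using tq(3) tqd U by (intro mult_mono) auto
    finally have "t2 * log 2 (Suc (P * M * M)) \<le> (64 * (1 / 32000) * U) * (3 * l)"
      using U by (intro mult_mono log log_Suc) auto
    also have "\<dots> = U * l * (6 / 1000)" by simp
    finally show ?thesis by simp
  qed
  have log_q: "1 \<le> log 2 (2 * q)"
  proof -
    have "log 2 2 \<le> log 2 (2 * q)" using q by (subst log_le_cancel_iff) auto
    then show ?thesis by simp
  qed
  \<comment> \<open>A cell that must be a zero of \<open>h\<close> costs
    \<open>log 2 (2 * q)\<close> bits; this is where \<open>tq * log 2 (2 * q)\<close> has to be
    small compared with \<open>l\<close>.\<close>
  have e5: "r * log 2 (2 * q) \<le> U * l * 5 / 1000"
  proof -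
    have "64 * tq * real (L * (q * M)) \<le> 64 * tq * (U / 256)"
      using LqM' tq(1) by (intro mult_left_mono) auto
    moreover have "r \<le> 64 * tq * real (L * (q * M)) + 64 * tq * U"
      using r unfolding U_def of_nat_mult[symmetric] .
    moreover have "0 \<le> tq * U" using tq(1) U by simp
    ultimately have "r \<le> 65 * tq * U" by linarith
    then have "r * log 2 (2 * q) \<le> (65 * tq * U) * log 2 (2 * q)"
      using log_q by (intro mult_right_mono) auto
    also have "\<dots> = 65 * U * (tq * log 2 (2 * q))" by simp
    also have "\<dots> \<le> 65 * U * (l / 32000)" using tq(2) U by (intro mult_left_mono) auto
    also have "\<dots> = U * l * (65 / 32000)" by simp
    also have "\<dots> \<le> U * l * (5 / 1000)" using U l0 by (intro mult_left_mono) auto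
    finally show ?thesis by simp
  qed
  \<comment> \<open>The bound on \<open>v\<close> exceeds \<open>64 * tq * U\<close> by the factor
    \<open>q\<close>, but each cell of \<open>W\<close> loses at most \<open>2 / q\<close>
    bits.\<close>
  have e6: "v * (log 2 (2 * q) - log 2 (2 * q - 1 :: nat)) \<le> U * l * 5 / 1000"
  proof -
    have le: "log 2 (2 * q) - log 2 (2 * q - 1 :: nat) \<le> 2 / q"
      using log_quotient_le[of "2 * q"] q by simp
    have "v * (log 2 (2 * q) - log 2 (2 * q - 1 :: nat)) \<le> v * (2 / q)"
      using le by (intro mult_left_mono) auto
    also have "\<dots> \<le> (64 * tq * (P * (q * M))) * (2 / q)"
      using v by (intro mult_right_mono) auto
    also have "\<dots> = 128 * U * (tq * 1)" using q by (simp add: U_def)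
    also have "\<dots> \<le> 128 * U * (tq * log 2 (2 * q))"
      using log_q tq(1) U by (intro mult_left_mono) auto
    also have "\<dots> \<le> 128 * U * (l / 32000)" using tq(2) U by (intro mult_left_mono) auto
    also have "\<dots> = U * l * (128 / 32000)" by simp
    also have "\<dots> \<le> U * l * (5 / 1000)" using U l0 by (intro mult_left_mono) auto
    finally show ?thesis by simp
  qed
  have "0 < U * l" using U l0 by simp
  \<comment> \<open>The fractions 1/1000, 1/1000, 1/256, 6/1000, 5/1000 and 5/1000 add up to less
    than 1/32.\<close>
  then show False using main lhs e1 e2 e3 e4 e5 e6 by linarith
qed


section \<open>The initial memory\<close>

lemma probes_0_result: "probes p m = 0 \<Longrightarrow> result p m' = result p m"
  by (cases p) auto

lemma query_cost_0_answer:
  assumes "wf_query S w Q" "query_cost Q m = 0"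
  shows "answer Q m' = answer Q m"
proof (cases Q)
  case (Deterministic p)
  then show ?thesis using assms probes_0_result[of p m m'] by simp
next
  case (Nondeterministic T)
  have "probes p m = 0" if "p \<in> T" for p
  proof -
    have "finite ((\<lambda>p. probes p m) ` T)" using assms(1) Nondeterministic by simp
    then have "probes p m \<le> Max ((\<lambda>p. probes p m) ` T)" using that by (intro Max_ge) auto
    then show ?thesis using assms(2) Nondeterministic by simp
  qed
  then have "\<forall>p\<in>T. result p m' = result p m" using probes_0_result by blast
  then show ?thesis using Nondeterministic by simp
qed

lemma
  assumes "wf_data_structure C n B D"
  shows finite_initial_memories: "finite (initial_memories n B D)"
    and initial_memories_nonempty: "initial_memories n B D \<noteq> {}"
proof -
  let ?R = "random_pages D" and ?K = "2 ^ page_bits n B :: nat"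
  have "?R \<subseteq> {..<num_pages D}" using assms by (simp add: wf_data_structure_def Let_def)
  then have fin: "finite ?R" by (rule finite_subset) simp
  have "initial_memories n B D \<subseteq>
      (\<lambda>f a. if a \<in> ?R then f a else init_page D a) ` (?R \<rightarrow>\<^sub>E {..<?K})"
  proof
    fix m assume m: "m \<in> initial_memories n B D"
    show "m \<in> (\<lambda>f a. if a \<in> ?R then f a else init_page D a) ` (?R \<rightarrow>\<^sub>E {..<?K})"
    proof (rule image_eqI)
      show "m = (\<lambda>a. if a \<in> ?R then restrict m ?R a else init_page D a)"
        using m by (auto simp: initial_memories_def)
      show "restrict m ?R \<in> ?R \<rightarrow>\<^sub>E {..<?K}"
        using m by (auto simp: initial_memories_def)
    qed
  qed
  moreover have "finite (?R \<rightarrow>\<^sub>E {..<?K})" using fin by (intro finite_PiE) auto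
  ultimately show "finite (initial_memories n B D)" by (meson finite_imageI finite_subset)
  have "(\<lambda>a. if a \<in> ?R then 0 else init_page D a) \<in> initial_memories n B D"
    by (simp add: initial_memories_def)
  then show "initial_memories n B D \<noteq> {}" by blast
qed

text \<open>The easy direction of Yao's principle: the expected cost is bounded for every single
  sequence, so after exchanging the sums some initial memory is cheap on average over the
  sequences.\<close>

lemma exists_cheap_memory:
  fixes e :: real
  assumes wf: "wf_data_structure C n B D"
    and cost: "amortized_expected_costs n B \<G> D tu tq"
    and fin: "finite A"
    and legal: "\<And>a. a \<in> A \<Longrightarrow> legal_ops n \<G> (xs a) {}"
    and e: "\<And>a. a \<in> A \<Longrightarrow> tu * length (filter (\<lambda>x. \<not> is_query x) (xs a)) +
       tq * length (filter is_query (xs a)) \<le> e"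
  shows "\<exists>m\<in>initial_memories n B D. (\<Sum>a\<in>A. real (total_cost D (xs a) m)) \<le> e * card A"
proof -
  let ?I = "initial_memories n B D"
  note I = finite_initial_memories[OF wf] initial_memories_nonempty[OF wf]
  have pos: "0 < real (card ?I)" using I by (simp add: card_gt_0_iff)
  have "(\<Sum>m\<in>?I. real (total_cost D (xs a) m)) \<le> e * card ?I" if "a \<in> A" for a
  proof -
    have "(\<Sum>m\<in>?I. real (total_cost D (xs a) m)) / card ?I \<le> e"
      using cost[unfolded amortized_expected_costs_def, rule_format, OF legal[OF that]] e[OF that]
      unfolding integral_pmf_of_set[OF I(2,1)] by linarith
    then show ?thesis using pos by (simp add: field_simps)
  qed
  then have "(\<Sum>a\<in>A. \<Sum>m\<in>?I. real (total_cost D (xs a) m)) \<le> (\<Sum>a\<in>A. e * card ?I)"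
    by (intro sum_mono)
  then have "(\<Sum>m\<in>?I. \<Sum>a\<in>A. real (total_cost D (xs a) m)) \<le> (e * card A) * card ?I"
    by (subst sum.swap) (simp add: ac_simps)
  from exists_le_average[OF I this] show ?thesis .
qed

text \<open>A query that probes nothing gives the same answer on every memory, although inserting
  the edge between 0 and 1 changes the correct one. So already the single query on the empty graph
  costs a probe.\<close>

lemma query_time_ge_1:
  assumes solves: "solves_connectivity C n B unions_of_paths D" and n: "2 \<le> n"
    and cost: "amortized_expected_costs n B unions_of_paths D tu tq"
  shows "1 \<le> tq"
proof -
  have wf: "wf_data_structure C n B D" using solves by (simp add: solves_connectivity_def)
  let ?Q = "connected_query D 0 1"
  have empty: "{} \<in> unions_of_paths"
    using edges_in_unions_of_paths[of "{}"] by (simp add: edges_def)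
  have single: "{{0, 1}} \<in> unions_of_paths"
    using edges_in_unions_of_paths[of "{(0, 1)}"] by (simp add: edges_def single_valued_def)
  have legal0: "legal_ops n unions_of_paths [Connected 0 1] {}" using n empty by simp
  obtain m where m: "m \<in> initial_memories n B D" "real (total_cost D [Connected 0 1] m) \<le> tq"
    using exists_cheap_memory[OF wf cost, of "{()}" "\<lambda>_. [Connected 0 1]" tq] legal0 by auto
  have "query_cost ?Q m \<noteq> 0"
  proof
    assume zero: "query_cost ?Q m = 0"
    have "wf_query (num_pages D) (page_bits n B) ?Q"
      using wf n by (simp add: wf_data_structure_def Let_def)
    from query_cost_0_answer[OF this zero]
    have eq: "answer ?Q (memory_after D [Insert 0 1] m) = answer ?Q (memory_after D [] m)"
      by (simp add: memory_after_def)
    have ans: "answer ?Q (memory_after D xs m) \<longleftrightarrow> joined (graph_after xs) 0 1"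
      if "legal_ops n unions_of_paths xs {}" for xs
      using solves m(1) that n unfolding solves_connectivity_def by auto
    have "joined (graph_after [Insert 0 1]) 0 1"
      by (auto simp: joined_def graph_after_def)
    moreover have "\<not> joined (graph_after []) 0 1"
      by (simp add: joined_def graph_after_def)
    ultimately show False
      using ans[of "[Insert 0 1]"] ans[of "[]"] eq n single by simp
  qed
  then show ?thesis using m(2) by simp
qed


section \<open>The lower bound\<close>

text \<open>The constant is 512000 = 2 * 8 * 32000: the 2 is lost in
  \<open>lg n \<le> 2 * l\<close>, the 8 in \<open>l \<le> 8 * (d * log 2 b)\<close>, and
  \<open>counting_contradiction\<close> needs 32000. The remaining factor bounds the quotient of
  \<open>log 2 b\<close> by \<open>lg B + lg (tu / tq)\<close>.\<close>

lemma lower_bound_paths: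
  fixes C n B :: nat and tu tq :: real
  assumes solves: "solves_connectivity C n B unions_of_paths D"
    and amortized: "amortized_expected_costs n B unions_of_paths D tu tq"
    and tu: "0 \<le> tu" and B: "1 \<le> B" and n: "2 ^ 40 \<le> n"
  shows "lg n / (512000 * (5 + log 2 (C + 2))) \<le> tq * (lg B + lg (tu / tq))"
proof (rule ccontr)
  assume neg: "\<not> ?thesis"
  define l a lam where "l = log 2 n" and "a = 5 + log 2 (C + 2)" and "lam = lg B + lg (tu / tq)"
  have less: "tq * lam < lg n / (512000 * a)" using neg by (simp add: a_def lam_def)
  have l: "40 \<le> l"
  proof -
    have "real 40 \<le> log 2 (real n)"
      using of_nat_mono[OF n, where 'a = real] by (intro le_log_of_power) simp_all
    then show ?thesis by (simp add: l_def)
  qed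
  have n2: "2 \<le> n" "1000000 \<le> n" using n by simp_all
  have a: "6 \<le> a"
  proof -
    have "log 2 2 \<le> log 2 (real C + 2)" by (subst log_le_cancel_iff) auto
    then show ?thesis by (simp add: a_def)
  qed
  have tq: "1 \<le> tq" by (rule query_time_ge_1[OF solves n2(1) amortized])
  have ratio: "0 \<le> tu / tq" using tu tq by simp
  have lgB: "1 \<le> lg B" "log 2 B \<le> lg B"
  proof -
    have "log 2 2 \<le> log 2 (2 + real B)" by (subst log_le_cancel_iff) auto
    then show "1 \<le> lg B" by (simp add: lg_def)
    show "log 2 B \<le> lg B" unfolding lg_def using B by (subst log_le_cancel_iff) auto
  qed
  have lgr: "1 \<le> lg (tu / tq)"
  proof -
    have "log 2 2 \<le> log 2 (2 + tu / tq)" using ratio by (subst log_le_cancel_iff) auto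
    then show ?thesis by (simp add: lg_def)
  qed
  have lam: "2 \<le> lam" using lgB lgr by (simp add: lam_def)
  have lgn: "lg n \<le> 2 * l"
  proof -
    have "2 * n \<le> n * n" using n2 by simp
    then have "2 + n \<le> n ^ 2" using n2 unfolding power2_eq_square by linarith
    then have "log 2 (2 + real n) \<le> log 2 (real n ^ 2)"
      using n2 by (subst log_le_cancel_iff) (auto simp flip: of_nat_power of_nat_add)
    then show ?thesis using n2 by (simp add: lg_def l_def log_nat_power)
  qed
  have tqlam: "a * (tq * lam) \<le> l / 256000"
  proof -
    have "tq * lam \<le> 2 * l / (512000 * a)"
      using less lgn a by (smt (verit) divide_right_mono)
    then show ?thesis using a by (simp add: field_simps)
  qed
  have lam_l: "a * lam \<le> l / 256000"
  proof -
    have "a * (1 * lam) \<le> a * (tq * lam)" using tq a lam by (intro mult_left_mono mult_right_mono) auto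
    then show ?thesis using tqlam by simp
  qed

  \<comment> \<open>At least \<open>tu / tq\<close>, so that the updates of a block are paid for by
    its queries; the maximum ensures that there is a query even if updates are cheap.\<close>
  define q where "q = nat \<lceil>max 1 (tu / tq)\<rceil>"
  have q: "1 \<le> q" "tu / tq \<le> q" "q \<le> 2 + tu / tq"
    unfolding q_def using ratio by linarith+
  have log_q: "log 2 q \<le> lg (tu / tq)"
    unfolding lg_def using q ratio by (subst log_le_cancel_iff) auto
  define b where "b = 256 * (C + 2) * B * q"
  have b_pos: "0 < b" using B q by (simp add: b_def)
  have b_ge: "256 \<le> b"
  proof -
    have "256 * (1 * 1 * 1) \<le> 256 * ((C + 2) * B * q)"
      using B q by (intro mult_le_mono2 mult_le_mono) auto
    then show ?thesis unfolding b_def mult.assoc by linarith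
  qed
  \<comment> \<open>Since \<open>lam\<close> is at least 2, the bits of the factor 256 are at most
    \<open>4 * lam\<close>; one more \<open>lam\<close> covers \<open>B\<close> and
    \<open>q\<close>. This is the origin of the 5 in \<open>a\<close>.\<close>
  have log_b: "log 2 b \<le> a * lam" "1 \<le> log 2 b"
  proof -
    define K where "K = log 2 (real (C + 2))"
    have K: "0 \<le> K" "a = 5 + K" by (simp_all add: K_def a_def add.commute)
    have "log 2 b = log 2 256 + K + log 2 B + log 2 q"
      using B q unfolding b_def of_nat_mult K_def by (simp add: log_mult del: distrib_left_numeral)
    moreover have "log 2 (256 :: real) = 8"
      using log_pow_cancel[of "2 :: real" 8] by simp
    ultimately have "log 2 b \<le> 8 + K + lam" using lgB(2) log_q by (simp add: lam_def)
    also have "\<dots> \<le> (4 + K) * 2 + lam" using K(1) by simp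
    also have "\<dots> \<le> (4 + K) * lam + lam"
      using lam K(1) by (intro add_right_mono mult_left_mono) auto
    also have "\<dots> = a * lam" by (simp add: K(2) algebra_simps)
    finally show "log 2 b \<le> a * lam" .
    have "log 2 2 \<le> log 2 (real b)" using b_ge by (subst log_le_cancel_iff) auto
    then show "1 \<le> log 2 b" by simp
  qed
  \<comment> \<open>The largest depth with \<open>4 * b ^ d \<le> sqrt n\<close>; with about
    \<open>sqrt n\<close> rows the \<open>N + 1\<close> layers then fit into \<open>n\<close>
    vertices.\<close>
  define d where "d = nat \<lfloor>(l / 2 - 2) / log 2 b\<rfloor>"
  have "2 \<le> (l / 2 - 2) / log 2 b"
    using log_b lam_l l by (simp add: field_simps)
  then have d: "1 \<le> d" "d \<le> (l / 2 - 2) / log 2 b" "(l / 2 - 2) / log 2 b \<le> 2 * d"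
    unfolding d_def by linarith+
  define N where "N = b ^ d"
  define M where "M = nat \<lfloor>sqrt n\<rfloor>"
  have sqrt: "1000 \<le> sqrt n" using n2 real_sqrt_le_mono[of "1000 ^ 2" n] by simp
  have M: "M \<le> sqrt n" "sqrt n - 1 \<le> M" using sqrt unfolding M_def by linarith+
  have M_ge: "1000 \<le> M" unfolding M_def using sqrt by (simp add: le_nat_floor)
  have log_sqrt: "log 2 (sqrt n) = l / 2"
    using n2 by (simp add: l_def log_def ln_sqrt)
  have sqrt_sqrt: "sqrt n * sqrt n = n" by simp
  have N: "4 * N \<le> sqrt n"
  proof -
    have "d * log 2 b \<le> l / 2 - 2" using d(2) log_b(2) by (simp add: field_simps)
    moreover have "log 2 N = d * log 2 b" using b_pos by (simp add: N_def log_nat_power)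
    moreover have N0: "0 < N" using b_pos by (simp add: N_def)
    then have "log 2 (4 * N) = 2 + log 2 N"
      using log_pow_cancel[of "2 :: real" 2] by (simp add: log_mult)
    ultimately have "log 2 (4 * N) \<le> log 2 (sqrt n)" using log_sqrt by linarith
    then show ?thesis using N0 n2 by simp
  qed
  have size: "Suc N * M \<le> n"
  proof -
    have "real (Suc N) * real M \<le> sqrt n * sqrt n"
      using N M sqrt by (intro mult_mono) auto
    then show ?thesis unfolding sqrt_sqrt of_nat_mult[symmetric] of_nat_le_iff .
  qed
  \<comment> \<open>Extended by the identity, because \<open>permutes\<close> speaks about all
    natural numbers.\<close>
  define col where "col t = (if t < N then digit_rev b d t else t)" for t
  have "bij_betw col {..<N} {..<N}"
  proof -
    have inj: "inj_on col {..<N}"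
      using digit_rev_inj[OF b_pos] by (auto simp: inj_on_def col_def N_def)
    moreover have "col ` {..<N} \<subseteq> {..<N}"
      using digit_rev_less[OF b_pos] by (auto simp: col_def N_def)
    ultimately have "col ` {..<N} = {..<N}" by (simp add: endo_inj_surj)
    with inj show ?thesis by (simp add: bij_betw_def)
  qed
  then have col: "col permutes {..<N}"
    by (rule bij_imp_permutes) (simp add: col_def)
  interpret schedule M N "q * M" n col
    by unfold_locales (use M_ge col size in auto)
  let ?Xs = "{..<N} \<rightarrow>\<^sub>E {p. p permutes {..<M}}"
  let ?Ys = "({..<N} \<times> {..<q * M}) \<rightarrow>\<^sub>E ({..<N} \<times> {..<M})"
  let ?xs = "\<lambda>p. map (sched (fst p) (snd p)) [0..<start N]"
  have wf: "wf_data_structure C n B D" using solves by (simp add: solves_connectivity_def)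
  have "\<exists>m\<in>initial_memories n B D. (\<Sum>p\<in>?Xs \<times> ?Ys. real (total_cost D (?xs p) m))
      \<le> (4 * N * (q * M) * tq) * card (?Xs \<times> ?Ys)"
  proof (rule exists_cheap_memory[OF wf amortized])
    show "finite (?Xs \<times> ?Ys)"
      by (intro finite_cartesian_product finite_PiE) (auto simp: finite_permutations)
    fix p assume "p \<in> ?Xs \<times> ?Ys"
    then have "valid_input (fst p) (snd p)"
      by (auto simp: valid_input_def PiE_iff mem_Times_iff)
    then show "legal_ops n unions_of_paths (?xs p) {}" by (intro legal_sched) simp_all
    \<comment> \<open>The \<open>3 * N * M\<close> updates count for at most
      \<open>3 * N * (q * M) * tq\<close>, and the queries add
      \<open>N * (q * M) * tq\<close>.\<close>
    have "tu \<le> q * tq" using q(2) tq by (simp add: field_simps)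
    then have "tu * (3 * N * M) \<le> q * tq * (3 * N * M)" by (intro mult_right_mono) auto
    then show "tu * length (filter (\<lambda>x. \<not> is_query x) (?xs p)) + tq * length (filter is_query (?xs p))
        \<le> 4 * N * (q * M) * tq"
      unfolding count_updates count_queries by (simp add: algebra_simps)
  qed
  then obtain m0 where m0: "m0 \<in> initial_memories n B D"
    and cost: "(\<Sum>p\<in>?Xs \<times> ?Ys. real (total_cost D (?xs p) m0)) \<le> (4 * N * (q * M) * tq) * card (?Xs \<times> ?Ys)"
    by blast
  interpret hard M N "q * M" n col C B b d q D m0
    by unfold_locales (use solves m0 b_pos q in \<open>auto simp: N_def col_def b_def\<close>)
  have "(\<Sum>x\<in>Xs. \<Sum>Y\<in>Ys. real (hard.cost M N (q * M) col D m0 x Y)) \<le> 4 * N * (q * M) * tq * (card Xs * card Ys)"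
    using cost unfolding Xs_def Ys_def cost_def
    by (simp add: sum.cartesian_product case_prod_unfold card_cartesian_product)
  from counting_inequality[OF _ _ this] tq d(1)
  obtain L P c t1 t2 r v where L: "0 < L" "P = L * b" "P \<le> N" "P \<le> 2 * c"
    and bounds: "t1 \<le> 64 * tq * (L * (q * M)) / d" "t2 \<le> 64 * tq * (P * M) / d"
      "r \<le> 64 * tq * (L * (q * M)) + 64 * tq * (P * M)" "v \<le> 64 * tq * (P * (q * M))"
    and ineq: "\<And>Q. 0 < Q \<Longrightarrow> fact M ^ c * (Q - 1) ^ v \<le>
      2 * ((Suc (S * 2 ^ w) ^ t1 * M ^ (L * (q * M)) * Suc (P * M * M) ^ t2 * fact M) * Q ^ (r + v))"
    by auto
  show False
  proof (rule counting_contradiction[OF l_def l q(1) B b_def L(1,2,4) _ _ M_ge _ _ _ tq _ _ bounds])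
    have "P * M \<le> Suc N * M" using L(3) by (intro mult_le_mono1) simp
    then show "P * M \<le> n" using size by linarith
    show "M \<le> n"
    proof -
      have "1 * M \<le> Suc N * M" by (intro mult_le_mono1) simp
      then show ?thesis using size by linarith
    qed
    show "l / 2 - 1 \<le> log 2 M"
    proof -
      have "sqrt n / 2 \<le> M" using M sqrt by linarith
      then have "log 2 (sqrt n / 2) \<le> log 2 M" using n2 M_ge by (subst log_le_cancel_iff) auto
      moreover have "log 2 (sqrt n / 2) = l / 2 - 1"
        using n2 log_sqrt by (simp add: log_divide)
      ultimately show ?thesis by simp
    qed
    show "S \<le> 2 ^ (C * w)" using wf by (simp add: wf_data_structure_def Let_def)
    show "w \<le> 2 * B * l"
    proof -
      have "0 \<le> lg n" using n2 by (simp add: lg_def)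
      then have "cell_bits n \<le> lg n + 1" unfolding cell_bits_def by linarith
      also have "\<dots> = log 2 (2 * (2 + real n))" by (simp add: lg_def log_mult del: distrib_left_numeral)
      also have "\<dots> \<le> log 2 (real n ^ 2)"
      proof -
        have "2 * (2 + n) \<le> 4 * n" using n2 by simp
        also have "\<dots> \<le> n * n" using n2 by simp
        finally have "2 * (2 + n) \<le> n ^ 2" unfolding power2_eq_square .
        then have "real (2 * (2 + n)) \<le> real (n ^ 2)" by (rule of_nat_mono)
        then show ?thesis using n2 by (subst log_le_cancel_iff) auto
      qed
      also have "\<dots> = 2 * l" using n2 by (simp add: l_def log_nat_power)
      finally have "B * real (cell_bits n) \<le> B * (2 * l)" by (intro mult_left_mono) auto
      then show ?thesis by (simp add: page_bits_def)
    qed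
    have "tq * log 2 (2 * q) \<le> tq * lam"
    proof (rule mult_left_mono)
      have "log 2 (2 * q) = 1 + log 2 q" using q(1) by (simp add: log_mult)
      then show "log 2 (2 * q) \<le> lam" using lgB(1) log_q lam_def by linarith
    qed (use tq in simp)
    also have "\<dots> \<le> a * (tq * lam)" using a tq lam by simp
    also have "\<dots> \<le> l / 256000" by (rule tqlam)
    finally show "tq * log 2 (2 * q) \<le> l / 32000" using l by simp
    show "tq / d \<le> 1 / 32000"
    proof -
      have "l / 4 \<le> l / 2 - 2" using l by simp
      also have "\<dots> \<le> 2 * d * log 2 b" using d(3) log_b(2) by (simp add: field_simps)
      finally have "l \<le> 8 * (d * log 2 b)" by simp
      have "log 2 b * tq \<le> (a * lam) * tq" using log_b(1) tq by (intro mult_right_mono) auto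
      also have "\<dots> \<le> l / 256000" using tqlam by (simp add: ac_simps)
      also have "\<dots> \<le> 8 * (d * log 2 b) / 256000" using \<open>l \<le> 8 * (d * log 2 b)\<close> by simp
      finally have "log 2 b * tq \<le> log 2 b * (d / 32000)" by (simp add: mult.commute)
      then have "tq \<le> d / 32000" by (rule mult_left_le_imp_le) (use log_b(2) in linarith)
      then show ?thesis using d(1) by (simp add: field_simps)
    qed
    show "fact M ^ c * (2 * q - 1) ^ v \<le>
      2 * ((Suc (S * 2 ^ w) ^ t1 * M ^ (L * (q * M)) * Suc (P * M * M) ^ t2 * fact M) * (2 * q) ^ (r + v))"
      using ineq[of "2 * q"] q(1) by simp
  qed
qed

theorem theorem2p5:
  fixes C :: nat
  shows "\<exists>c>0. \<exists>n\<^sub>0. \<forall>n\<ge>n\<^sub>0. \<forall>B\<ge>1. \<forall>\<G>\<in>{UNIV, unions_of_paths}. \<forall>D t\<^sub>u t\<^sub>q.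
           0 \<le> t\<^sub>u \<longrightarrow> 0 < t\<^sub>q \<longrightarrow>
           solves_connectivity C n B \<G> D \<longrightarrow>
           amortized_expected_costs n B \<G> D t\<^sub>u t\<^sub>q \<longrightarrow>
           t\<^sub>q * (lg (real B) + lg (t\<^sub>u / t\<^sub>q)) \<ge> c * lg (real n)"
proof (intro exI[of _ "1 / (512000 * (5 + log 2 (C + 2)))"] conjI exI[of _ "2 ^ 40"] allI ballI impI)
  have "0 \<le> log 2 (real (C + 2))" by simp
  then show "0 < 1 / (512000 * (5 + log 2 (C + 2)))" by (simp add: add_pos_nonneg)
  fix n B :: nat and \<G> D and t\<^sub>u t\<^sub>q :: real
  assume *: "2 ^ 40 \<le> n" "1 \<le> B" "\<G> \<in> {UNIV, unions_of_paths}" "0 \<le> t\<^sub>u"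
    "solves_connectivity C n B \<G> D" "amortized_expected_costs n B \<G> D t\<^sub>u t\<^sub>q"
  \<comment> \<open>A sequence that keeps the graph a union of paths is legal for either class, so a
    structure for all graphs inherits both correctness and cost on the hard sequences.\<close>
  have legal: "legal_ops n \<G> xs {}" if "legal_ops n unions_of_paths xs {}" for xs
    using *(3) that legal_ops_UNIV by auto
  have "solves_connectivity C n B unions_of_paths D"
    using *(5) legal unfolding solves_connectivity_def by blast
  moreover have "amortized_expected_costs n B unions_of_paths D t\<^sub>u t\<^sub>q"
    using *(6) legal unfolding amortized_expected_costs_def by blast
  ultimately have "lg n / (512000 * (5 + log 2 (C + 2))) \<le> t\<^sub>q * (lg B + lg (t\<^sub>u / t\<^sub>q))"
    using lower_bound_paths *(1,2,4) by blast
  then show "1 / (512000 * (5 + log 2 (C + 2))) * lg n \<le> t\<^sub>q * (lg B + lg (t\<^sub>u / t\<^sub>q))" by simp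
qed

end
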